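(* There exist constants $c>0$ and $x_0$ such that for all real $x\ge x_0$, $$c\,x\ \le\ N^+_{\tau}(x):=\#\{n\le x:\ n=k+\tau(k)\text{ for some positive integer }k\}\ \le\ 0.94\,x.$$
   Context: $\tau(n)=\sum_{d\mid n}1$ is the number of positive divisors of $n$; $n$ and $k$ range over positive integers. *)

theory Defs
  imports Complex_Main
begin

(* The value at 0 is 0 (cardinality of an infinite set); only positive arguments matter. *)
definition divisor_tau :: "nat \<Rightarrow> nat" where
  "divisor_tau n = card {d. d dvd n}"

definition N_plus_tau :: "real \<Rightarrow> nat" where
  "N_plus_tau x =
     card {n :: nat. 0 < n \<and> real n \<le> x \<and> (\<exists>k :: nat. 0 < k \<and> n = k + divisor_tau k)}"

end

theory Submission
  imports Defs "HOL-Complex_Analysis.Complex_Analysis" "HOL-Number_Theory.Number_Theory"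
    "HOL-Computational_Algebra.Squarefree"
begin

text \<open>
  Upper bound. For almost all \<open>k\<close> the number \<open>\<tau>(k)\<close> is divisible by 256, so \<open>k\<close> and
  \<open>k + \<tau>(k)\<close> have the same residue modulo 256. Modulo 3, a \<open>k\<close> with \<open>3\<close> dividing \<open>\<tau>(k)\<close> also
  keeps its residue, and otherwise \<open>\<tau>(k)\<close> is \<open>1\<close> or \<open>2\<close> modulo 3 equally often in each
  class. A multiple of 3 has \<open>3\<close> dividing \<open>\<tau>(k)\<close> more often than a number prime to 3, so more \<open>k\<close>
  move into the class 0 modulo 3 than leave it, and the classes 1 and 2 are left with a proportion
  of at least 0.0601 of all integers that are not attained. Equidistribution is the statement that
  \<open>\<psi> f\<close> has mean value 0, where \<open>f(k) \<in> {-1, 0, 1}\<close> is \<open>\<tau>(k)\<close> modulo 3 and \<open>\<psi>\<close> is the real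
  primitive character modulo 3 restricted to odd numbers; since the Dirichlet series of \<open>\<psi> f\<close> is
  \<open>L(3s) / L(s)\<close>, this follows from \<open>L(1 + it) \<noteq> 0\<close> by Newman's Tauberian theorem.

  Lower bound. The map \<open>k \<mapsto> k + \<tau>(k)\<close> is studied on squarefree \<open>k\<close> whose part composed of primes
  up to a small power \<open>z\<close> of \<open>x\<close> is small and has a typical number of prime factors. On
  these, \<open>\<tau>(k)\<close> is a power of 2 taking about \<open>sqrt(log log x)\<close> values, and a collision of \<open>k\<close> with
  \<open>k + h\<close> prescribes the numbers of small prime factors of both. The Brun-Hooley sieve
  bounds the number of such \<open>k\<close> by \<open>O(x / log log x)\<close>, so there are \<open>O(x)\<close> collisions, and the
  Cauchy-Schwarz inequality bounds the size of the image from below.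
\<close>

section \<open>The divisor function and sums over primes\<close>

text \<open>Constants: if the multiples of 3 whose 3-adic valuation is 2 modulo 3 also moved, the
  flows into and out of the class 0 modulo 3 would balance, each coming from a third of the
  integers. These multiples have density 1/13 and stay in place. This 1/13, times 219/256 from the
  prime 2, times a product over the primes from 5 on that is at least 1 - 0.0866, exceeds 0.06,
  whence 0.94.

  Lower bound: the obstacle is uniformity in the difference h of two powers of 2. Such an h can have
  many small prime factors, and a direct sieve bound for k and k + h carries a factor that grows
  with them. Pairs are therefore sorted by the exact sets of small primes dividing k and k + h
  before sieving. The common primes then have total weight 1, and the others give two Poisson-type
  sums, each of relative size 1 / sqrt(log log x); their product compensates the number of pairs of
  values of \<tau>. Primes above z are not sifted, but z is at least a fixed power of x, so
  boundedly many of them divide k, which costs a constant.\<close>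

lemma divisor_tau_mult_coprime:
  assumes "coprime a b"
  shows "divisor_tau (a * b) = divisor_tau a * divisor_tau b"
proof -
  have "bij_betw (\<lambda>(x, y). x * y) ({d. d dvd a} \<times> {d. d dvd b}) {d. d dvd a * b}"
    unfolding bij_betw_def
  proof
    show "inj_on (\<lambda>(x, y). x * y) ({d. d dvd a} \<times> {d. d dvd b})"
    proof (rule inj_onI, clarsimp)
      fix x y x' y' assume *: "x dvd a" "y dvd b" "x' dvd a" "y' dvd b" "x * y = x' * y'"
      have c: "coprime x y'" "coprime x' y" "coprime x y" "coprime x' y'"
        using * assms by (meson coprime_divisors)+
      have "x dvd x'" using *(5) c(1) by (metis coprime_dvd_mult_left_iff dvd_triv_left)
      moreover have "x' dvd x" using *(5) c(2) by (metis coprime_dvd_mult_left_iff dvd_triv_left)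
      moreover have "y dvd y'" using *(5) c(2)
        by (metis coprime_commute coprime_dvd_mult_right_iff dvd_triv_right)
      moreover have "y' dvd y" using *(5) c(1)
        by (metis coprime_commute coprime_dvd_mult_right_iff dvd_triv_right)
      ultimately show "x = x' \<and> y = y'" by (simp add: dvd_antisym)
    qed
    show "(\<lambda>(x, y). x * y) ` ({d. d dvd a} \<times> {d. d dvd b}) = {d. d dvd a * b}"
    proof (intro equalityI subsetI)
      fix d assume "d \<in> {d. d dvd a * b}"
      then obtain x y where "d = x * y" "x dvd a" "y dvd b"
        using division_decomp[of d a b] by auto
      thus "d \<in> (\<lambda>(x, y). x * y) ` ({d. d dvd a} \<times> {d. d dvd b})" by auto
    qed (auto intro: mult_dvd_mono)
  qed
  thus ?thesis
    unfolding divisor_tau_def by (metis bij_betw_same_card card_cartesian_product)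
qed

lemma divisor_tau_prime_power:
  assumes "prime p"
  shows "divisor_tau (p ^ e) = e + 1"
proof -
  have "{d. d dvd p ^ e} = (\<lambda>i. p ^ i) ` {..e}"
    using divides_primepow_nat[OF assms] by auto
  moreover have "inj_on (\<lambda>i. p ^ i) {..e}"
    using assms by (intro inj_onI) (metis power_inject_exp prime_gt_1_nat)
  ultimately show ?thesis by (simp add: divisor_tau_def card_image)
qed

lemma divisor_tau_prime_power_mult:
  assumes "prime p" "\<not> p dvd m"
  shows "divisor_tau (p ^ e * m) = (e + 1) * divisor_tau m"
  using assms divisor_tau_mult_coprime[of "p ^ e" m] divisor_tau_prime_power[of p e]
    prime_imp_coprime[of p m] by simp

lemma divisor_tau_prod_prime_powers:
  assumes "finite P" "\<And>p. p \<in> P \<Longrightarrow> prime p"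
  shows "divisor_tau (\<Prod>p\<in>P. p ^ e p) = (\<Prod>p\<in>P. e p + 1)"
  using assms
proof (induction P)
  case empty
  thus ?case by (simp add: divisor_tau_def)
next
  case (insert q P)
  have "\<not> q dvd (\<Prod>p\<in>P. p ^ e p)"
  proof
    assume "q dvd (\<Prod>p\<in>P. p ^ e p)"
    then obtain p where "p \<in> P" "q dvd p ^ e p"
      using insert by (auto simp: prime_dvd_prod_iff)
    hence "q = p" using insert.prems by (metis insertI1 insertI2 prime_dvd_power primes_dvd_imp_eq)
    thus False using \<open>p \<in> P\<close> insert by blast
  qed
  thus ?case using insert divisor_tau_prime_power_mult[of q] by simp
qed

lemma divisor_tau_eq_prod:
  assumes "n > 0"
  shows "divisor_tau n = (\<Prod>p\<in>prime_factors n. multiplicity p n + 1)"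
proof -
  have "n = (\<Prod>p\<in>prime_factors n. p ^ multiplicity p n)"
    using assms prime_factorization_nat by blast
  thus ?thesis
    using divisor_tau_prod_prime_powers[of "prime_factors n" "\<lambda>p. multiplicity p n"] by auto
qed

lemma divisor_tau_le: "n > 0 \<Longrightarrow> divisor_tau n \<le> n"
proof -
  assume "n > 0"
  hence "{d. d dvd n} \<subseteq> {1..n}" by (auto dest: dvd_imp_le intro: Suc_leI dvd_pos_nat)
  from card_mono[OF _ this] show ?thesis by (simp add: divisor_tau_def)
qed

section \<open>Counting multiples; the Turan variance inequality\<close>

lemma card_multiples:
  assumes "d > 0"
  shows "card {k \<in> {1..X}. d dvd k} = X div (d::nat)"
proof -
  have "{k \<in> {1..X}. d dvd k} = (\<lambda>j. d * j) ` {1..X div d}"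
  proof (intro equalityI subsetI)
    fix k assume "k \<in> {k \<in> {1..X}. d dvd k}"
    then obtain j where j: "k = d * j" "1 \<le> k" "k \<le> X" by auto
    hence "j \<le> X div d" using assms by (metis div_le_mono nonzero_mult_div_cancel_left not_gr0)
    moreover have "1 \<le> j" using j by (cases j) auto
    ultimately show "k \<in> (\<lambda>j. d * j) ` {1..X div d}" using j by auto
  next
    fix k assume "k \<in> (\<lambda>j. d * j) ` {1..X div d}"
    then obtain j where "k = d * j" "j \<in> {1..X div d}" by blast
    hence "k = d * j" "1 \<le> j" "j \<le> X div d" by auto
    moreover from this have "d * j \<le> X"
      using assms by (simp add: less_eq_div_iff_mult_less_eq mult.commute)
    ultimately show "k \<in> {k \<in> {1..X}. d dvd k}" using assms by auto
  qed
  moreover have "inj_on (\<lambda>j. d * j) {1..X div d}" using assms by (auto intro: inj_onI)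
  ultimately show ?thesis by (simp add: card_image)
qed

lemma card_multiples_le: "d > 0 \<Longrightarrow> real (card {k \<in> {1..X}. d dvd k}) \<le> real X / real d"
  by (subst card_multiples) (auto simp: of_nat_div_le_of_nat)

lemma card_multiples_ge: "d > 0 \<Longrightarrow> real (card {k \<in> {1..X}. d dvd k}) \<ge> real X / real d - 1"
proof -
  assume "d > 0"
  hence "real X < real (X div d + 1) * real d"
    by (metis Suc_eq_plus1 dividend_less_div_times less_add_Suc1 mult_Suc of_nat_less_iff of_nat_mult add.commute)
  with \<open>d > 0\<close> show ?thesis by (subst card_multiples) (auto simp: field_simps)
qed

text \<open>After expanding the square, the second moment needs only upper bounds for counts of
  multiples of \<open>p * q\<close>, where the floor is harmless. The first moment enters with a
  negative sign and needs a lower bound, which loses 1 for each prime; this loss is the term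
  \<open>2 * S * real (card P)\<close>, and \<open>real X * S\<close> comes from the
  diagonal.\<close>

lemma turan_variance:
  fixes P :: "nat set" and X :: nat
  assumes "finite P" "\<And>p. p \<in> P \<Longrightarrow> prime p"
  defines "S \<equiv> \<Sum>p\<in>P. 1 / real p"
  shows "(\<Sum>k=1..X. (real (card {p \<in> P. p dvd k}) - S)\<^sup>2) \<le> real X * S + 2 * S * real (card P)"
proof -
  define b where "b p k = (if p dvd k then 1 else (0::real))" for p k :: nat
  have W: "real (card {p \<in> P. p dvd k}) = (\<Sum>p\<in>P. b p k)" for k
    using assms(1) by (simp add: b_def sum.If_cases Int_def)
  have cnt: "(\<Sum>k=1..X. b p k) = real (card {k\<in>{1..X}. p dvd k})" for p
    by (simp add: b_def sum.If_cases Int_def)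
  have pos: "p > 0" if "p \<in> P" for p using assms(2)[OF that] prime_gt_0_nat by blast
  have S0: "S \<ge> 0" unfolding S_def by (intro sum_nonneg) auto
  have one: "(\<Sum>k=1..X. \<Sum>p\<in>P. b p k) \<ge> real X * S - real (card P)"
  proof -
    have "(\<Sum>k=1..X. \<Sum>p\<in>P. b p k) = (\<Sum>p\<in>P. \<Sum>k=1..X. b p k)" by (rule sum.swap)
    also have "\<dots> \<ge> (\<Sum>p\<in>P. real X / real p - 1)"
      unfolding cnt using card_multiples_ge pos by (intro sum_mono) auto
    also have "(\<Sum>p\<in>P. real X / real p - 1) = real X * S - real (card P)"
      by (simp add: S_def sum_subtractf sum_distrib_left)
    finally show ?thesis .
  qed
  have two: "(\<Sum>k=1..X. (\<Sum>p\<in>P. b p k)\<^sup>2) \<le> real X * S\<^sup>2 + real X * S"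
  proof -
    have "(\<Sum>k=1..X. (\<Sum>p\<in>P. b p k)\<^sup>2) = (\<Sum>k=1..X. \<Sum>p\<in>P. \<Sum>q\<in>P. b p k * b q k)"
      by (simp add: power2_eq_square sum_product)
    also have "\<dots> = (\<Sum>p\<in>P. \<Sum>q\<in>P. \<Sum>k=1..X. b p k * b q k)"
      by (subst sum.swap, rule sum.cong[OF refl], rule sum.swap)
    also have "\<dots> \<le> (\<Sum>p\<in>P. \<Sum>q\<in>P. real X / (real p * real q) + (if p = q then real X / real p else 0))"
    proof (intro sum_mono)
      fix p q assume pq: "p \<in> P" "q \<in> P"
      show "(\<Sum>k=1..X. b p k * b q k) \<le> real X / (real p * real q) + (if p = q then real X / real p else 0)"
      proof (cases "p = q")
        case True
        have "(\<Sum>k=1..X. b p k * b q k) = (\<Sum>k=1..X. b p k)" using True by (intro sum.cong) (auto simp: b_def)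
        also have "\<dots> \<le> real X / real p" unfolding cnt using pos pq card_multiples_le by auto
        finally have "(\<Sum>k=1..X. b p k * b q k) \<le> real X / real p" .
        moreover have "0 \<le> real X / (real p * real q)" by simp
        moreover have "(if p = q then real X / real p else 0) = real X / real p" using True by simp
        ultimately show ?thesis by linarith
      next
        case False
        hence "coprime p q" using assms(2) pq primes_coprime by blast
        hence "b p k * b q k = b (p * q) k" for k
          unfolding b_def using divides_mult[of p k q] by (auto dest: dvd_mult_left dvd_mult_right)
        hence "(\<Sum>k=1..X. b p k * b q k) = (\<Sum>k=1..X. b (p*q) k)" by simp
        also have "\<dots> \<le> real X / real (p*q)" unfolding cnt using pos pq by (intro card_multiples_le) auto
        finally show ?thesis using False by simp
      qed
    qed
    also have "\<dots> = real X * S\<^sup>2 + real X * S"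
    proof -
      have "(\<Sum>p\<in>P. \<Sum>q\<in>P. real X / (real p * real q)) = real X * S\<^sup>2"
        unfolding S_def power2_eq_square sum_product by (simp add: sum_distrib_left)
      moreover have "(\<Sum>p\<in>P. \<Sum>q\<in>P. if p = q then real X / real p else 0) = real X * S"
        using assms(1) by (simp add: S_def sum_distrib_left)
      ultimately show ?thesis by (simp add: sum.distrib)
    qed
    finally show ?thesis .
  qed
  have "(\<Sum>k=1..X. (real (card {p \<in> P. p dvd k}) - S)\<^sup>2)
      = (\<Sum>k=1..X. (\<Sum>p\<in>P. b p k)\<^sup>2) - 2 * S * (\<Sum>k=1..X. \<Sum>p\<in>P. b p k) + real X * S\<^sup>2"
    unfolding W by (simp add: power2_diff sum.distrib sum_subtractf sum_distrib_left mult_ac)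
  also have "\<dots> \<le> (real X * S\<^sup>2 + real X * S) - 2 * S * (real X * S - real (card P)) + real X * S\<^sup>2"
    using two mult_left_mono[OF one, of "2 * S"] S0 by linarith
  also have "\<dots> = real X * S + 2 * S * real (card P)" by (simp add: power2_eq_square algebra_simps)
  finally show ?thesis .
qed

lemma turan_deviation:
  fixes P :: "nat set" and X :: nat
  assumes "finite P" "\<And>p. p \<in> P \<Longrightarrow> prime p" and "T > 0"
  defines "S \<equiv> \<Sum>p\<in>P. 1 / real p"
  shows "real (card {k \<in> {1..X}. \<bar>real (card {p \<in> P. p dvd k}) - S\<bar> \<ge> T}) * T\<^sup>2
    \<le> real X * S + 2 * S * real (card P)"
proof -
  let ?A = "{k \<in> {1..X}. \<bar>real (card {p \<in> P. p dvd k}) - S\<bar> \<ge> T}"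
  have "real (card ?A) * T\<^sup>2 = (\<Sum>k\<in>?A. T\<^sup>2)" by simp
  also have "\<dots> \<le> (\<Sum>k\<in>?A. (real (card {p \<in> P. p dvd k}) - S)\<^sup>2)"
    using assms(3) by (intro sum_mono) (auto simp: abs_le_square_iff[symmetric])
  also have "\<dots> \<le> (\<Sum>k=1..X. (real (card {p \<in> P. p dvd k}) - S)\<^sup>2)"
    by (intro sum_mono2) auto
  finally show ?thesis using turan_variance[OF assms(1,2), of X] unfolding S_def by linarith
qed

lemma prod_primes_dvd_iff:
  fixes n :: nat
  assumes "finite P" "\<And>p. p \<in> P \<Longrightarrow> prime p"
  shows "\<Prod>P dvd n \<longleftrightarrow> (\<forall>p\<in>P. p dvd n)"
  using assms
proof (induction P)
  case (insert q P)
  have "coprime q (\<Prod>P)"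
    using insert by (intro prod_coprime_right) (metis insertI1 insertI2 primes_coprime)
  hence "q * \<Prod>P dvd n \<longleftrightarrow> q dvd n \<and> \<Prod>P dvd n"
    by (meson divides_mult dvd_mult_left dvd_mult_right)
  thus ?case using insert by simp
qed auto

section \<open>Chebyshev and Mertens upper bounds on dyadic blocks\<close>

lemma sum_ln_primes_dyadic:
  fixes i :: nat
  shows "(\<Sum>p | prime p \<and> 2 ^ i < p \<and> p \<le> 2 ^ (i + 1). ln (real p)) \<le> 2 ^ (i + 1) * ln 2"
proof -
  let ?m = "2 ^ i :: nat"
  let ?P = "{p. prime p \<and> ?m < p \<and> p \<le> 2 * ?m}"
  have fin: "finite ?P" by (rule finite_subset[of _ "{..2 * ?m}"]) auto
  \<comment> \<open>A prime between \<open>?m\<close> and \<open>2 * ?m\<close> divides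
    \<open>fact (2 * ?m)\<close> but not \<open>fact ?m\<close>, hence it divides the central
    binomial coefficient.\<close>
  have each: "p dvd (2 * ?m choose ?m)" if "p \<in> ?P" for p
  proof -
    have "p dvd fact (2 * ?m)" using that by (subst prime_dvd_fact_iff) auto
    also have "fact (2 * ?m) = fact ?m * fact (2 * ?m - ?m) * (2 * ?m choose ?m)"
      by (rule binomial_fact_lemma[symmetric]) auto
    finally show ?thesis using that prime_dvd_fact_iff[of p ?m] by (auto simp: prime_dvd_mult_iff)
  qed
  have "\<Prod>?P dvd (2 * ?m choose ?m)"
    using each prod_primes_dvd_iff[OF fin] by auto
  hence "\<Prod>?P \<le> (2 * ?m choose ?m)" by (intro dvd_imp_le) auto
  also have "\<dots> \<le> 2 ^ (2 * ?m)" by (rule binomial_le_pow2)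
  finally have "real (\<Prod>?P) \<le> real (2 ^ (2 * ?m))" by (simp only: of_nat_le_iff)
  hence "real (\<Prod>?P) \<le> 2 ^ (2 * ?m)" by simp
  moreover have "real (\<Prod>?P) > 0" using fin by (auto intro!: prod_pos prime_gt_0_nat)
  ultimately have "ln (real (\<Prod>?P)) \<le> ln (2 ^ (2 * ?m))" by (subst ln_le_cancel_iff) auto
  moreover have "ln (real (\<Prod>?P)) = (\<Sum>p\<in>?P. ln (real p))"
    unfolding of_nat_prod using fin by (subst ln_prod) (auto simp: prime_gt_0_nat)
  ultimately show ?thesis by (simp add: ln_realpow)
qed


lemma finite_primes_interval [simp]: "finite {p::nat. prime p \<and> a < p \<and> p \<le> b}"
  by (rule finite_subset[of _ "{..b}"]) auto

lemma finite_primes_le [simp]: "finite {p::nat. prime p \<and> p \<le> b}"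
  by (rule finite_subset[of _ "{..b}"]) auto

lemma sum_primes_blocks:
  fixes f :: "nat \<Rightarrow> real"
  assumes "m \<le> n"
  shows "(\<Sum>p | prime p \<and> 2 ^ m < p \<and> p \<le> 2 ^ n. f p) =
    (\<Sum>i\<in>{m..<n}. \<Sum>p | prime p \<and> 2 ^ i < p \<and> p \<le> 2 ^ (i + 1). f p)"
  using assms
proof (induction n rule: dec_induct)
  case (step n)
  have "{p::nat. prime p \<and> 2 ^ m < p \<and> p \<le> 2 ^ Suc n} =
    {p. prime p \<and> 2 ^ m < p \<and> p \<le> 2 ^ n} \<union> {p. prime p \<and> 2 ^ n < p \<and> p \<le> 2 ^ (n + 1)}"
    using step(1) power_increasing[of m n "2::nat"] power_increasing[of n "Suc n" "2::nat"]
    by (auto elim: le_less_trans[rotated])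
  moreover have "(\<Sum>p\<in>{p. prime p \<and> 2 ^ m < p \<and> p \<le> 2 ^ n} \<union> {p. prime p \<and> 2 ^ n < p \<and> p \<le> 2 ^ (n + 1)}. f p)
     = (\<Sum>p | prime p \<and> 2 ^ m < p \<and> p \<le> 2 ^ n. f p) + (\<Sum>p | prime p \<and> 2 ^ n < p \<and> p \<le> 2 ^ (n + 1). f p)"
    by (rule sum.union_disjoint) auto
  ultimately show ?case using step by simp
next
  case base
  have eq: "{p::nat. prime p \<and> 2 ^ m < p \<and> p \<le> 2 ^ m} = {}" by auto
  show ?case unfolding eq by simp
qed

lemma sum_ln_over_primes_le:
  "(\<Sum>p | prime p \<and> p \<le> 2 ^ n. ln (real p) / real p) \<le> 2 * real n * ln 2"
proof -
  have "{p::nat. prime p \<and> p \<le> 2 ^ n} = {p. prime p \<and> 2 ^ 0 < p \<and> p \<le> 2 ^ n}"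
    by (auto simp: prime_gt_Suc_0_nat)
  hence "(\<Sum>p | prime p \<and> p \<le> 2 ^ n. ln (real p) / real p) =
     (\<Sum>i\<in>{0..<n}. \<Sum>p | prime p \<and> 2 ^ i < p \<and> p \<le> 2 ^ (i + 1). ln (real p) / real p)"
    using sum_primes_blocks[of 0 n "\<lambda>p. ln (real p) / real p"] by simp
  also have "\<dots> \<le> (\<Sum>i\<in>{0..<n}. 2 * ln 2)"
  proof (intro sum_mono)
    fix i
    have "(\<Sum>p | prime p \<and> 2 ^ i < p \<and> p \<le> 2 ^ (i + 1). ln (real p) / real p) \<le>
       (\<Sum>p | prime p \<and> 2 ^ i < p \<and> p \<le> 2 ^ (i + 1). ln (real p) / 2 ^ i)"
      by (intro sum_mono divide_left_mono) (auto simp: prime_gt_0_nat ln_ge_zero prime_ge_1_nat intro!: less_imp_le)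
    also have "\<dots> = (\<Sum>p | prime p \<and> 2 ^ i < p \<and> p \<le> 2 ^ (i + 1). ln (real p)) / 2 ^ i"
      by (simp add: sum_divide_distrib)
    also have "\<dots> \<le> (2 ^ (i + 1) * ln 2) / 2 ^ i"
      by (intro divide_right_mono sum_ln_primes_dyadic) auto
    finally show "(\<Sum>p | prime p \<and> 2 ^ i < p \<and> p \<le> 2 ^ (i + 1). ln (real p) / real p) \<le> 2 * ln 2"
      by simp
  qed
  finally show ?thesis by simp
qed

lemma sum_inverse_primes_dyadic:
  fixes i :: nat
  assumes "i \<ge> 1"
  shows "(\<Sum>p | prime p \<and> 2 ^ i < p \<and> p \<le> 2 ^ (i + 1). 1 / real p) \<le> 2 / real i"
proof -
  have "(\<Sum>p | prime p \<and> 2 ^ i < p \<and> p \<le> 2 ^ (i + 1). 1 / real p) \<le>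
      (\<Sum>p | prime p \<and> 2 ^ i < p \<and> p \<le> 2 ^ (i + 1). ln (real p) / (2 ^ i * (real i * ln 2)))"
  proof (intro sum_mono)
    fix p :: nat assume p: "p \<in> {p. prime p \<and> 2 ^ i < p \<and> p \<le> 2 ^ (i + 1)}"
    have p2: "2 ^ i \<le> real p" using p by auto
    have "ln (2 ^ i) \<le> ln (real p)" using p2 p by (subst ln_le_cancel_iff) (auto simp: prime_gt_0_nat)
    hence "real i * ln 2 \<le> ln (real p)" by (simp add: ln_realpow)
    hence "2 ^ i * (real i * ln 2) \<le> real p * ln (real p)"
      using p2 by (intro mult_mono) auto
    thus "1 / real p \<le> ln (real p) / (2 ^ i * (real i * ln 2))"
      using assms p by (simp add: field_simps prime_gt_0_nat)
  qed
  also have "\<dots> = (\<Sum>p | prime p \<and> 2 ^ i < p \<and> p \<le> 2 ^ (i + 1). ln (real p)) / (2 ^ i * (real i * ln 2))"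
    by (simp add: sum_divide_distrib)
  also have "\<dots> \<le> (2 ^ (i + 1) * ln 2) / (2 ^ i * (real i * ln 2))"
    by (intro divide_right_mono sum_ln_primes_dyadic) auto
  also have "\<dots> = 2 / real i" by simp
  finally show ?thesis .
qed

text \<open>Squaring the endpoint doubles the logarithm, so the reciprocal sum of such a block is
  bounded independently of \<open>j\<close>. These are the blocks on which the sieve
  truncates.\<close>

lemma sum_inverse_primes_block:
  "(\<Sum>p | prime p \<and> 2 ^ 2 ^ j < p \<and> p \<le> 2 ^ 2 ^ (j + 1). 1 / real p) \<le> 2"
proof -
  have "(\<Sum>p | prime p \<and> 2 ^ 2 ^ j < p \<and> p \<le> 2 ^ 2 ^ (j + 1). 1 / real p) =
     (\<Sum>i\<in>{2^j..<2^(j+1)}. \<Sum>p | prime p \<and> 2 ^ i < p \<and> p \<le> 2 ^ (i + 1). 1 / real p)"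
    by (rule sum_primes_blocks) simp
  also have "\<dots> \<le> (\<Sum>i\<in>{2^j..<2^(j+1)::nat}. 2 / 2 ^ j)"
  proof (intro sum_mono)
    fix i :: nat assume i: "i \<in> {2^j..<2^(j+1)}"
    hence i1: "i \<ge> 1" using one_le_power[of "2::nat" j] by (auto intro: order_trans)
    have "2 ^ j \<le> real i" using i by (auto simp flip: of_nat_le_iff)
    hence "2 / real i \<le> 2 / 2 ^ j" by (intro divide_left_mono) (use i1 in auto)
    thus "(\<Sum>p | prime p \<and> 2 ^ i < p \<and> p \<le> 2 ^ (i + 1). 1 / real p) \<le> 2 / 2 ^ j"
      using sum_inverse_primes_dyadic[OF i1] by linarith
  qed
  also have "\<dots> = 2" by simp
  finally show ?thesis .
qed

section \<open>The Brun-Hooley sieve\<close>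

definition esym :: "'a set \<Rightarrow> ('a \<Rightarrow> real) \<Rightarrow> nat \<Rightarrow> real" where
  "esym A v m = (\<Sum>D | D \<subseteq> A \<and> card D = m. \<Prod>p\<in>D. v p)"

text \<open>Inclusion-exclusion cut off before the subsets of size \<open>m\<close>. It is applied
  to negative weights for the signed main term and to nonnegative ones for the error term.\<close>

definition esym_below :: "'a set \<Rightarrow> ('a \<Rightarrow> real) \<Rightarrow> nat \<Rightarrow> real" where
  "esym_below A v m = (\<Sum>D | D \<subseteq> A \<and> card D < m. \<Prod>p\<in>D. v p)"

lemma sum_subsets_insert:
  fixes F :: "'a set \<Rightarrow> real"
  assumes "finite A" "q \<notin> A"
  shows "(\<Sum>D | D \<subseteq> insert q A \<and> Q (card D). F D) =
    (\<Sum>D | D \<subseteq> A \<and> Q (card D). F D) + (\<Sum>D | D \<subseteq> A \<and> Q (Suc (card D)). F (insert q D))"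
proof -
  have eq: "{D. D \<subseteq> insert q A \<and> Q (card D)} =
     {D. D \<subseteq> A \<and> Q (card D)} \<union> insert q ` {D. D \<subseteq> A \<and> Q (Suc (card D))}" (is "?L = ?A \<union> ?B")
  proof (intro equalityI subsetI)
    fix D assume D: "D \<in> ?L"
    show "D \<in> ?A \<union> ?B"
    proof (cases "q \<in> D")
      case True
      have "D - {q} \<subseteq> A" using D by auto
      moreover from this have "finite (D - {q})" using assms(1) finite_subset by blast
      moreover have "insert q (D - {q}) = D" using True by auto
      ultimately have "D - {q} \<subseteq> A \<and> Q (Suc (card (D - {q})))"
        using D card_insert_disjoint[of "D - {q}" q] by auto
      thus ?thesis using \<open>insert q (D - {q}) = D\<close> by (intro UnI2 image_eqI[of _ _ "D - {q}"]) auto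
    qed (use D in auto)
  next
    fix D assume "D \<in> ?A \<union> ?B"
    thus "D \<in> ?L"
    proof
      assume "D \<in> ?B"
      then obtain E where "D = insert q E" "E \<subseteq> A" "Q (Suc (card E))" by auto
      moreover from this have "card (insert q E) = Suc (card E)"
        using assms finite_subset by (subst card_insert_disjoint) auto
      ultimately show ?thesis by auto
    qed auto
  qed
  have inj: "inj_on (insert q) {D. D \<subseteq> A \<and> Q (Suc (card D))}"
    using assms(2) by (intro inj_onI) (metis (mono_tags, lifting) insert_ident mem_Collect_eq subsetD)
  show ?thesis unfolding eq using assms
    by (subst sum.union_disjoint) (auto simp: sum.reindex[OF inj])
qed

lemma esym_insert:
  assumes "finite A" "q \<notin> A"
  shows "esym (insert q A) v (Suc m) = esym A v (Suc m) + v q * esym A v m"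
proof -
  have "(\<Prod>p\<in>insert q D. v p) = v q * (\<Prod>p\<in>D. v p)" if "D \<subseteq> A" for D
    using that assms finite_subset by (subst prod.insert) auto
  thus ?thesis unfolding esym_def
    by (subst sum_subsets_insert[OF assms]) (auto simp: sum_distrib_left intro!: sum.cong)
qed

lemma esym_0 [simp]: "finite A \<Longrightarrow> esym A v 0 = 1"
proof -
  assume "finite A"
  hence "{D. D \<subseteq> A \<and> card D = 0} = {{}}" by (auto dest: finite_subset)
  thus ?thesis by (simp add: esym_def)
qed

lemma esym_below_insert:
  assumes "finite A" "q \<notin> A"
  shows "esym_below (insert q A) v (Suc m) = esym_below A v (Suc m) + v q * esym_below A v m"
proof -
  have "(\<Prod>p\<in>insert q D. v p) = v q * (\<Prod>p\<in>D. v p)" if "D \<subseteq> A" for D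
    using that assms finite_subset by (subst prod.insert) auto
  thus ?thesis unfolding esym_below_def
    by (subst sum_subsets_insert[OF assms]) (auto simp: sum_distrib_left intro!: sum.cong)
qed

lemma esym_below_0 [simp]: "esym_below A v 0 = 0"
  by (simp add: esym_below_def)

lemma esym_empty: "esym {} v m = (if m = 0 then 1 else 0)"
proof -
  have eq: "{D. D \<subseteq> {} \<and> card D = m} = (if m = 0 then {{}} else {})" by auto
  show ?thesis unfolding esym_def eq by simp
qed

lemma esym_below_empty: "esym_below {} v m = (if m = 0 then 0 else 1)"
proof -
  have eq: "{D. D \<subseteq> {} \<and> card D < m} = (if m = 0 then {} else {{}})" by auto
  show ?thesis unfolding esym_below_def eq by simp
qed

lemma esym_le:
  assumes "finite A" "\<And>p. p \<in> A \<Longrightarrow> v p \<ge> 0"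
  shows "esym A v m \<le> (\<Sum>p\<in>A. v p) ^ m / fact m"
  using assms
proof (induction A arbitrary: m)
  case empty
  show ?case by (auto simp: esym_empty)
next
  case (insert q A)
  show ?case
  proof (cases m)
    case 0
    thus ?thesis using insert by simp
  next
    case (Suc n)
    define s where "s = (\<Sum>p\<in>A. v p)"
    have s: "s \<ge> 0" "v q \<ge> 0" unfolding s_def using insert by (auto intro: sum_nonneg)
    \<comment> \<open>Only the terms of degree 0 and 1 in \<open>v q\<close> of the binomial
      expansion are kept.\<close>
    have pw: "s ^ Suc n + real (Suc n) * v q * s ^ n \<le> (v q + s) ^ Suc n"
    proof -
      have "{0, 1} \<subseteq> {..Suc n}" by auto
      have "(v q + s) ^ Suc n = (\<Sum>k\<le>Suc n. real (Suc n choose k) * v q ^ k * s ^ (Suc n - k))"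
        by (rule binomial_ring)
      also have "\<dots> \<ge> (\<Sum>k\<in>{0,1}. real (Suc n choose k) * v q ^ k * s ^ (Suc n - k))"
        using s by (intro sum_mono2) auto
      finally show ?thesis by simp
    qed
    have "esym (insert q A) v (Suc n) = esym A v (Suc n) + v q * esym A v n"
      using insert by (intro esym_insert)
    also have "\<dots> \<le> s ^ Suc n / fact (Suc n) + v q * (s ^ n / fact n)"
      using insert.IH[of "Suc n"] insert.IH[of n] insert.prems s unfolding s_def by (intro add_mono mult_left_mono) auto
    also have "\<dots> = (s ^ Suc n + real (Suc n) * v q * s ^ n) / fact (Suc n)"
    proof -
      have "v q * (s ^ n / fact n) = real (Suc n) * v q * s ^ n / fact (Suc n)"
        by (simp add: fact_Suc del: of_nat_Suc)
      thus ?thesis by (simp add: add_divide_distrib)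
    qed
    also have "\<dots> \<le> (v q + s) ^ Suc n / fact (Suc n)"
      using pw by (intro divide_right_mono) auto
    finally show ?thesis using insert Suc by (simp add: s_def)
  qed
qed

text \<open>The signed remainder obeys the recursion of \<open>esym\<close>: for
  \<open>insert q A\<close>, the remainder of order \<open>Suc n\<close> is that of \<open>A\<close>
  plus \<open>v q\<close> times the remainder of order \<open>n\<close> of \<open>A\<close>.
  Nonnegativity and the bound by \<open>esym A v m\<close> therefore go through one induction
  together.\<close>

lemma bonferroni:
  assumes "finite A" "\<And>p. p \<in> A \<Longrightarrow> 0 \<le> v p \<and> v p \<le> 1"
  shows "0 \<le> (-1) ^ m * ((\<Prod>p\<in>A. 1 - v p) - esym_below A (\<lambda>p. - v p) m) \<and>
    (-1) ^ m * ((\<Prod>p\<in>A. 1 - v p) - esym_below A (\<lambda>p. - v p) m) \<le> esym A v m"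
  using assms
proof (induction A arbitrary: m)
  case empty
  show ?case by (auto simp: esym_empty esym_below_empty)
next
  case (insert q A)
  have prod01: "0 \<le> (\<Prod>p\<in>insert q A. 1 - v p)" "(\<Prod>p\<in>insert q A. 1 - v p) \<le> 1"
    using insert by (auto intro!: prod_nonneg prod_le_1 simp del: prod.insert)
  show ?case
  proof (cases m)
    case 0
    thus ?thesis using prod01 insert by simp
  next
    case (Suc n)
    let ?R = "\<lambda>m. (-1) ^ m * ((\<Prod>p\<in>A. 1 - v p) - esym_below A (\<lambda>p. - v p) m)"
    have v: "0 \<le> v q" using insert by auto
    have eq: "(-1) ^ Suc n * ((\<Prod>p\<in>insert q A. 1 - v p) - esym_below (insert q A) (\<lambda>p. - v p) (Suc n)) =
        ?R (Suc n) + v q * ?R n"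
      using insert(1,2) by (simp add: esym_below_insert algebra_simps)
    have IH: "0 \<le> ?R m \<and> ?R m \<le> esym A v m" for m using insert by auto
    have "0 \<le> v q * ?R n" "v q * ?R n \<le> v q * esym A v n"
      using IH[of n] v by (auto intro: mult_left_mono)
    thus ?thesis unfolding Suc eq esym_insert[OF insert(1,2)] using IH[of "Suc n"] by linarith
  qed
qed

lemma bonferroni_odd:
  assumes "finite A" "\<And>p. p \<in> A \<Longrightarrow> 0 \<le> v p \<and> v p \<le> 1"
  shows "(\<Prod>p\<in>A. 1 - v p) \<le> esym_below A (\<lambda>p. - v p) (2 * b + 1)"
    and "esym_below A (\<lambda>p. - v p) (2 * b + 1) \<le> (\<Prod>p\<in>A. 1 - v p) + esym A v (2 * b + 1)"
  using bonferroni[of A v "2 * b + 1"] assms by auto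

lemma esym_below_le_power:
  assumes "finite A" "\<And>p. p \<in> A \<Longrightarrow> v p \<ge> 0"
  shows "esym_below A v (Suc m) \<le> (1 + (\<Sum>p\<in>A. v p)) ^ m"
  using assms
proof (induction A arbitrary: m)
  case (insert q A)
  define s where "s = (\<Sum>p\<in>A. v p)"
  have s: "s \<ge> 0" "v q \<ge> 0" unfolding s_def using insert by (auto intro: sum_nonneg)
  show ?case
  proof (cases m)
    case 0
    have "esym_below B v (Suc 0) = 1" if "finite B" for B :: "'a set"
    proof -
      have "{D. D \<subseteq> B \<and> card D < Suc 0} = {{}}" using that by (auto dest: finite_subset)
      thus ?thesis by (simp add: esym_below_def)
    qed
    thus ?thesis using insert 0 by simp
  next
    case (Suc n)
    have "esym_below (insert q A) v (Suc m) \<le> (1 + s) ^ m + v q * (1 + s) ^ n"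
      unfolding esym_below_insert[OF insert(1,2)] using insert.IH[of m] insert.IH[of n] insert.prems s Suc unfolding s_def
      by (intro add_mono mult_left_mono) auto
    also have "\<dots> = (1 + s) ^ n * (1 + (v q + s))" by (simp add: Suc algebra_simps)
    also have "\<dots> \<le> (1 + (v q + s)) ^ n * (1 + (v q + s))"
      using s by (intro mult_right_mono power_mono) auto
    finally show ?thesis using insert Suc by (simp add: s_def mult.commute)
  qed
qed (auto simp: esym_below_empty)

text \<open>Hooley's variant of Brun's truncation: sizes are limited separately in each block, so
  that a sum over the family factors into one truncated sum per block.\<close>

definition trunc_family :: "nat \<Rightarrow> (nat \<Rightarrow> 'a set) \<Rightarrow> (nat \<Rightarrow> nat) \<Rightarrow> 'a set set" where
  "trunc_family r P m = {D. D \<subseteq> (\<Union>j<r. P j) \<and> (\<forall>j<r. card (D \<inter> P j) < m j)}"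

lemma finite_trunc_family: "(\<And>j. j < r \<Longrightarrow> finite (P j)) \<Longrightarrow> finite (trunc_family r P m)"
  unfolding trunc_family_def by (rule finite_subset[of _ "Pow (\<Union>j<r. P j)"]) auto

lemma sum_trunc_family:
  fixes v :: "'a \<Rightarrow> real"
  assumes "\<And>j. j < r \<Longrightarrow> finite (P j)" "disjoint_family_on P {..<r}"
  shows "(\<Sum>D\<in>trunc_family r P m. \<Prod>p\<in>D. v p) = (\<Prod>j<r. esym_below (P j) v (m j))"
  using assms
proof (induction r)
  case 0
  have "trunc_family 0 P m = {{}}" by (auto simp: trunc_family_def)
  thus ?case by simp
next
  case (Suc r)
  have dj: "P j \<inter> P r = {}" if "j < r" for j
    using Suc.prems(2) that by (auto simp: disjoint_family_on_def)
  let ?B = "{D. D \<subseteq> P r \<and> card D < m r}"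
  have fin: "finite D" if "D \<in> trunc_family r P m \<or> D \<in> ?B" for D
    using that Suc.prems(1) by (auto simp: trunc_family_def intro: finite_subset)
  have bij: "bij_betw (\<lambda>(D, E). D \<union> E) (trunc_family r P m \<times> ?B) (trunc_family (Suc r) P m)"
  proof (rule bij_betwI[where g = "\<lambda>D. (D \<inter> (\<Union>j<r. P j), D \<inter> P r)"])
    show "(\<lambda>(D, E). D \<union> E) \<in> trunc_family r P m \<times> ?B \<rightarrow> trunc_family (Suc r) P m"
    proof (clarsimp simp: trunc_family_def, intro conjI allI impI)
      fix D E assume D: "D \<subseteq> (\<Union>j<r. P j)" "\<forall>j<r. card (D \<inter> P j) < m j"
        and E: "E \<subseteq> P r" "card E < m r"
      show "D \<subseteq> (\<Union>j<Suc r. P j)" using D by (auto simp: lessThan_Suc)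
      show "E \<subseteq> (\<Union>j<Suc r. P j)" using E by (auto simp: lessThan_Suc)
      fix j assume "j < Suc r"
      show "card ((D \<union> E) \<inter> P j) < m j"
      proof (cases "j = r")
        case True
        hence "(D \<union> E) \<inter> P j = E" using D E dj by blast
        thus ?thesis using E True by simp
      next
        case False
        hence "(D \<union> E) \<inter> P j = D \<inter> P j" using D E dj[of j] \<open>j < Suc r\<close> by auto
        thus ?thesis using D False \<open>j < Suc r\<close> by simp
      qed
    qed
    show "(\<lambda>D. (D \<inter> (\<Union>j<r. P j), D \<inter> P r)) \<in> trunc_family (Suc r) P m \<rightarrow> trunc_family r P m \<times> ?B"
    proof (clarsimp simp: trunc_family_def)
      fix D j assume D: "\<forall>j<Suc r. card (D \<inter> P j) < m j" and "j < r"
      have "D \<inter> (\<Union>j<r. P j) \<inter> P j = D \<inter> P j" using \<open>j < r\<close> by auto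
      thus "card (D \<inter> (\<Union>j<r. P j) \<inter> P j) < m j" using D \<open>j < r\<close> by simp
    qed
  next
    fix x assume "x \<in> trunc_family r P m \<times> ?B"
    then obtain D E where x: "x = (D, E)" "D \<subseteq> (\<Union>j<r. P j)" "E \<subseteq> P r"
      by (auto simp: trunc_family_def)
    have "D \<inter> P r = {}" "E \<inter> (\<Union>j<r. P j) = {}" using x dj by blast+
    thus "(\<lambda>D. (D \<inter> (\<Union>j<r. P j), D \<inter> P r)) ((\<lambda>(D, E). D \<union> E) x) = x"
      using x by auto
  next
    fix D assume "D \<in> trunc_family (Suc r) P m"
    thus "(\<lambda>(D, E). D \<union> E) (D \<inter> (\<Union>j<r. P j), D \<inter> P r) = D"
      by (auto simp: trunc_family_def lessThan_Suc)
  qed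
  have "(\<Sum>D\<in>trunc_family (Suc r) P m. \<Prod>p\<in>D. v p) =
      (\<Sum>(D, E)\<in>trunc_family r P m \<times> ?B. \<Prod>p\<in>D \<union> E. v p)"
    by (subst sum.reindex_bij_betw[OF bij, symmetric]) (simp add: case_prod_unfold)
  also have "\<dots> = (\<Sum>(D, E)\<in>trunc_family r P m \<times> ?B. (\<Prod>p\<in>D. v p) * (\<Prod>p\<in>E. v p))"
  proof (intro sum.cong refl, clarify)
    fix D E assume DE: "D \<in> trunc_family r P m" "E \<subseteq> P r" "card E < m r"
    hence "D \<inter> E = {}" using dj unfolding trunc_family_def by blast
    thus "(\<Prod>p\<in>D \<union> E. v p) = (\<Prod>p\<in>D. v p) * (\<Prod>p\<in>E. v p)"
      using fin DE by (intro prod.union_disjoint) auto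
  qed
  also have "\<dots> = (\<Sum>D\<in>trunc_family r P m. \<Prod>p\<in>D. v p) * esym_below (P r) v (m r)"
    by (simp add: sum_product sum.cartesian_product esym_below_def)
  also have "\<dots> = (\<Prod>j<Suc r. esym_below (P j) v (m j))"
    using Suc.IH Suc.prems by (simp add: disjoint_family_on_def)
  finally show ?case .
qed


section \<open>Counting by residue classes and the sieve inequality\<close>

lemma card_residue_class:
  fixes X M c :: nat
  assumes "M > 0"
  shows "\<bar>real (card {k \<in> {1..X}. [k = c] (mod M)}) - real X / real M\<bar> \<le> 1"
proof -
  \<comment> \<open>Shifting by \<open>s\<close> turns the class of \<open>c\<close> into the
    multiples of \<open>M\<close>.\<close>
  define s where "s = M - c mod M"
  have cM: "c mod M \<le> M" using assms by (simp add: less_imp_le)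
  have cong_iff: "[k = c] (mod M) \<longleftrightarrow> M dvd k + s" for k
  proof -
    have "[k = c] (mod M) \<longleftrightarrow> [k + s = c mod M + s] (mod M)"
      by (metis cong_add_rcancel_nat cong_mod_right)
    also have "c mod M + s = M" using cM by (simp add: s_def)
    also have "[k + s = M] (mod M) \<longleftrightarrow> M dvd k + s" by (auto simp: cong_def mod_eq_0_iff_dvd)
    finally show ?thesis .
  qed
  have "card {k \<in> {1..X}. [k = c] (mod M)} = card {j \<in> {s+1..X+s}. M dvd j}"
  proof (rule bij_betw_same_card[of "\<lambda>k. k + s"], rule bij_betwI[where g = "\<lambda>j. j - s"])
    show "(\<lambda>j. j - s) \<in> {j \<in> {s+1..X+s}. M dvd j} \<rightarrow> {k \<in> {1..X}. [k = c] (mod M)}"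
      unfolding cong_iff by auto
  qed (auto simp: cong_iff)
  also have "{j \<in> {s+1..X+s}. M dvd j} = {j \<in> {1..X+s}. M dvd j} - {j \<in> {1..s}. M dvd j}" by auto
  also have "card \<dots> = (X + s) div M - s div M"
    by (subst card_Diff_subset) (auto simp: card_multiples[OF assms, simplified])
  finally have eq: "real (card {k \<in> {1..X}. [k = c] (mod M)}) = real ((X + s) div M) - real (s div M)"
    by (simp add: of_nat_diff div_le_mono)
  have fl: "real a / real M - 1 < real (a div M) \<and> real (a div M) \<le> real a / real M" for a
    using card_multiples_ge[OF assms, of a] of_nat_div_le_of_nat[of a M, where 'a = real]
      floor_divide_of_nat_eq[of a M, where 'a = real] assms
      real_of_int_floor_gt_diff_one[of "real a / real M"] by auto
  show ?thesis unfolding eq using fl[of "X + s"] fl[of s] by (simp add: add_divide_distrib abs_le_iff)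
qed

text \<open>By the Chinese remainder theorem the conditions split into as many residue classes as
  the product of the \<open>card (\<Omega> p)\<close>, each with an error of at most 1. The extra
  modulus \<open>M\<close> lets the induction absorb one prime at a time.\<close>

lemma card_sieved_residues:
  fixes X M c :: nat and \<Omega> :: "nat \<Rightarrow> nat set"
  assumes "finite D" "M > 0" "\<And>p. p \<in> D \<Longrightarrow> prime p \<and> coprime M p \<and> \<Omega> p \<subseteq> {..<p}"
  shows "\<bar>real (card {k \<in> {1..X}. [k = c] (mod M) \<and> (\<forall>p\<in>D. k mod p \<in> \<Omega> p)})
     - (\<Prod>p\<in>D. real (card (\<Omega> p)) / real p) * (real X / real M)\<bar> \<le> (\<Prod>p\<in>D. real (card (\<Omega> p)))"
  using assms
proof (induction D arbitrary: M c)
  case empty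
  thus ?case using card_residue_class[of M X c] by simp
next
  case (insert q D)
  have q: "prime q" "coprime M q" "\<Omega> q \<subseteq> {..<q}" using insert.prems by auto
  have fin: "finite (\<Omega> q)" using q(3) finite_subset by blast
  have M0: "M * q > 0" using insert.prems q prime_gt_0_nat by auto
  define A where "A a = {k \<in> {1..X}. [k = c] (mod M) \<and> (\<forall>p\<in>D. k mod p \<in> \<Omega> p) \<and> k mod q = a}" for a
  let ?R = "\<Prod>p\<in>D. real (card (\<Omega> p))"
  let ?T = "(\<Prod>p\<in>D. real (card (\<Omega> p)) / real p) * (real X / (real M * real q))"
  have each: "\<bar>real (card (A a)) - ?T\<bar> \<le> ?R" if a: "a \<in> \<Omega> q" for a
  proof -
    obtain x where x: "[x = c] (mod M)" "[x = a] (mod q)"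
      using binary_chinese_remainder_nat[OF q(2), of c a] by auto
    have aq: "a mod q = a" using a q(3) by auto
    have "[k = c] (mod M) \<and> k mod q = a \<longleftrightarrow> [k = x] (mod M * q)" for k
    proof -
      have "k mod q = a \<longleftrightarrow> [k = x] (mod q)" using x(2) aq by (auto simp: cong_def)
      moreover have "[k = c] (mod M) \<longleftrightarrow> [k = x] (mod M)" using x(1) by (auto simp: cong_def)
      ultimately show ?thesis
        using coprime_cong_mult_nat[OF _ _ q(2), of k x] cong_dvd_modulus_nat[of k x "M * q" M]
          cong_dvd_modulus_nat[of k x "M * q" q] by (meson dvd_triv_left dvd_triv_right)
    qed
    hence "A a = {k \<in> {1..X}. [k = x] (mod M * q) \<and> (\<forall>p\<in>D. k mod p \<in> \<Omega> p)}"
      unfolding A_def by blast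
    moreover have "coprime (M * q) p" if "p \<in> D" for p
      using insert.prems insert.hyps that q(1) primes_coprime[of q p] by auto
    ultimately show ?thesis using insert.IH[of "M * q" x] insert.prems M0 by auto
  qed
  have "card {k \<in> {1..X}. [k = c] (mod M) \<and> (\<forall>p\<in>insert q D. k mod p \<in> \<Omega> p)} = card (\<Union>a\<in>\<Omega> q. A a)"
    by (rule arg_cong[of _ _ card]) (auto simp: A_def)
  also have "\<dots> = (\<Sum>a\<in>\<Omega> q. card (A a))"
    by (rule card_UN_disjoint) (auto simp: A_def fin)
  finally have eqc: "card {k \<in> {1..X}. [k = c] (mod M) \<and> (\<forall>p\<in>insert q D. k mod p \<in> \<Omega> p)}
     = (\<Sum>a\<in>\<Omega> q. card (A a))" .
  have "real (card {k \<in> {1..X}. [k = c] (mod M) \<and> (\<forall>p\<in>insert q D. k mod p \<in> \<Omega> p)})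
     - (\<Prod>p\<in>insert q D. real (card (\<Omega> p)) / real p) * (real X / real M)
     = (\<Sum>a\<in>\<Omega> q. real (card (A a)) - ?T)"
  proof -
    have "(\<Prod>p\<in>insert q D. real (card (\<Omega> p)) / real p) * (real X / real M) = real (card (\<Omega> q)) * ?T"
    proof -
      have "(a / b * e) * (x / m) = a * (e * (x / (m * b)))" for a b e x m :: real by (simp add: mult.commute)
      thus ?thesis by (simp only: prod.insert[OF insert.hyps])
    qed
    thus ?thesis using eqc by (simp only: sum_subtractf of_nat_sum sum_constant)
  qed
  also have "\<bar>\<dots>\<bar> \<le> (\<Sum>a\<in>\<Omega> q. ?R)"
    by (rule order_trans[OF sum_abs sum_mono]) (rule each)
  finally show ?case using insert.hyps by simp
qed


text \<open>The indicator of the sifted set is a product of block indicators, each bounded above by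
  a Bonferroni truncation of odd order. All factors are nonnegative, so the product of the
  truncations is an upper bound. Expanding it gives a sum over \<open>trunc_family\<close>; main
  terms and errors then factor over the blocks again.\<close>

theorem brun_hooley:
  fixes X M c r :: nat and \<Omega> P :: "nat \<Rightarrow> nat set" and b :: "nat \<Rightarrow> nat"
  assumes fin: "\<And>j. j < r \<Longrightarrow> finite (P j)" and dj: "disjoint_family_on P {..<r}" and "M > 0"
    and pr: "\<And>j p. j < r \<Longrightarrow> p \<in> P j \<Longrightarrow> prime p \<and> coprime M p \<and> \<Omega> p \<subseteq> {..<p}"
  shows "real (card {k \<in> {1..X}. [k = c] (mod M) \<and> (\<forall>j<r. \<forall>p\<in>P j. k mod p \<notin> \<Omega> p)}) \<le>
     real X / real M * (\<Prod>j<r. esym_below (P j) (\<lambda>p. - (real (card (\<Omega> p)) / real p)) (2 * b j + 1))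
     + (\<Prod>j<r. esym_below (P j) (\<lambda>p. real (card (\<Omega> p))) (2 * b j + 1))"
proof -
  define m where "m j = 2 * b j + 1" for j
  let ?F = "trunc_family r P m"
  let ?K = "{k \<in> {1..X}. [k = c] (mod M)}"
  let ?A = "\<lambda>D. {k \<in> {1..X}. [k = c] (mod M) \<and> (\<forall>p\<in>D. k mod p \<in> \<Omega> p)}"
  define w :: "nat \<Rightarrow> nat \<Rightarrow> real" where "w k p = (if k mod p \<in> \<Omega> p then 1 else 0)" for k p
  let ?S = "{k \<in> {1..X}. [k = c] (mod M) \<and> (\<forall>j<r. \<forall>p\<in>P j. k mod p \<notin> \<Omega> p)}"
  have finF: "finite ?F" using fin by (rule finite_trunc_family)
  have finD: "finite D" if "D \<in> ?F" for D
    using that fin by (auto simp: trunc_family_def intro: finite_subset[of D "\<Union>j<r. P j"])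
  have prD: "prime p \<and> coprime M p \<and> \<Omega> p \<subseteq> {..<p}" if "D \<in> ?F" "p \<in> D" for D p
    using that pr unfolding trunc_family_def by blast
  have ind: "(if k \<in> ?S then 1 else 0) \<le> (\<Sum>D\<in>?F. \<Prod>p\<in>D. - w k p)" if kK: "k \<in> ?K" for k
  proof -
    have "(if k \<in> ?S then 1 else 0) = (\<Prod>j<r. \<Prod>p\<in>P j. 1 - w k p)"
    proof (cases "k \<in> ?S")
      case False
      then obtain j p where "j < r" "p \<in> P j" "k mod p \<in> \<Omega> p" using kK by auto
      hence "(\<Prod>p\<in>P j. 1 - w k p) = 0" using fin by (intro prod_zero) (auto simp: w_def)
      hence "(\<Prod>j<r. \<Prod>p\<in>P j. 1 - w k p) = 0" using \<open>j < r\<close> by (intro prod_zero) auto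
      thus ?thesis using False by (simp only: if_False)
    qed (auto simp: w_def)
    also have "\<dots> \<le> (\<Prod>j<r. esym_below (P j) (\<lambda>p. - w k p) (m j))"
      unfolding m_def using fin
      by (intro prod_mono conjI bonferroni_odd(1) prod_nonneg) (auto simp: w_def)
    also have "\<dots> = (\<Sum>D\<in>?F. \<Prod>p\<in>D. - w k p)"
      using sum_trunc_family[OF fin dj] by simp
    finally show ?thesis .
  qed
  have "real (card ?S) = (\<Sum>k\<in>?K. if k \<in> ?S then 1 else 0)"
  proof -
    have "?K \<inter> ?S = ?S" by auto
    thus ?thesis by (simp add: sum.If_cases del: mem_Collect_eq)
  qed
  also have "\<dots> \<le> (\<Sum>k\<in>?K. \<Sum>D\<in>?F. \<Prod>p\<in>D. - w k p)" by (intro sum_mono ind)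
  also have "\<dots> = (\<Sum>D\<in>?F. \<Sum>k\<in>?K. \<Prod>p\<in>D. - w k p)" by (rule sum.swap)
  also have "\<dots> = (\<Sum>D\<in>?F. (-1) ^ card D * real (card (?A D)))"
  proof (intro sum.cong refl)
    fix D assume D: "D \<in> ?F"
    have "(\<Prod>p\<in>D. - w k p) = (if k \<in> ?A D then (-1) ^ card D else 0)" if kK: "k \<in> ?K" for k
    proof (cases "k \<in> ?A D")
      case True
      thus ?thesis by (simp add: w_def)
    next
      case False
      then obtain p where "p \<in> D" "k mod p \<notin> \<Omega> p" using kK by auto
      hence "(\<Prod>p\<in>D. - w k p) = 0" using finD[OF D] by (intro prod_zero) (auto simp: w_def)
      thus ?thesis using False by simp
    qed
    hence "(\<Sum>k\<in>?K. \<Prod>p\<in>D. - w k p) = (\<Sum>k\<in>?K. if k \<in> ?A D then (-1) ^ card D else 0)"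
      by (intro sum.cong refl) blast
    moreover have "?K \<inter> ?A D = ?A D" by auto
    ultimately show "(\<Sum>k\<in>?K. \<Prod>p\<in>D. - w k p) = (-1) ^ card D * real (card (?A D))"
      by (simp add: sum.If_cases del: mem_Collect_eq)
  qed
  also have "\<dots> \<le> (\<Sum>D\<in>?F. real X / real M * (\<Prod>p\<in>D. - (real (card (\<Omega> p)) / real p))
      + (\<Prod>p\<in>D. real (card (\<Omega> p))))"
  proof (intro sum_mono)
    fix D assume D: "D \<in> ?F"
    let ?u = "\<Prod>p\<in>D. real (card (\<Omega> p)) / real p"
    have "\<bar>real (card (?A D)) - ?u * (real X / real M)\<bar> \<le> (\<Prod>p\<in>D. real (card (\<Omega> p)))"
      using card_sieved_residues[OF finD[OF D] \<open>M > 0\<close> prD[OF D], where X = X and c = c] by auto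
    moreover have "(\<Prod>p\<in>D. - (real (card (\<Omega> p)) / real p)) = (-1) ^ card D * ?u"
      by (rule prod_uminus)
    moreover have "(-1) ^ card D * y \<le> a * b + z"
      if "\<bar>y - t * a\<bar> \<le> z" "b = (-1) ^ card D * t" for a b t y z :: real
      using that by (cases "even (card D)") (auto simp: mult.commute)
    ultimately show "(-1) ^ card D * real (card (?A D)) \<le>
       real X / real M * (\<Prod>p\<in>D. - (real (card (\<Omega> p)) / real p)) + (\<Prod>p\<in>D. real (card (\<Omega> p)))"
      by blast
  qed
  also have "\<dots> = real X / real M * (\<Prod>j<r. esym_below (P j) (\<lambda>p. - (real (card (\<Omega> p)) / real p)) (m j))
     + (\<Prod>j<r. esym_below (P j) (\<lambda>p. real (card (\<Omega> p))) (m j))"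
    by (simp only: sum.distrib sum_distrib_left[symmetric] sum_trunc_family[OF fin dj])
  finally show ?thesis by (simp add: m_def)
qed

section \<open>The sieve with at most two excluded classes per prime\<close>

lemma one_minus_ge_exp:
  fixes u :: real
  assumes "0 \<le> u" "u \<le> 2 / 3"
  shows "exp (- 3 * u) \<le> 1 - u"
proof -
  \<comment> \<open>The product exceeds 1 by \<open>u * (2 - 3 * u)\<close>. The limit
    \<open>2 / 3\<close> is attained by two classes modulo 3.\<close>
  have "1 \<le> (1 - u) * (1 + 3 * u)"
  proof -
    have "0 \<le> u * (2 - 3 * u)" using assms by (intro mult_nonneg_nonneg) auto
    thus ?thesis by (simp add: algebra_simps)
  qed
  also have "\<dots> \<le> (1 - u) * exp (3 * u)"
    using assms exp_ge_add_one_self[of "3 * u"] by (intro mult_left_mono) auto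
  finally have "1 * exp (- 3 * u) \<le> (1 - u) * exp (3 * u) * exp (- 3 * u)"
    by (intro mult_right_mono) auto
  also have "\<dots> = 1 - u" by (simp add: mult.assoc flip: exp_add)
  finally show ?thesis by simp
qed

text \<open>With truncation parameters \<open>J - 1 - j\<close>, the exponents in the error term of
  the sieve add up to less than a multiple of \<open>2 ^ J\<close>.\<close>

lemma sum_reversed_weighted_powers: "(\<Sum>j<J. 2 ^ j * (J - 1 - j)) + J + 1 = (2::nat) ^ J"
proof (induction J)
  case (Suc J)
  have "(\<Sum>j<Suc J. 2 ^ j * (Suc J - 1 - j)) = (\<Sum>j<J. 2 ^ j * (J - 1 - j) + 2 ^ j)"
    by (auto intro!: sum.cong simp: Suc_diff_Suc) (metis Suc_diff_Suc add.commute diff_Suc_eq_diff_pred mult_Suc_right)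
  also have "\<dots> = (\<Sum>j<J. 2 ^ j * (J - 1 - j)) + (2 ^ J - 1)"
    by (simp add: sum.distrib mask_eq_sum_exp_nat lessThan_def)
  finally show ?case using Suc by simp
qed simp

text \<open>Over all integers the product telescopes, and passing to primes only increases it. A
  polynomial lower bound for the sifting density suffices to absorb the error term.\<close>

lemma prod_one_minus_two_over_ge:
  fixes N :: nat
  assumes "N \<ge> 2"
  shows "1 / real N ^ 2 \<le> (\<Prod>n=3..N. 1 - 2 / real n)"
proof -
  have "(\<Prod>n=3..N. 1 - 2 / real n) = 2 / (real N * (real N - 1))"
    using assms
  proof (induction N rule: dec_induct)
    case (step N)
    have "(\<Prod>n=3..Suc N. 1 - 2 / real n) = 2 / (real N * (real N - 1)) * (1 - 2 / real (Suc N))"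
      using step by (subst prod.nat_ivl_Suc') auto
    also have "\<dots> = 2 / (real (Suc N) * (real (Suc N) - 1))"
      using step(1) by (simp add: divide_simps) (simp add: algebra_simps)?
    finally show ?case .
  qed simp
  also have "\<dots> \<ge> 1 / real N ^ 2"
    using assms by (simp add: field_simps power2_eq_square)
  finally show ?thesis .
qed


lemma sum_exp_terms_le:
  fixes x :: real
  assumes "finite A" "inj_on m A" "x \<ge> 0"
  shows "(\<Sum>j\<in>A. x ^ m j / fact (m j)) \<le> exp x"
proof -
  have "(\<Sum>j\<in>A. x ^ m j / fact (m j)) = (\<Sum>n\<in>m ` A. x ^ n /\<^sub>R fact n)"
    using assms by (simp add: sum.reindex divide_inverse mult.commute)
  also have "\<dots> \<le> (\<Sum>n. x ^ n /\<^sub>R fact n)"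
    using assms by (intro sum_le_suminf summable_exp_generic) auto
  finally show ?thesis by (simp add: exp_def)
qed

text \<open>The block with index \<open>j\<close> is truncated with \<open>b j = J - 1 - j\<close>.
  Large primes get few terms, which keeps the error below \<open>2 ^ (8 * 2 ^ J)\<close>, while the
  truncation orders are distinct, so that the relative errors \<open>4 ^ m / fact m\<close> add up
  to at most \<open>exp 4\<close>. A block has reciprocal sum at most 2, hence the sum of
  \<open>u\<close> over it is at most 4 and its product at least \<open>exp (- 12)\<close>. Together
  this gives the constant \<open>exp (exp 12 * exp 4)\<close>.\<close>

theorem sieve_upper_bound:
  fixes X M c J :: nat and \<Omega> :: "nat \<Rightarrow> nat set"
  assumes "finite P" "M > 0"
    and P: "\<And>p. p \<in> P \<Longrightarrow> prime p \<and> 2 < p \<and> p \<le> 2 ^ 2 ^ J \<and> coprime M p"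
    and \<Omega>: "\<And>p. p \<in> P \<Longrightarrow> \<Omega> p \<subseteq> {..<p} \<and> card (\<Omega> p) \<le> 2"
    and X: "real X / real M \<ge> 2 ^ (10 * 2 ^ J)"
  shows "real (card {k \<in> {1..X}. [k = c] (mod M) \<and> (\<forall>p\<in>P. k mod p \<notin> \<Omega> p)}) \<le>
     (exp (exp 16) + 1) * (real X / real M) * (\<Prod>p\<in>P. 1 - real (card (\<Omega> p)) / real p)"
proof -
  define Q where "Q j = {p \<in> P. 2 ^ 2 ^ j < p \<and> p \<le> 2 ^ 2 ^ (j + 1)}" for j
  define b where "b j = J - 1 - j" for j
  define u where "u p = real (card (\<Omega> p)) / real p" for p
  have finQ: "finite (Q j)" for j using assms(1) by (auto simp: Q_def)
  have mono: "(2::nat) ^ 2 ^ i \<le> 2 ^ 2 ^ j" if "i \<le> j" for i j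
    using that by (intro power_increasing) auto
  have djQ: "disjoint_family_on Q {..<J}"
  proof -
    have "Q i \<inter> Q j = {}" if "i < j" for i j
    proof (rule equals0I)
      fix x assume "x \<in> Q i \<inter> Q j"
      hence "x \<le> 2 ^ 2 ^ (i + 1)" "2 ^ 2 ^ j < x" unfolding Q_def by blast+
      thus False using mono[of "i + 1" j] that by linarith
    qed
    thus ?thesis unfolding disjoint_family_on_def by (metis Int_commute nat_neq_iff)
  qed
  have PQ: "P = (\<Union>j<J. Q j)"
  proof (intro equalityI subsetI)
    fix p assume p: "p \<in> P"
    define j where "j = (LEAST j. p \<le> 2 ^ 2 ^ j)"
    have pJ: "p \<le> 2 ^ 2 ^ J" using P[OF p] by blast
    have pj: "p \<le> 2 ^ 2 ^ j" unfolding j_def using pJ by (rule LeastI)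
    have jJ: "j \<le> J" unfolding j_def using pJ by (rule Least_le)
    have j0: "j \<noteq> 0" using pj P[OF p] by (intro notI) auto
    hence "\<not> p \<le> 2 ^ 2 ^ (j - 1)" unfolding j_def by (intro not_less_Least) auto
    moreover have "j - 1 + 1 = j" using j0 by simp
    ultimately have "p \<in> Q (j - 1)" using pj p by (simp only: Q_def mem_Collect_eq not_le simp_thms)
    thus "p \<in> (\<Union>j<J. Q j)" using jJ j0 by (intro UN_I[of "j - 1"]) auto
  qed (auto simp: Q_def)
  have u: "0 \<le> u p" "u p \<le> 2 / 3" "u p \<le> 2 * (1 / real p)" if "p \<in> P" for p
    using P[OF that] \<Omega>[OF that] by (auto simp: u_def field_simps)
  have su: "(\<Sum>p\<in>Q j. u p) \<le> 4" for j
  proof -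
    have "(\<Sum>p\<in>Q j. u p) \<le> (\<Sum>p\<in>Q j. 2 * (1 / real p))"
      using u by (intro sum_mono) (auto simp: Q_def)
    also have "\<dots> = 2 * (\<Sum>p\<in>Q j. 1 / real p)" by (simp add: sum_distrib_left)
    also have "(\<Sum>p\<in>Q j. 1 / real p) \<le> (\<Sum>p | prime p \<and> 2 ^ 2 ^ j < p \<and> p \<le> 2 ^ 2 ^ (j + 1). 1 / real p)"
      using P by (intro sum_mono2) (auto simp: Q_def)
    also have "\<dots> \<le> 2" by (rule sum_inverse_primes_block)
    finally show ?thesis by simp
  qed
  have su0: "0 \<le> (\<Sum>p\<in>Q j. u p)" for j using u by (intro sum_nonneg) (auto simp: Q_def)
  have E: "0 \<le> esym_below (Q j) (\<lambda>p. - u p) (2 * b j + 1) \<and> esym_below (Q j) (\<lambda>p. - u p) (2 * b j + 1)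
      \<le> (\<Prod>p\<in>Q j. 1 - u p) * exp (exp 12 * (4 ^ (2 * b j + 1) / fact (2 * b j + 1)))" for j
  proof -
    define m where "m = 2 * b j + 1"
    have u01: "0 \<le> u p \<and> u p \<le> 1" if "p \<in> Q j" for p using that u[of p] by (auto simp: Q_def)
    have pr0: "0 \<le> (\<Prod>p\<in>Q j. 1 - u p)" using u01 by (intro prod_nonneg) auto
    \<comment> \<open>This lower bound converts the additive Bonferroni error into one relative to
      the product over the block.\<close>
    have "exp (- 12) \<le> exp (\<Sum>p\<in>Q j. - 3 * u p)"
      using su[of j] by (simp add: sum_distrib_left[symmetric] sum_negf)
    also have "\<dots> = (\<Prod>p\<in>Q j. exp (- 3 * u p))" using finQ by (rule exp_sum)
    also have "\<dots> \<le> (\<Prod>p\<in>Q j. 1 - u p)"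
      using u by (intro prod_mono conjI one_minus_ge_exp) (auto simp: Q_def)
    finally have lb: "1 \<le> (\<Prod>p\<in>Q j. 1 - u p) * exp 12"
      by (simp add: exp_minus field_simps)
    have "esym_below (Q j) (\<lambda>p. - u p) m \<le> (\<Prod>p\<in>Q j. 1 - u p) + esym (Q j) u m"
      unfolding m_def using u01 finQ by (intro bonferroni_odd)
    also have "esym (Q j) u m \<le> (\<Sum>p\<in>Q j. u p) ^ m / fact m"
      using u01 finQ by (intro esym_le) auto
    also have "\<dots> \<le> 4 ^ m / fact m" using su su0 by (intro divide_right_mono power_mono) auto
    also have "\<dots> \<le> ((\<Prod>p\<in>Q j. 1 - u p) * exp 12) * (4 ^ m / fact m)"
      using mult_right_mono[OF lb, of "4 ^ m / fact m"] by simp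
    also have "(\<Prod>p\<in>Q j. 1 - u p) + \<dots> = (\<Prod>p\<in>Q j. 1 - u p) * (1 + exp 12 * (4 ^ m / fact m))"
      by (simp add: algebra_simps)
    also have "\<dots> \<le> (\<Prod>p\<in>Q j. 1 - u p) * exp (exp 12 * (4 ^ m / fact m))"
      using pr0 by (intro mult_left_mono) auto
    finally have "esym_below (Q j) (\<lambda>p. - u p) m \<le> (\<Prod>p\<in>Q j. 1 - u p) * exp (exp 12 * (4 ^ m / fact m))"
      by simp
    moreover have "0 \<le> esym_below (Q j) (\<lambda>p. - u p) m"
      unfolding m_def using u01 finQ bonferroni_odd(1)[of "Q j" u "b j"] pr0 by auto
    ultimately show ?thesis by (simp add: m_def)
  qed
  have main: "(\<Prod>j<J. esym_below (Q j) (\<lambda>p. - u p) (2 * b j + 1)) \<le> exp (exp 16) * (\<Prod>p\<in>P. 1 - u p)"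
  proof -
    have "(\<Prod>j<J. esym_below (Q j) (\<lambda>p. - u p) (2 * b j + 1)) \<le>
       (\<Prod>j<J. (\<Prod>p\<in>Q j. 1 - u p) * exp (exp 12 * (4 ^ (2 * b j + 1) / fact (2 * b j + 1))))"
      using E by (intro prod_mono) auto
    also have "\<dots> = (\<Prod>j<J. \<Prod>p\<in>Q j. 1 - u p) * exp (exp 12 * (\<Sum>j<J. 4 ^ (2 * b j + 1) / fact (2 * b j + 1)))"
      by (simp only: prod.distrib exp_sum[OF finite_lessThan, symmetric] sum_distrib_left)
    also have "(\<Prod>j<J. \<Prod>p\<in>Q j. 1 - u p) = (\<Prod>p\<in>P. 1 - u p)"
      unfolding PQ using finQ djQ
      by (intro prod.UNION_disjoint[symmetric]) (auto simp: disjoint_family_on_def)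
    also have "(\<Prod>p\<in>P. 1 - u p) * exp (exp 12 * (\<Sum>j<J. 4 ^ (2 * b j + 1) / fact (2 * b j + 1)))
       \<le> (\<Prod>p\<in>P. 1 - u p) * exp (exp 12 * exp 4)"
    proof (intro mult_left_mono prod_nonneg)
      have "inj_on (\<lambda>j. 2 * b j + 1) {..<J}" by (auto simp: inj_on_def b_def)
      hence "(\<Sum>j<J. 4 ^ (2 * b j + 1) / fact (2 * b j + 1)) \<le> exp (4::real)"
        by (intro sum_exp_terms_le) auto
      thus "exp (exp 12 * (\<Sum>j<J. 4 ^ (2 * b j + 1) / fact (2 * b j + 1))) \<le> exp (exp 12 * exp (4::real))"
        by simp
    qed (use u in force)
    finally show ?thesis by (simp add: mult.commute flip: exp_add)
  qed
  have err: "(\<Prod>j<J. esym_below (Q j) (\<lambda>p. real (card (\<Omega> p))) (2 * b j + 1)) \<le> 2 ^ (8 * 2 ^ J)"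
  proof -
    \<comment> \<open>A block has fewer than \<open>2 ^ 2 ^ (j + 1)\<close> primes with at most two
      classes each, so the base of the power is at most \<open>2 ^ (4 * 2 ^ j)\<close>; the exponent
      is \<open>2 * b j\<close>.\<close>
    have "esym_below (Q j) (\<lambda>p. real (card (\<Omega> p))) (2 * b j + 1) \<le> 2 ^ (8 * (2 ^ j * b j))" for j
    proof -
      define N :: nat where "N = 2 ^ 2 ^ (j + 1)"
      have "Q j \<subseteq> {2..N}" by (auto simp: Q_def N_def prime_ge_2_nat dest!: P)
      hence "card (Q j) \<le> card {2..N}" by (intro card_mono) auto
      moreover have "N \<ge> 1" by (simp add: N_def)
      ultimately have "card (Q j) + 1 \<le> N" by simp
      hence "card (Q j) + 1 \<le> 2 ^ 2 ^ (j + 1)" by (simp only: N_def)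
      hence cQ: "real (card (Q j)) + 1 \<le> 2 ^ 2 ^ (j + 1)"
      proof -
        have "real (card (Q j) + 1) \<le> real (2 ^ 2 ^ (j + 1))"
          using \<open>card (Q j) + 1 \<le> 2 ^ 2 ^ (j + 1)\<close> by (simp only: of_nat_le_iff)
        thus ?thesis by simp
      qed
      have "(\<Sum>p\<in>Q j. real (card (\<Omega> p))) \<le> (\<Sum>p\<in>Q j. 2)"
        using \<Omega> by (intro sum_mono) (auto simp: Q_def)
      hence "1 + (\<Sum>p\<in>Q j. real (card (\<Omega> p))) \<le> 2 * 2 ^ 2 ^ (j + 1)" using cQ by simp
      also have "\<dots> \<le> 2 ^ 2 ^ (j + 1) * 2 ^ 2 ^ (j + 1)"
        by (intro mult_right_mono) (auto intro: self_le_power)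
      also have "\<dots> = (2::real) ^ (4 * 2 ^ j)" by (simp flip: power_add)
      finally have s: "1 + (\<Sum>p\<in>Q j. real (card (\<Omega> p))) \<le> 2 ^ (4 * 2 ^ j)" .
      have "esym_below (Q j) (\<lambda>p. real (card (\<Omega> p))) (Suc (2 * b j)) \<le> (1 + (\<Sum>p\<in>Q j. real (card (\<Omega> p)))) ^ (2 * b j)"
        using finQ by (intro esym_below_le_power) auto
      also have "\<dots> \<le> (2 ^ (4 * 2 ^ j)) ^ (2 * b j)"
        using s sum_nonneg[of "Q j" "\<lambda>p. real (card (\<Omega> p))"] by (intro power_mono) auto
      also have "\<dots> = 2 ^ (8 * (2 ^ j * b j))" by (simp flip: power_mult add: mult_ac)
      finally show ?thesis by simp
    qed
    hence "(\<Prod>j<J. esym_below (Q j) (\<lambda>p. real (card (\<Omega> p))) (2 * b j + 1)) \<le> (\<Prod>j<J. 2 ^ (8 * (2 ^ j * b j)))"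
      by (intro prod_mono) (auto simp: esym_below_def intro!: sum_nonneg prod_nonneg)
    also have "\<dots> = 2 ^ (8 * (\<Sum>j<J. 2 ^ j * b j))" by (simp add: power_sum sum_distrib_left)
    also have "\<dots> \<le> 2 ^ (8 * 2 ^ J)"
      using sum_reversed_weighted_powers[of J] unfolding b_def by (intro power_increasing) auto
    finally show ?thesis .
  qed
  have low: "1 / (2 ^ (2 * 2 ^ J)) \<le> (\<Prod>p\<in>P. 1 - u p)"
  proof -
    have "1 / real (2 ^ 2 ^ J) ^ 2 \<le> (\<Prod>n=3..2 ^ 2 ^ J. 1 - 2 / real n)"
      by (intro prod_one_minus_two_over_ge) (auto intro: self_le_power)
    also have "\<dots> \<le> (\<Prod>p\<in>P. 1 - 2 / real p)"
    proof -
      let ?N = "2 ^ 2 ^ J :: nat"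
      have "P \<subseteq> {3..?N}" using P by fastforce
      hence "(\<Prod>n=3..?N. 1 - 2 / real n) = (\<Prod>n\<in>{3..?N} - P. 1 - 2 / real n) * (\<Prod>p\<in>P. 1 - 2 / real p)"
        by (intro prod.subset_diff) auto
      also have "\<dots> \<le> 1 * (\<Prod>p\<in>P. 1 - 2 / real p)"
        using P by (intro mult_right_mono prod_le_1 prod_nonneg) (fastforce simp: field_simps)+
      finally show ?thesis by simp
    qed
    also have "\<dots> \<le> (\<Prod>p\<in>P. 1 - u p)"
      using u P by (intro prod_mono) (fastforce simp: field_simps)
    finally show ?thesis by (simp add: mult.commute flip: power_mult)
  qed
  have "real (card {k \<in> {1..X}. [k = c] (mod M) \<and> (\<forall>j<J. \<forall>p\<in>Q j. k mod p \<notin> \<Omega> p)}) \<le>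
     real X / real M * (\<Prod>j<J. esym_below (Q j) (\<lambda>p. - u p) (2 * b j + 1))
     + (\<Prod>j<J. esym_below (Q j) (\<lambda>p. real (card (\<Omega> p))) (2 * b j + 1))"
  proof -
    have "prime p \<and> coprime M p \<and> \<Omega> p \<subseteq> {..<p}" if "p \<in> Q j" for j p
      using that P \<Omega> unfolding Q_def by blast
    thus ?thesis unfolding u_def by (intro brun_hooley finQ djQ assms(2))
  qed
  also have "\<dots> \<le> real X / real M * (exp (exp 16) * (\<Prod>p\<in>P. 1 - u p)) + 2 ^ (8 * 2 ^ J)"
    using main err by (intro add_mono mult_left_mono) auto
  \<comment> \<open>Of the 10 in the hypothesis on \<open>X\<close>, 8 pay for the error term and 2
    for the lower bound \<open>low\<close> of the density; the error then costs the
    \<open>+ 1\<close> in the constant.\<close>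
  also have "(2::real) ^ (8 * 2 ^ J) = 2 ^ (10 * 2 ^ J) * (1 / 2 ^ (2 * 2 ^ J))"
    by (simp add: field_simps flip: power_add)
  also have "\<dots> \<le> real X / real M * (\<Prod>p\<in>P. 1 - u p)"
    using X low by (intro mult_mono) auto
  finally have "real (card {k \<in> {1..X}. [k = c] (mod M) \<and> (\<forall>j<J. \<forall>p\<in>Q j. k mod p \<notin> \<Omega> p)}) \<le>
      (exp (exp 16) + 1) * (real X / real M) * (\<Prod>p\<in>P. 1 - u p)"
    by (simp add: algebra_simps)
  moreover have "(\<forall>j<J. \<forall>p\<in>Q j. k mod p \<notin> \<Omega> p) \<longleftrightarrow> (\<forall>p\<in>P. k mod p \<notin> \<Omega> p)" for k
    unfolding PQ by auto
  ultimately show ?thesis by (simp add: u_def)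
qed

section \<open>Euler products\<close>

definition smooth_nats :: "nat set \<Rightarrow> nat set" where
  "smooth_nats P = {n. n > 0 \<and> prime_factors n \<subseteq> P}"

lemma smooth_nats_not_dvd: "m \<in> smooth_nats P \<Longrightarrow> prime q \<Longrightarrow> q \<notin> P \<Longrightarrow> \<not> q dvd m"
  by (auto simp: smooth_nats_def prime_factors_dvd)

lemma abs_summable_on_mult_Times:
  fixes f :: "'a \<Rightarrow> 'c::{real_normed_field,banach}" and g :: "'b \<Rightarrow> 'c"
  assumes "f abs_summable_on A" "g abs_summable_on B"
  shows "(\<lambda>(x, y). f x * g y) abs_summable_on A \<times> B"
    and "((\<lambda>(x, y). f x * g y) has_sum (infsum f A * infsum g B)) (A \<times> B)"
proof -
  have "(\<lambda>(x, y). norm (f x) * norm (g y)) summable_on A \<times> B"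
    using assms
    by (intro summable_on_SigmaI[where g = "\<lambda>x. norm (f x) * infsum (\<lambda>y. norm (g y)) B"])
       (auto intro!: has_sum_cmult_right summable_on_cmult_left)
  thus *: "(\<lambda>(x, y). f x * g y) abs_summable_on A \<times> B"
    by (simp add: case_prod_unfold norm_mult)
  show "((\<lambda>(x, y). f x * g y) has_sum (infsum f A * infsum g B)) (A \<times> B)"
    using assms abs_summable_summable[OF *]
    by (intro has_sum_SigmaI[where g = "\<lambda>x. f x * infsum g B"])
       (auto intro!: has_sum_cmult_right has_sum_cmult_left has_sum_infsum intro: abs_summable_summable)
qed

lemma bij_betw_smooth_nats_insert:
  assumes "prime q" "q \<notin> P"
  shows "bij_betw (\<lambda>(e, m). q ^ e * m) (UNIV \<times> smooth_nats P) (smooth_nats (insert q P))"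
proof (rule bij_betwI[where g = "\<lambda>n. (multiplicity q n, n div q ^ multiplicity q n)"])
  have nd: "\<not> q dvd m" if "m \<in> smooth_nats P" for m
    using that assms by (auto simp: smooth_nats_def prime_factors_dvd)
  have q0: "q > 0" using assms prime_gt_0_nat by blast
  show "(\<lambda>(e, m). q ^ e * m) \<in> UNIV \<times> smooth_nats P \<rightarrow> smooth_nats (insert q P)"
  proof (clarsimp)
    fix e m :: nat assume m: "m \<in> smooth_nats P"
    have "prime_factors (q ^ e * m) \<subseteq> insert q P"
    proof
      fix p assume "p \<in> prime_factors (q ^ e * m)"
      hence "prime p" "p dvd q ^ e * m" by (auto simp: in_prime_factors_iff)
      hence "prime p" "p dvd q ^ e \<or> p dvd m" by (auto simp: prime_dvd_mult_iff)
      thus "p \<in> insert q P"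
        using m assms(1) by (auto simp: smooth_nats_def prime_factors_dvd dest: prime_dvd_power primes_dvd_imp_eq)
    qed
    thus "q ^ e * m \<in> smooth_nats (insert q P)" using m q0 by (simp add: smooth_nats_def)
  qed
  show "(\<lambda>n. (multiplicity q n, n div q ^ multiplicity q n)) \<in> smooth_nats (insert q P) \<rightarrow> UNIV \<times> smooth_nats P"
  proof (clarsimp)
    fix n assume n: "n \<in> smooth_nats (insert q P)"
    define m where "m = n div q ^ multiplicity q n"
    have nm: "n = q ^ multiplicity q n * m" unfolding m_def by (simp add: multiplicity_dvd)
    have "\<not> q dvd m" unfolding m_def using n assms
      by (intro multiplicity_decompose) (auto simp: smooth_nats_def)
    moreover have "prime_factors m \<subseteq> insert q P"
      using n nm by (metis (no_types, lifting) dvd_prime_factors dvd_triv_right mem_Collect_eq not_gr0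
          order.trans smooth_nats_def)
    moreover have "m > 0" using n nm by (auto simp: smooth_nats_def intro: Nat.gr0I)
    ultimately have "m \<in> smooth_nats P" by (auto simp: smooth_nats_def prime_factors_dvd)
    thus "n div q ^ multiplicity q n \<in> smooth_nats P" by (simp add: m_def)
  qed
next
  fix x assume x: "x \<in> (UNIV :: nat set) \<times> smooth_nats P"
  then obtain e m where em: "x = (e, m)" "m \<in> smooth_nats P" by auto
  have "\<not> q dvd m" using em assms by (auto simp: smooth_nats_def prime_factors_dvd)
  hence "multiplicity q (q ^ e * m) = e"
    using assms em by (intro multiplicity_eqI) (auto simp: prime_gt_0_nat)
  thus "(\<lambda>n. (multiplicity q n, n div q ^ multiplicity q n)) ((\<lambda>(e, m). q ^ e * m) x) = x"
    using em assms by (simp add: prime_gt_0_nat)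
next
  fix n assume "n \<in> smooth_nats (insert q P)"
  thus "(\<lambda>(e, m). q ^ e * m) (multiplicity q n, n div q ^ multiplicity q n) = n"
    by (simp add: multiplicity_dvd)
qed

text \<open>By unique factorization \<open>n = q ^ e * m\<close>, a new prime multiplies the sum by
  its local series. Only the local series are assumed summable, so the result covers
  \<open>1 / n\<close>, whose sum over all integers diverges.\<close>

theorem euler_product_finite:
  fixes a :: "nat \<Rightarrow> 'a::{real_normed_field,banach}"
  assumes "finite P" "\<And>p. p \<in> P \<Longrightarrow> prime p" "a 1 = 1"
    and mult: "\<And>p e m. prime p \<Longrightarrow> \<not> p dvd m \<Longrightarrow> a (p ^ e * m) = a (p ^ e) * a m"
    and summ: "\<And>p. p \<in> P \<Longrightarrow> summable (\<lambda>e. norm (a (p ^ e)))"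
  shows "a abs_summable_on smooth_nats P \<and> (a has_sum (\<Prod>p\<in>P. \<Sum>e. a (p ^ e))) (smooth_nats P)"
  using assms(1,2) summ
proof (induction P)
  case empty
  have eq: "smooth_nats {} = {1}"
    by (auto simp: smooth_nats_def prime_factorization_empty_iff)
  show ?case using \<open>a 1 = 1\<close> unfolding eq by (simp add: has_sum_finiteI)
next
  case (insert q P)
  have IH: "a abs_summable_on smooth_nats P" "infsum a (smooth_nats P) = (\<Prod>p\<in>P. \<Sum>e. a (p ^ e))"
    using insert by (auto intro: infsumI)
  have sq: "summable (\<lambda>e. norm (a (q ^ e)))" using insert by auto
  have hs: "((\<lambda>e. a (q ^ e)) has_sum (\<Sum>e. a (q ^ e))) UNIV"
    by (rule norm_summable_imp_has_sum[OF sq summable_sums[OF summable_norm_cancel[OF sq]]])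
  have "((\<lambda>e. norm (a (q ^ e))) has_sum (\<Sum>e. norm (a (q ^ e)))) UNIV"
    using sq by (intro norm_summable_imp_has_sum summable_sums) auto
  hence as: "(\<lambda>e. a (q ^ e)) abs_summable_on UNIV" by (rule has_sum_imp_summable)
  have q: "prime q" "q \<notin> P" using insert by auto
  note bij = bij_betw_smooth_nats_insert[OF q]
  have eq: "a (case x of (e, m) \<Rightarrow> q ^ e * m) = (case x of (e, m) \<Rightarrow> a (q ^ e) * a m)"
    if "x \<in> UNIV \<times> smooth_nats P" for x
    using that mult[OF q(1)] smooth_nats_not_dvd[OF _ q] by auto
  note T = abs_summable_on_mult_Times[OF as IH(1)]
  have "(\<lambda>x. norm (a (case x of (e, m) \<Rightarrow> q ^ e * m))) summable_on UNIV \<times> smooth_nats P \<longleftrightarrow>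
      (\<lambda>x. norm (case x of (e, m) \<Rightarrow> a (q ^ e) * a m)) summable_on UNIV \<times> smooth_nats P"
    by (intro summable_on_cong) (simp only: eq)
  hence 1: "a abs_summable_on smooth_nats (insert q P)"
    using T(1) summable_on_reindex_bij_betw[OF bij, of "\<lambda>n. norm (a n)"] by blast
  have "((\<lambda>x. a (case x of (e, m) \<Rightarrow> q ^ e * m)) has_sum S) (UNIV \<times> smooth_nats P) \<longleftrightarrow>
      ((\<lambda>x. case x of (e, m) \<Rightarrow> a (q ^ e) * a m) has_sum S) (UNIV \<times> smooth_nats P)" for S
    by (intro has_sum_cong) (simp only: eq)
  hence "((\<lambda>x. a (case x of (e, m) \<Rightarrow> q ^ e * m)) has_sum
      ((\<Sum>e. a (q ^ e)) * (\<Prod>p\<in>P. \<Sum>e. a (p ^ e)))) (UNIV \<times> smooth_nats P)"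
    using T(2) unfolding infsumI[OF hs] IH(2) by blast
  hence "(a has_sum ((\<Sum>e. a (q ^ e)) * (\<Prod>p\<in>P. \<Sum>e. a (p ^ e)))) (smooth_nats (insert q P))"
    using has_sum_reindex_bij_betw[OF bij] by blast
  thus ?case using 1 insert by simp
qed

lemma le_imp_smooth_nats: "0 < n \<Longrightarrow> n \<le> N \<Longrightarrow> n \<in> smooth_nats {p. prime p \<and> p \<le> N}"
  by (auto simp: smooth_nats_def prime_factors_dvd dest: dvd_imp_le)

text \<open>Every positive \<open>n \<le> N\<close> has all its prime factors up to
  \<open>N\<close>, so the finite product misses at most the tail of the absolute values. In this
  form, identities between Dirichlet series can be checked one prime at a time.\<close>

theorem euler_product_tendsto:
  fixes a :: "nat \<Rightarrow> 'a::{real_normed_field,banach}"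
  assumes "a 0 = 0" "a 1 = 1" and sum: "summable (\<lambda>n. norm (a n))"
    and mult: "\<And>p e m. prime p \<Longrightarrow> \<not> p dvd m \<Longrightarrow> a (p ^ e * m) = a (p ^ e) * a m"
  shows "(\<lambda>N. \<Prod>p | prime p \<and> p \<le> N. \<Sum>e. a (p ^ e)) \<longlonglongrightarrow> (\<Sum>n. a n)"
proof -
  let ?P = "\<lambda>N. {p::nat. prime p \<and> p \<le> N}"
  let ?E = "\<lambda>N. \<Prod>p\<in>?P N. \<Sum>e. a (p ^ e)"
  have sn: "summable (\<lambda>e. norm (a (p ^ e)))" if "prime p" for p
  proof -
    have "inj (\<lambda>e. p ^ e)" using prime_gt_1_nat[OF that] by (auto intro!: injI)
    from summable_reindex[OF sum this] show ?thesis by (simp add: o_def)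
  qed
  have as: "a abs_summable_on UNIV"
    using sum by (intro has_sum_imp_summable[OF norm_summable_imp_has_sum[of _ "\<Sum>n. norm (a n)"]])
      (auto intro: summable_sums)
  have tot: "(a has_sum (\<Sum>n. a n)) UNIV"
    by (rule norm_summable_imp_has_sum[OF sum summable_sums[OF summable_norm_cancel[OF sum]]])
  have bound: "norm ((\<Sum>n. a n) - ?E N) \<le> (\<Sum>n. norm (a (n + Suc N)))" for N
  proof -
    have E: "(a has_sum ?E N) (smooth_nats (?P N))"
      using sn by (intro euler_product_finite[THEN conjunct2] mult \<open>a 1 = 1\<close>) auto
    have "(a has_sum ((\<Sum>n. a n) - ?E N)) (UNIV - smooth_nats (?P N))"
      using tot E by (intro has_sum_Diff) auto
    hence "norm ((\<Sum>n. a n) - ?E N) = norm (infsum a (UNIV - smooth_nats (?P N)))"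
      by (simp add: infsumI)
    also have "\<dots> \<le> infsum (\<lambda>n. norm (a n)) (UNIV - smooth_nats (?P N))"
      by (intro norm_infsum_bound summable_on_subset_banach[OF as]) auto
    also have "\<dots> \<le> infsum (\<lambda>n. norm (a n)) {Suc N..}"
    proof (rule infsum_mono_neutral)
      fix x assume x: "x \<in> (UNIV - smooth_nats (?P N)) - {Suc N..}"
      \<comment> \<open>The number 0 is never smooth; this is where \<open>a 0 = 0\<close>
        enters.\<close>
      hence "x = 0" using le_imp_smooth_nats[of x N] by auto
      thus "norm (a x) \<le> 0" using assms(1) by simp
    qed (auto intro: summable_on_subset_banach[OF as])
    also have "infsum (\<lambda>n. norm (a n)) {Suc N..} = (\<Sum>n. norm (a (n + Suc N)))"
    proof -
      have bij: "bij_betw (\<lambda>n. n + Suc N) UNIV {Suc N..}"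
        by (rule bij_betwI[where g = "\<lambda>n. n - Suc N"]) auto
      have "((\<lambda>n. norm (a (n + Suc N))) has_sum (\<Sum>n. norm (a (n + Suc N)))) UNIV"
      proof -
        have "summable (\<lambda>n. norm (a (n + Suc N)))" using sum summable_iff_shift[of "\<lambda>n. norm (a n)"] by blast
        thus ?thesis by (intro norm_summable_imp_has_sum summable_sums) auto
      qed
      thus ?thesis using infsum_reindex_bij_betw[OF bij, of "\<lambda>n. norm (a n)"] by (simp add: infsumI)
    qed
    finally show ?thesis .
  qed
  have "(\<lambda>N. \<Sum>n. norm (a (n + Suc N))) \<longlonglongrightarrow> 0"
    using suminf_exist_split2[OF sum] by (intro LIMSEQ_Suc[where f = "\<lambda>N. \<Sum>n. norm (a (n + N))"]) simp
  hence "(\<lambda>N. (\<Sum>n. a n) - ?E N) \<longlonglongrightarrow> 0"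
    by (rule Lim_null_comparison[OF always_eventually[OF allI[OF bound]]])
  hence "(\<lambda>N. (\<Sum>n. a n) - ((\<Sum>n. a n) - ?E N)) \<longlonglongrightarrow> (\<Sum>n. a n) - 0"
    by (intro tendsto_intros)
  thus ?thesis by simp
qed

section \<open>Divergence of the sum of prime reciprocals\<close>

lemma sum_inverse_primes_ge: "ln (harm N) \<le> 2 * (\<Sum>p | prime p \<and> p \<le> N. 1 / real p)" if "N \<ge> 1"
proof -
  let ?P = "{p::nat. prime p \<and> p \<le> N}"
  let ?a = "\<lambda>n::nat. 1 / real n"
  have p1: "norm (1 / real p) < 1" if "prime p" for p :: nat using that prime_gt_1_nat[of p] by simp
  have geo: "(\<Sum>e. ?a (p ^ e)) = 1 / (1 - 1 / real p)" "summable (\<lambda>e. norm (?a (p ^ e)))" if "prime p" for p :: nat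
    using suminf_geometric[OF p1[OF that]] summable_geometric[of "1 / real p"] p1[OF that]
    by (simp_all add: power_one_over)
  have "harm N = (\<Sum>n\<in>{1..N}. ?a n)" by (simp add: harm_def inverse_eq_divide)
  also have "\<dots> \<le> (\<Prod>p\<in>?P. \<Sum>e. ?a (p ^ e))"
  proof -
    have hs: "(?a has_sum (\<Prod>p\<in>?P. \<Sum>e. ?a (p ^ e))) (smooth_nats ?P)"
      using geo(2) by (intro euler_product_finite[THEN conjunct2]) auto
    have "(?a has_sum (\<Sum>n\<in>{1..N}. ?a n)) {1..N}" by (rule has_sum_finite) simp
    from this hs show ?thesis by (rule has_sum_mono_neutral) (auto intro: le_imp_smooth_nats)
  qed
  also have "\<dots> \<le> (\<Prod>p\<in>?P. exp (2 * (1 / real p)))"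
  proof (intro prod_mono conjI)
    fix p assume p: "p \<in> ?P"
    hence "p \<ge> 2" by (auto simp: prime_ge_2_nat)
    \<comment> \<open>The left side is \<open>1 + 1 / (p - 1)\<close>, and
      \<open>p \<le> 2 * (p - 1)\<close>. This is Euler's argument with a crude constant in the
      exponent.\<close>
    hence "1 / (1 - 1 / real p) \<le> 1 + 2 * (1 / real p)"
      by (simp add: field_simps) (use \<open>p \<ge> 2\<close> in \<open>simp flip: of_nat_mult add: self_le_power\<close>)?
    also have "\<dots> \<le> exp (2 * (1 / real p))" by (rule exp_ge_add_one_self)
    finally show "(\<Sum>e. ?a (p ^ e)) \<le> exp (2 * (1 / real p))" using geo p by auto
    show "0 \<le> (\<Sum>e. ?a (p ^ e))" using geo p \<open>p \<ge> 2\<close> by auto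
  qed
  also have "\<dots> = exp (2 * (\<Sum>p\<in>?P. 1 / real p))" by (simp add: exp_sum sum_distrib_left)
  finally show ?thesis using that by (metis exp_le_cancel_iff exp_ln harm_pos less_le_trans zero_less_one)
qed

lemma sum_inverse_primes_unbounded: "\<exists>N0. \<forall>N\<ge>N0. (\<Sum>p | prime p \<and> p \<le> N. 1 / real p) \<ge> B"
proof -
  have "filterlim (\<lambda>N. ln (harm N :: real)) at_top at_top"
    by (rule filterlim_compose[OF ln_at_top harm_at_top])
  hence "\<forall>\<^sub>F N in at_top. ln (harm N :: real) \<ge> 2 * B" by (simp add: filterlim_at_top)
  then obtain N0 where N0: "\<And>N. N \<ge> N0 \<Longrightarrow> ln (harm N :: real) \<ge> 2 * B"
    by (auto simp: eventually_at_top_linorder)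
  have "(\<Sum>p | prime p \<and> p \<le> N. 1 / real p) \<ge> B" if "N \<ge> max N0 1" for N
    using sum_inverse_primes_ge[of N] N0[of N] that by auto
  thus ?thesis by blast
qed

section \<open>Pairs of integers with prescribed numbers of small prime factors\<close>

lemma sum_inverse_squares_le:
  fixes A :: "nat set"
  assumes "finite A" "\<And>n. n \<in> A \<Longrightarrow> n > m" "m \<ge> 1"
  shows "(\<Sum>n\<in>A. 1 / real n ^ 2) \<le> 1 / real m"
proof -
  define N where "N = max (Max (insert 0 A)) m"
  have "A \<subseteq> {m<..N}" using assms by (auto simp: N_def le_max_iff_disj intro: Max_ge)
  hence "(\<Sum>n\<in>A. 1 / real n ^ 2) \<le> (\<Sum>n\<in>{m<..N}. 1 / real n ^ 2)" by (intro sum_mono2) auto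
  also have "\<dots> \<le> 1 / real m - 1 / real N"
  proof -
    have "m \<le> N" by (simp add: N_def)
    thus ?thesis
    proof (induction N rule: dec_induct)
      case (step N)
      have "{m<..Suc N} = insert (Suc N) {m<..N}" using step by auto
      hence "(\<Sum>n\<in>{m<..Suc N}. 1 / real n ^ 2) \<le> 1 / real m - 1 / real N + 1 / real (Suc N) ^ 2"
        using step by simp
      also have "1 / real (Suc N) ^ 2 \<le> 1 / real N - 1 / real (Suc N)"
      proof -
        have N0: "real N > 0" using step assms by simp
        have "1 / real (Suc N) ^ 2 \<le> 1 / (real N * real (Suc N))"
          unfolding power2_eq_square using N0 by (intro divide_left_mono mult_right_mono mult_pos_pos) auto
        also have "\<dots> = 1 / real N - 1 / real (Suc N)" using N0 by (simp add: field_simps)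
        finally show ?thesis .
      qed
      finally show ?case by simp
    qed simp
  qed
  finally show ?thesis by (smt (verit) divide_nonneg_nonneg of_nat_0_le_iff)
qed

lemma inverse_prime_le_1: "prime p \<Longrightarrow> 1 / real p \<le> 1"
  using prime_gt_0_nat[of p] by simp

text \<open>A Poisson probability has at most the order of one over the standard deviation. Below
  the mean, the next \<open>sqrt \<Lambda>\<close> terms are at least \<open>exp (- 1)\<close> times
  the given one, and together they sum to at most 1; above the mean the terms decrease.\<close>

lemma poisson_term_le:
  fixes \<Lambda> :: real
  assumes "\<Lambda> > 0"
  shows "exp (- \<Lambda>) * (\<Lambda> ^ a / fact a) \<le> exp 1 / sqrt \<Lambda>"
proof -
  define t where "t n = exp (- \<Lambda>) * (\<Lambda> ^ n / fact n)" for n :: nat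
  have t0: "t n > 0" for n using assms by (simp add: t_def)
  have tS: "t (Suc n) * (real n + 1) = t n * \<Lambda>" for n
  proof -
    have "t (Suc n) = t n * \<Lambda> / (1 + real n)" by (simp add: t_def mult_ac)
    moreover have "1 + real n \<noteq> 0" by linarith
    ultimately show ?thesis by (simp add: add.commute)
  qed
  have small: "t a \<le> exp 1 / sqrt \<Lambda>" if "real a \<le> \<Lambda>" for a
  proof -
    \<comment> \<open>\<open>q\<close> bounds from below the ratio of consecutive terms during these
      \<open>m\<close> steps, and its \<open>m\<close>-th power is at least
      \<open>(1 + 1 / sqrt \<Lambda>)\<close> to the power \<open>- sqrt \<Lambda>\<close>, hence at
      least \<open>exp (- 1)\<close>.\<close>
    define q where "q = \<Lambda> / (\<Lambda> + sqrt \<Lambda>)"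
    define m where "m = nat \<lfloor>sqrt \<Lambda>\<rfloor>"
    have sq: "sqrt \<Lambda> > 0" using assms by simp
    have m: "real m \<le> sqrt \<Lambda>" "sqrt \<Lambda> \<le> real m + 1" unfolding m_def using sq by linarith+
    have pos: "\<Lambda> + sqrt \<Lambda> > 0" using assms sq by linarith
    have q01: "0 < q" "q \<le> 1" unfolding q_def using divide_pos_pos[OF assms pos] pos_divide_le_eq[OF pos] sq
      by auto
    have step: "t a * q ^ j \<le> t (a + j)" if "j \<le> m" for j
      using that
    proof (induction j)
      case (Suc j)
      have "real (a + j) + 1 \<le> \<Lambda> + sqrt \<Lambda>" using Suc.prems m \<open>real a \<le> \<Lambda>\<close> by auto
      hence "q \<le> \<Lambda> / (real (a + j) + 1)" unfolding q_def using assms by (intro divide_left_mono) auto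
      hence "t a * q ^ j * q \<le> t (a + j) * (\<Lambda> / (real (a + j) + 1))"
        using Suc q01 t0 by (intro mult_mono) (auto intro: less_imp_le)
      also have "\<dots> = t (Suc (a + j))" using tS[of "a + j"] by (simp add: field_simps)
      finally show ?case by (simp add: mult_ac)
    qed simp
    have qm: "exp (- 1) \<le> q ^ j" if "j \<le> m" for j
    proof -
      have "1 / q = 1 + 1 / sqrt \<Lambda>" using assms sq by (simp add: q_def field_simps real_sqrt_mult_self flip: power2_eq_square)
      also have "\<dots> \<le> exp (1 / sqrt \<Lambda>)" by (rule exp_ge_add_one_self)
      finally have "exp (- (1 / sqrt \<Lambda>)) \<le> q" using q01 by (simp add: exp_minus field_simps)
      hence "exp (- (1 / sqrt \<Lambda>)) ^ j \<le> q ^ j" by (intro power_mono) auto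
      moreover have "exp (- (1 / sqrt \<Lambda>)) ^ j = exp (- (real j / sqrt \<Lambda>))"
        by (simp add: exp_of_nat_mult[symmetric])
      moreover have "real j / sqrt \<Lambda> \<le> 1" using that m sq by (simp add: field_simps)
      ultimately show ?thesis by (smt (verit) exp_le_cancel_iff)
    qed
    have "sqrt \<Lambda> * (t a * exp (- 1)) \<le> real (Suc m) * (t a * exp (- 1))"
      using m t0[of a] by (intro mult_right_mono) auto
    also have "\<dots> = (\<Sum>j\<le>m. t a * exp (- 1))" by simp
    also have "\<dots> \<le> (\<Sum>j\<le>m. t (a + j))"
      using step qm t0 by (intro sum_mono) (meson atMost_iff less_imp_le mult_left_mono order_trans)
    also have "\<dots> = exp (- \<Lambda>) * (\<Sum>j\<le>m. \<Lambda> ^ (a + j) / fact (a + j))"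
      by (simp add: t_def sum_distrib_left)
    also have "\<dots> \<le> exp (- \<Lambda>) * exp \<Lambda>"
      using assms by (intro mult_left_mono sum_exp_terms_le) (auto simp: inj_on_def)
    also have "\<dots> = 1" by (simp flip: exp_add)
    finally show ?thesis using sq by (simp add: exp_minus field_simps)
  qed
  have "t a \<le> exp 1 / sqrt \<Lambda>"
  proof (induction a)
    case 0
    thus ?case using small[of 0] assms by simp
  next
    case (Suc a)
    show ?case
    proof (cases "real (Suc a) \<le> \<Lambda>")
      case False
      have "t (Suc a) * (real a + 1) \<le> t a * (real a + 1)"
        unfolding tS using False t0[of a] by (intro mult_left_mono) auto
      hence "t (Suc a) \<le> t a" by simp
      thus ?thesis using Suc by simp
    qed (rule small)
  qed
  thus ?thesis by (simp add: t_def)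
qed

text \<open>With \<open>x = 2 / (p - 2)\<close> a factor is \<open>1 / (1 + x)\<close>, and
  \<open>ln (1 + x) \<ge> x - x ^ 2\<close>. The exponent is expressed through
  \<open>1 / (p - 2)\<close> because this is the weight of a prime in the pattern sums; the
  quadratic terms contribute the 8.\<close>

lemma prod_one_minus_two_over_le:
  fixes Q :: "nat set"
  assumes "finite Q" "\<And>p. p \<in> Q \<Longrightarrow> p \<ge> 3"
  shows "(\<Prod>p\<in>Q. 1 - 2 / real p) \<le> exp (8 - 2 * (\<Sum>p\<in>Q. 1 / (real p - 2)))"
proof -
  have "(\<Prod>p\<in>Q. 1 - 2 / real p) \<le> (\<Prod>p\<in>Q. exp (4 * (1 / (real p - 2)) ^ 2 - 2 * (1 / (real p - 2))))"
  proof (intro prod_mono conjI)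
    fix p assume p: "p \<in> Q"
    hence p3: "real p \<ge> 3" using assms(2) by (metis of_nat_le_iff of_nat_numeral)
    define x where "x = 2 / (real p - 2)"
    have x0: "x > 0" using p3 by (simp add: x_def)
    have "x - x ^ 2 \<le> ln (1 + x)"
    proof (cases "x \<le> 1")
      case True
      thus ?thesis using x0 ln_one_plus_pos_lower_bound[of x] by simp
    next
      case False
      hence "x - x ^ 2 \<le> 0" using mult_right_mono[of 1 x x] by (simp add: power2_eq_square)
      also have "0 \<le> ln (1 + x)" using x0 by simp
      finally show ?thesis .
    qed
    hence "exp (x - x ^ 2) \<le> 1 + x" using x0 by (simp add: ln_ge_iff)
    hence "exp (x - x ^ 2) * exp (x ^ 2 - x) \<le> (1 + x) * exp (x ^ 2 - x)" by (intro mult_right_mono) auto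
    hence "1 / (1 + x) \<le> exp (x ^ 2 - x)" using x0 by (simp add: pos_divide_le_eq mult.commute flip: exp_add)
    moreover have "1 / (1 + x) = 1 - 2 / real p" using p3 by (simp add: x_def field_simps)
    ultimately show "1 - 2 / real p \<le> exp (4 * (1 / (real p - 2)) ^ 2 - 2 * (1 / (real p - 2)))"
      by (simp add: x_def power2_eq_square)
    show "0 \<le> 1 - 2 / real p" using p3 by (simp add: field_simps)
  qed
  also have "\<dots> = exp (4 * (\<Sum>p\<in>Q. 1 / real (p - 2) ^ 2) - 2 * (\<Sum>p\<in>Q. 1 / (real p - 2)))"
  proof -
    have "real (p - 2) = real p - 2" if "p \<in> Q" for p using assms(2)[OF that] by simp
    hence "(\<Sum>p\<in>Q. 1 / real (p - 2) ^ 2) = (\<Sum>p\<in>Q. 1 / (real p - 2) ^ 2)" by (intro sum.cong) auto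
    thus ?thesis using assms(1) by (simp add: exp_sum[symmetric] sum_subtractf sum_distrib_left power_one_over)
  qed
  also have "(\<Sum>p\<in>Q. 1 / real (p - 2) ^ 2) \<le> 2"
  proof -
    have inj: "inj_on (\<lambda>p. p - 2) Q"
    proof (rule inj_onI)
      fix x y assume "x \<in> Q" "y \<in> Q" "x - 2 = y - 2"
      thus "x = y" using assms(2)[of x] assms(2)[of y] by linarith
    qed
    \<comment> \<open>The prime 3 gives \<open>n = 1\<close>, which is split off; the rest is a sum
      of inverse squares above 1.\<close>
    have "(\<Sum>p\<in>Q. 1 / real (p - 2) ^ 2) = (\<Sum>n\<in>(\<lambda>p. p - 2) ` Q. 1 / real n ^ 2)"
      using inj by (simp add: sum.reindex)
    also have "\<dots> \<le> (\<Sum>n\<in>insert 1 (((\<lambda>p. p - 2) ` Q) - {1}). 1 / real n ^ 2)"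
      using assms(1) by (intro sum_mono2) auto
    also have "\<dots> = 1 + (\<Sum>n\<in>((\<lambda>p. p - 2) ` Q) - {1}. 1 / real n ^ 2)"
      using assms(1) by (subst sum.insert) auto
    also have "(\<Sum>n\<in>((\<lambda>p. p - 2) ` Q) - {1}. 1 / real n ^ 2) \<le> 1 / real 1"
    proof (rule sum_inverse_squares_le)
      fix n assume "n \<in> ((\<lambda>p. p - 2) ` Q) - {1}"
      thus "1 < n" using assms(2) by fastforce
    qed (use assms(1) in auto)
    finally show ?thesis by simp
  qed
  finally show ?thesis by simp
qed


lemma sum_subset_weights_eq_1:
  fixes H :: "'a set" and w :: "'a \<Rightarrow> real"
  assumes "finite H"
  shows "(\<Sum>G\<in>Pow H. (\<Prod>p\<in>G. w p) * (\<Prod>p\<in>H - G. 1 - w p)) = 1"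
  using prod_add[OF assms, of w "\<lambda>p. 1 - w p"] by simp

section \<open>Sieving pairs with prescribed sets of small prime factors\<close>

context
  fixes J X h :: nat
  assumes X: "X \<ge> 2 ^ (128 * 2 ^ J)" and h: "h > 0" "even h"
begin

abbreviation "PP \<equiv> {p::nat. prime p \<and> p \<le> 2 ^ 2 ^ J}"
abbreviation "HH \<equiv> {p \<in> PP. p dvd h}"
abbreviation "QQ \<equiv> {p \<in> PP. \<not> p dvd h}"

text \<open>The sets of primes up to \<open>2 ^ 2 ^ J\<close> that divide both, only the first, and only
  the second of \<open>k\<close> and \<open>k + h\<close> are \<open>G\<close>, \<open>A\<close> and \<open>B\<close>.\<close>

definition pattern :: "nat set \<Rightarrow> nat set \<Rightarrow> nat set \<Rightarrow> nat set" where
  "pattern G A B = {k \<in> {1..X}. {p \<in> HH. p dvd k} = G \<and> {p \<in> QQ. p dvd k} = A \<and> {p \<in> QQ. p dvd k + h} = B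
      \<and> (\<Prod>p | p \<in> PP \<and> p dvd k. p) ^ 4 \<le> X \<and> (\<Prod>p | p \<in> PP \<and> p dvd k + h. p) ^ 4 \<le> X}"

lemma fin_PP: "finite PP" by simp
lemma fin_HH: "finite HH" and fin_QQ: "finite QQ" by (rule finite_subset[OF _ fin_PP], blast)+

text \<open>An even \<open>h\<close> puts 2 among the primes with a single excluded class. With two
  classes excluded nothing would remain modulo 2.\<close>

lemma two_in_HH: "2 \<in> HH"
  using h self_le_power[of "2::nat" "2 ^ J"] by (auto simp: two_is_prime_nat)

lemma QQ_ge_3: "p \<in> QQ \<Longrightarrow> p \<ge> 3"
  using h(2) prime_ge_2_nat[of p] by (cases "p = 2") auto

lemma QQ_factor_nonneg: "p \<in> QQ \<Longrightarrow> 0 \<le> 1 - 2 / real p" "p \<in> QQ \<Longrightarrow> 0 \<le> 1 / (real p - 2)"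
proof -
  assume "p \<in> QQ"
  hence "real p \<ge> 3" using QQ_ge_3[of p] by simp
  thus "0 \<le> 1 - 2 / real p" "0 \<le> 1 / (real p - 2)" by (simp_all add: field_simps)
qed

text \<open>The classes of \<open>k\<close> in which \<open>p\<close> divides \<open>k\<close> or
  \<open>k + h\<close>. The two conditions name the same class exactly when \<open>p\<close> divides
  \<open>h\<close>.\<close>

definition residues_for :: "nat \<Rightarrow> nat set" where
  "residues_for p = {r. r < p \<and> (r = 0 \<or> p dvd r + h)}"

lemma mod_in_residues_for: "p > 0 \<Longrightarrow> k mod p \<in> residues_for p \<longleftrightarrow> p dvd k \<or> p dvd k + h"
proof -
  assume "p > 0"
  moreover have "p dvd k mod p + h \<longleftrightarrow> p dvd k + h"
    by (metis mod_add_left_eq mod_eq_0_iff_dvd)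
  moreover have "k mod p = 0 \<longleftrightarrow> p dvd k" by (rule mod_eq_0_iff_dvd)
  ultimately show ?thesis by (simp add: residues_for_def)
qed

lemma residues_for_HH: assumes "p \<in> HH" shows "residues_for p = {0}"
proof -
  have "p dvd r + h \<longleftrightarrow> p dvd r" for r using assms by (simp add: dvd_add_left_iff)
  thus ?thesis using assms by (auto simp: residues_for_def prime_gt_0_nat dest: dvd_imp_le)
qed

lemma residues_for_QQ: assumes "p \<in> QQ" shows "card (residues_for p) = 2"
proof -
  have p0: "p > 0" using assms by (auto simp: prime_gt_0_nat)
  have hm: "h mod p > 0" "h mod p < p" using assms p0 by (auto simp: mod_greater_zero_iff_not_dvd)
  have "residues_for p = {0, p - h mod p}"
  proof (intro equalityI subsetI)
    fix r assume r: "r \<in> residues_for p"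
    show "r \<in> {0, p - h mod p}"
    proof (cases "r = 0")
      case False
      hence "p dvd r + h" "r < p" using r by (auto simp: residues_for_def)
      hence "p dvd r + h mod p" by (metis mod_add_right_eq mod_eq_0_iff_dvd)
      then obtain t where t: "r + h mod p = p * t" by blast
      have "0 < p * t" "p * t < p * 2" using t hm \<open>r < p\<close> by linarith+
      hence "t = 1" using p0 by simp
      hence "r + h mod p = p" using t by simp
      hence "r = p - h mod p" by linarith
      thus ?thesis by simp
    qed simp
  next
    fix r assume "r \<in> {0, p - h mod p}"
    moreover have "p dvd p - h mod p + h"
    proof -
      have "p - h mod p + h = p + p * (h div p)"
        using hm mult_div_mod_eq[of p h] by linarith
      thus ?thesis by simp
    qed
    ultimately show "r \<in> residues_for p" using hm p0 by (auto simp: residues_for_def)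
  qed
  thus ?thesis using hm by simp
qed

text \<open>A pattern fixes \<open>k\<close> modulo the product \<open>M\<close> of its primes and
  excludes \<open>residues_for p\<close> for every other small prime, so the sieve applies inside
  one progression. The factor \<open>v p\<close>, which is \<open>1 / p\<close> divided by
  \<open>1 - 2 / p\<close>, is the cost of requiring a divisibility instead of excluding it; in this
  form the full product over \<open>QQ\<close> is common to all patterns.\<close>

lemma card_pattern_le:
  assumes G: "G \<subseteq> HH" and A: "A \<subseteq> QQ" and B: "B \<subseteq> QQ"
  defines "v \<equiv> \<lambda>p. 1 / (real p - 2)"
  shows "real (card (pattern G A B)) \<le> 2 * (exp (exp 16) + 1) * real X
     * ((\<Prod>p\<in>G. 1 / real p) * (\<Prod>p\<in>HH - G. 1 - 1 / real p))
     * (\<Prod>p\<in>QQ. 1 - 2 / real p) * (\<Prod>p\<in>A. v p) * (\<Prod>p\<in>B. v p)"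
proof (cases "pattern G A B = {}")
  case True
  have 1: "0 \<le> (\<Prod>p\<in>HH - G. 1 - 1 / real p)" by (intro prod_nonneg) (auto dest: inverse_prime_le_1)
  have 2: "0 \<le> (\<Prod>p\<in>QQ. 1 - 2 / real p)" by (intro prod_nonneg QQ_factor_nonneg(1)) blast
  have 3: "0 \<le> (\<Prod>p\<in>C. v p)" if "C \<subseteq> QQ" for C
    unfolding v_def using that by (intro prod_nonneg QQ_factor_nonneg(2)) blast
  have 4: "0 \<le> (\<Prod>p\<in>G. 1 / real p)" by (intro prod_nonneg) auto
  have 5: "0 \<le> 2 * (exp (exp 16) + 1) * real X" by (simp add: add_nonneg_nonneg)
  show ?thesis unfolding True card.empty of_nat_0
    by (rule mult_nonneg_nonneg[OF mult_nonneg_nonneg[OF mult_nonneg_nonneg[OF mult_nonneg_nonneg[OF 5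
        mult_nonneg_nonneg[OF 4 1]] 2] 3[OF A]] 3[OF B]])
next
  case False
  \<comment> \<open>A member \<open>k0\<close> names the residue class modulo \<open>M\<close>, and
    its existence forces \<open>A\<close> and \<open>B\<close> to be disjoint and \<open>M\<close>
    to be small.\<close>
  then obtain k0 where k0: "k0 \<in> pattern G A B" by blast
  have fin: "finite G" "finite A" "finite B"
    using G A B fin_HH fin_QQ finite_subset by blast+
  have dAB: "A \<inter> B = {}"
  proof (rule equals0I)
    fix p assume p: "p \<in> A \<inter> B"
    hence "p dvd k0" "p dvd k0 + h" using k0 unfolding pattern_def by blast+
    hence "p dvd h" by (simp add: dvd_add_right_iff)
    thus False using p A by auto
  qed
  have dG: "G \<inter> (A \<union> B) = {}" using G A B by auto
  define D where "D = G \<union> A \<union> B"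
  define M where "M = \<Prod>D"
  have finD: "finite D" using fin by (simp add: D_def)
  have D: "D \<subseteq> PP" using G A B by (auto simp: D_def)
  have M0: "M > 0" unfolding M_def using D by (intro prod_pos) (auto simp: prime_gt_0_nat)
  have k0_eq: "{p \<in> PP. p dvd k0} = G \<union> A" "{p \<in> PP. p dvd k0 + h} = G \<union> B"
  proof -
    have "{p \<in> PP. p dvd k0} = {p \<in> HH. p dvd k0} \<union> {p \<in> QQ. p dvd k0}" by blast
    thus "{p \<in> PP. p dvd k0} = G \<union> A" using k0 by (simp only: pattern_def mem_Collect_eq)
    have "{p \<in> PP. p dvd k0 + h} = {p \<in> HH. p dvd k0 + h} \<union> {p \<in> QQ. p dvd k0 + h}" by blast
    also have "{p \<in> HH. p dvd k0 + h} = {p \<in> HH. p dvd k0}" by (auto simp: dvd_add_left_iff)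
    finally show "{p \<in> PP. p dvd k0 + h} = G \<union> B" using k0 by (simp only: pattern_def mem_Collect_eq)
  qed
  \<comment> \<open>\<open>M\<close> is at most the product over the small primes of
    \<open>k0\<close> times that over the small primes of \<open>k0 + h\<close>, and each of these
    is at most the fourth root of \<open>X\<close>.\<close>
  have M2: "M ^ 2 \<le> X"
  proof -
    have le: "(\<Prod>(G \<union> A)) ^ 4 \<le> X" "(\<Prod>(G \<union> B)) ^ 4 \<le> X"
      using k0 k0_eq by (simp_all add: pattern_def)
    have "M = \<Prod>(G \<union> A) * \<Prod>B" unfolding M_def D_def using fin dAB dG by (intro prod.union_disjoint) auto
    also have "\<Prod>B \<le> \<Prod>(G \<union> B)"
    proof (rule dvd_imp_le)
      show "\<Prod>B dvd \<Prod>(G \<union> B)" using fin by (intro prod_dvd_prod_subset) auto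
      show "0 < \<Prod>(G \<union> B)" using D by (intro prod_pos) (auto simp: D_def prime_gt_0_nat)
    qed
    finally have "M ^ 4 \<le> (\<Prod>(G \<union> A) * \<Prod>(G \<union> B)) ^ 4" by (intro power_mono) auto
    also have "\<dots> \<le> X * X" unfolding power_mult_distrib using le by (intro mult_mono) auto
    finally have "(M ^ 2) ^ 2 \<le> X ^ 2" by (simp add: power2_eq_square power4_eq_xxxx mult.assoc)
    thus ?thesis by (rule power2_le_imp_le) simp
  qed
  have XM: "real X / real M \<ge> 2 ^ (10 * 2 ^ J)"
  proof -
    have "real M ^ 2 \<le> real X" using M2 by (metis of_nat_le_iff of_nat_power)
    hence "real X \<le> (real X / real M) ^ 2"
      using M0 mult_right_mono[of "real M ^ 2" "real X" "real X"] by (simp add: field_simps power2_eq_square)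
    moreover have "2 ^ (128 * 2 ^ J) \<le> real X" using X by (metis of_nat_le_iff of_nat_numeral of_nat_power)
    moreover have "(2::real) ^ (128 * 2 ^ J) = (2 ^ (64 * 2 ^ J)) ^ 2" by (simp flip: power_mult)
    ultimately have "(2 ^ (64 * 2 ^ J)) ^ 2 \<le> (real X / real M) ^ 2" by linarith
    hence "2 ^ (64 * 2 ^ J) \<le> real X / real M" by (rule power2_le_imp_le) simp
    moreover have "(2::real) ^ (10 * 2 ^ J) \<le> 2 ^ (64 * 2 ^ J)" by (intro power_increasing) auto
    ultimately show ?thesis by linarith
  qed
  \<comment> \<open>The sieve starts above 2. Leaving out the prime 2 costs at most the factor
    \<open>1 / (1 - 1 / 2)\<close>.\<close>
  define P' where "P' = PP - D - {2}"
  have P': "p \<in> P' \<Longrightarrow> prime p \<and> 2 < p \<and> p \<le> 2 ^ 2 ^ J \<and> coprime M p" for p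
  proof -
    assume p: "p \<in> P'"
    hence "prime p" "p \<noteq> 2" "p \<le> 2 ^ 2 ^ J" "p \<notin> D" unfolding P'_def by blast+
    moreover have "coprime M p" unfolding M_def
      using D \<open>prime p\<close> \<open>p \<notin> D\<close> by (intro prod_coprime_left) (metis (no_types, lifting) mem_Collect_eq primes_coprime subsetD)
    moreover have "2 < p" using prime_ge_2_nat[OF \<open>prime p\<close>] \<open>p \<noteq> 2\<close> by linarith
    ultimately show ?thesis by blast
  qed
  have res: "residues_for p \<subseteq> {..<p} \<and> card (residues_for p) \<le> 2" if "p \<in> P'" for p
  proof -
    have "p \<in> HH \<or> p \<in> QQ" using that by (auto simp: P'_def)
    hence "card (residues_for p) \<le> 2" using residues_for_HH residues_for_QQ by auto
    thus ?thesis by (auto simp: residues_for_def)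
  qed
  have sub: "pattern G A B \<subseteq> {k \<in> {1..X}. [k = k0] (mod M) \<and> (\<forall>p\<in>P'. k mod p \<notin> residues_for p)}"
  proof
    fix k assume k: "k \<in> pattern G A B"
    have "[k = k0] (mod p)" if "p \<in> D" for p
    proof -
      have "(p dvd k \<and> p dvd k0) \<or> (p dvd k + h \<and> p dvd k0 + h)"
        using that k k0 unfolding D_def pattern_def by blast
      thus ?thesis
      proof
        assume "p dvd k + h \<and> p dvd k0 + h"
        hence "[k + h = k0 + h] (mod p)" by (metis cong_0_iff cong_sym cong_trans)
        thus ?thesis by (simp add: cong_add_rcancel_nat)
      qed (metis cong_0_iff cong_sym cong_trans)
    qed
    hence c: "[k = k0] (mod M)" unfolding M_def
      using D by (intro coprime_cong_prod_nat) (metis (no_types, lifting) mem_Collect_eq primes_coprime subsetD)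
    have "k mod p \<notin> residues_for p" if "p \<in> P'" for p
    proof -
      have p: "p \<in> PP" "p \<notin> G" "p \<notin> A" "p \<notin> B" using that by (auto simp: P'_def D_def)
      have "\<not> p dvd k" using p k unfolding pattern_def by blast
      moreover have "\<not> p dvd k + h"
      proof
        assume pk: "p dvd k + h"
        show False
        proof (cases "p dvd h")
          case True
          thus False using pk \<open>\<not> p dvd k\<close> by (simp add: dvd_add_left_iff)
        qed (use p k pk in \<open>unfold pattern_def, blast\<close>)
      qed
      ultimately show ?thesis using mod_in_residues_for[of p k] p by (simp add: prime_gt_0_nat)
    qed
    thus "k \<in> {k \<in> {1..X}. [k = k0] (mod M) \<and> (\<forall>p\<in>P'. k mod p \<notin> residues_for p)}"
      using c k by (simp add: pattern_def)
  qed
  have finP': "finite P'" unfolding P'_def by (intro finite_Diff fin_PP)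
  have "real (card (pattern G A B)) \<le> real (card {k \<in> {1..X}. [k = k0] (mod M) \<and> (\<forall>p\<in>P'. k mod p \<notin> residues_for p)})"
    using card_mono[OF _ sub] by simp
  also have "\<dots> \<le> (exp (exp 16) + 1) * (real X / real M) * (\<Prod>p\<in>P'. 1 - real (card (residues_for p)) / real p)"
    by (rule sieve_upper_bound[OF finP' M0 P' res XM])
  also have "(\<Prod>p\<in>P'. 1 - real (card (residues_for p)) / real p) =
      (\<Prod>p\<in>HH - G - {2}. 1 - 1 / real p) * (\<Prod>p\<in>QQ - (A \<union> B). 1 - 2 / real p)"
  proof -
    have "P' = (HH - G - {2}) \<union> (QQ - (A \<union> B))"
      using G A B two_in_HH by (auto simp: P'_def D_def)
    moreover have "(\<Prod>p\<in>(HH - G - {2}) \<union> (QQ - (A \<union> B)). 1 - real (card (residues_for p)) / real p) =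
      (\<Prod>p\<in>HH - G - {2}. 1 - real (card (residues_for p)) / real p) *
      (\<Prod>p\<in>QQ - (A \<union> B). 1 - real (card (residues_for p)) / real p)"
      using fin_HH fin_QQ by (intro prod.union_disjoint) auto
    moreover have "(\<Prod>p\<in>HH - G - {2}. 1 - real (card (residues_for p)) / real p) = (\<Prod>p\<in>HH - G - {2}. 1 - 1 / real p)"
      using residues_for_HH by (intro prod.cong) auto
    moreover have "(\<Prod>p\<in>QQ - (A \<union> B). 1 - real (card (residues_for p)) / real p) = (\<Prod>p\<in>QQ - (A \<union> B). 1 - 2 / real p)"
      using residues_for_QQ by (intro prod.cong) auto
    ultimately show ?thesis by simp
  qed
  also have "(exp (exp 16) + 1) * (real X / real M) * \<dots> \<le> (exp (exp 16) + 1) * (real X / real M) *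
      ((2 * (\<Prod>p\<in>HH - G. 1 - 1 / real p)) * (\<Prod>p\<in>QQ - (A \<union> B). 1 - 2 / real p))"
  proof (intro mult_left_mono mult_right_mono)
    have nn: "0 \<le> (\<Prod>p\<in>HH - G - {2}. 1 - 1 / real p)" by (intro prod_nonneg) (auto dest: inverse_prime_le_1)
    show "(\<Prod>p\<in>HH - G - {2}. 1 - 1 / real p) \<le> 2 * (\<Prod>p\<in>HH - G. 1 - 1 / real p)"
    proof (cases "2 \<in> G")
      case True
      hence eq: "HH - G - {2} = HH - G" by auto
      show ?thesis using nn unfolding eq by linarith
    next
      case False
      hence "(\<Prod>p\<in>HH - G. 1 - 1 / real p) = (1 - 1 / real 2) * (\<Prod>p\<in>HH - G - {2}. 1 - 1 / real p)"
        using two_in_HH fin_HH by (intro prod.remove) auto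
      thus ?thesis by simp
    qed
    show "0 \<le> (\<Prod>p\<in>QQ - (A \<union> B). 1 - 2 / real p)"
      by (intro prod_nonneg QQ_factor_nonneg(1)) blast
  qed (auto intro: add_nonneg_nonneg)
  also have "\<dots> = 2 * (exp (exp 16) + 1) * real X
     * ((\<Prod>p\<in>G. 1 / real p) * (\<Prod>p\<in>HH - G. 1 - 1 / real p))
     * ((\<Prod>p\<in>A \<union> B. 1 / real p) * (\<Prod>p\<in>QQ - (A \<union> B). 1 - 2 / real p))"
  proof -
    have "1 / real M = (\<Prod>p\<in>D. 1 / real p)" by (simp add: M_def prod_dividef)
    also have "\<dots> = (\<Prod>p\<in>G. 1 / real p) * (\<Prod>p\<in>A \<union> B. 1 / real p)"
      unfolding D_def Un_assoc using fin dG by (intro prod.union_disjoint) auto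
    finally have "real X / real M = real X * ((\<Prod>p\<in>G. 1 / real p) * (\<Prod>p\<in>A \<union> B. 1 / real p))"
      by (metis mult.right_neutral times_divide_eq_right)
    thus ?thesis by (simp only: mult_ac)
  qed
  also have "(\<Prod>p\<in>A \<union> B. 1 / real p) * (\<Prod>p\<in>QQ - (A \<union> B). 1 - 2 / real p)
     = (\<Prod>p\<in>QQ. 1 - 2 / real p) * (\<Prod>p\<in>A. v p) * (\<Prod>p\<in>B. v p)"
  proof -
    have "(\<Prod>p\<in>A \<union> B. 1 / real p) = (\<Prod>p\<in>A \<union> B. (1 - 2 / real p) * v p)"
    proof (intro prod.cong refl)
      fix p assume "p \<in> A \<union> B"
      hence "p \<in> QQ" using A B by blast
      hence "real p \<ge> 3" using QQ_ge_3[of p] by simp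
      thus "1 / real p = (1 - 2 / real p) * v p" by (simp add: v_def field_simps)
    qed
    also have "\<dots> = (\<Prod>p\<in>A \<union> B. 1 - 2 / real p) * ((\<Prod>p\<in>A. v p) * (\<Prod>p\<in>B. v p))"
      using fin dAB by (simp add: prod.distrib prod.union_disjoint)
    finally have "(\<Prod>p\<in>A \<union> B. 1 / real p) * (\<Prod>p\<in>QQ - (A \<union> B). 1 - 2 / real p) =
       ((\<Prod>p\<in>QQ - (A \<union> B). 1 - 2 / real p) * (\<Prod>p\<in>A \<union> B. 1 - 2 / real p)) * ((\<Prod>p\<in>A. v p) * (\<Prod>p\<in>B. v p))"
      by (simp only: mult_ac)
    also have "(\<Prod>p\<in>QQ - (A \<union> B). 1 - 2 / real p) * (\<Prod>p\<in>A \<union> B. 1 - 2 / real p) = (\<Prod>p\<in>QQ. 1 - 2 / real p)"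
      using A B fin_QQ by (intro prod.subset_diff[symmetric]) auto
    finally show ?thesis by (simp only: mult_ac)
  qed
  finally show ?thesis by (simp only: mult_ac)
qed

text \<open>For fixed common primes \<open>G\<close> the sizes of \<open>A\<close> and
  \<open>B\<close> are prescribed, so each of their sums is an elementary symmetric function of the
  weights, that is, at most \<open>exp \<Lambda>\<close> times a Poisson probability. The factor
  \<open>exp (8 - 2 * \<Lambda>)\<close> from \<open>QQ\<close> cancels both exponentials, and each
  prescribed count leaves a factor \<open>exp 1 / sqrt \<Lambda>\<close>.\<close>

theorem card_fixed_counts_le:
  defines "\<Lambda> \<equiv> \<Sum>p\<in>QQ. 1 / (real p - 2)"
  assumes \<Lambda>0: "\<Lambda> > 0"
  shows "real (card {k \<in> {1..X}. card {p \<in> PP. p dvd k} = i \<and> card {p \<in> PP. p dvd k + h} = i'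
      \<and> (\<Prod>p | p \<in> PP \<and> p dvd k. p) ^ 4 \<le> X \<and> (\<Prod>p | p \<in> PP \<and> p dvd k + h. p) ^ 4 \<le> X})
    \<le> 2 * (exp (exp 16) + 1) * exp 10 * real X / \<Lambda>" (is "real (card ?C) \<le> _")
proof -
  define v where "v = (\<lambda>p. 1 / (real p - 2))"
  define c0 where "c0 = 2 * (exp (exp 16) + 1) * real X"
  define V where "V = (\<Prod>p\<in>QQ. 1 - 2 / real p)"
  define w where "w G = (\<Prod>p\<in>G. 1 / real p) * (\<Prod>p\<in>HH - G. 1 - 1 / real p)" for G
  \<comment> \<open>The size condition is a sum because \<open>i - card G\<close> would be truncated
    at 0 when \<open>G\<close> has more than \<open>i\<close> elements; the set is then empty, as it
    should be.\<close>
  define TA where "TA G i = {A. A \<subseteq> QQ \<and> card A + card G = i}" for G :: "nat set" and i :: nat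
  have c00: "c0 \<ge> 0" by (simp add: c0_def add_nonneg_nonneg)
  have V0: "V \<ge> 0" unfolding V_def by (intro prod_nonneg QQ_factor_nonneg(1)) blast
  have w0: "w G \<ge> 0" for G unfolding w_def
    by (rule mult_nonneg_nonneg; rule prod_nonneg) (auto dest: inverse_prime_le_1)
  have v0: "v p \<ge> 0" if "p \<in> QQ" for p unfolding v_def using that by (rule QQ_factor_nonneg(2))
  have finTA: "finite (TA G i)" for G i
    unfolding TA_def by (rule finite_subset[of _ "Pow QQ"]) (use fin_QQ in blast)+
  have sub: "?C \<subseteq> (\<Union>G\<in>Pow HH. \<Union>A\<in>TA G i. \<Union>B\<in>TA G i'. pattern G A B)"
  proof
    fix k assume k: "k \<in> ?C"
    let ?G = "{p \<in> HH. p dvd k}" and ?A = "{p \<in> QQ. p dvd k}" and ?B = "{p \<in> QQ. p dvd k + h}"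
    have fin: "finite ?G" "finite ?A" "finite ?B" using fin_HH fin_QQ by auto
    have "{p \<in> PP. p dvd k} = ?A \<union> ?G" by blast
    hence "card {p \<in> PP. p dvd k} = card ?A + card ?G"
      using fin by (simp only:) (rule card_Un_disjoint, auto)
    moreover have "{p \<in> PP. p dvd k + h} = ?B \<union> ?G" by (auto simp: dvd_add_left_iff)
    hence "card {p \<in> PP. p dvd k + h} = card ?B + card ?G"
      using fin by (simp only:) (rule card_Un_disjoint, auto)
    ultimately have "?A \<in> TA ?G i" "?B \<in> TA ?G i'" using k by (auto simp: TA_def)
    moreover have "k \<in> pattern ?G ?A ?B" using k unfolding pattern_def by blast
    moreover have "?G \<in> Pow HH" by blast
    ultimately show "k \<in> (\<Union>G\<in>Pow HH. \<Union>A\<in>TA G i. \<Union>B\<in>TA G i'. pattern G A B)" by blast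
  qed
  have finp: "finite (pattern G A B)" for G A B unfolding pattern_def by simp
  have finPow: "finite (Pow HH)" using fin_HH by blast
  have "card ?C \<le> card (\<Union>G\<in>Pow HH. \<Union>A\<in>TA G i. \<Union>B\<in>TA G i'. pattern G A B)"
    using sub finp finTA finPow by (intro card_mono) blast+
  also have "\<dots> \<le> (\<Sum>G\<in>Pow HH. card (\<Union>A\<in>TA G i. \<Union>B\<in>TA G i'. pattern G A B))"
    by (rule card_UN_le[OF finPow])
  also have "\<dots> \<le> (\<Sum>G\<in>Pow HH. \<Sum>A\<in>TA G i. card (\<Union>B\<in>TA G i'. pattern G A B))"
    by (intro sum_mono card_UN_le finTA)
  also have "\<dots> \<le> (\<Sum>G\<in>Pow HH. \<Sum>A\<in>TA G i. \<Sum>B\<in>TA G i'. card (pattern G A B))"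
    by (intro sum_mono card_UN_le finTA)
  finally have "real (card ?C) \<le> (\<Sum>G\<in>Pow HH. \<Sum>A\<in>TA G i. \<Sum>B\<in>TA G i'. real (card (pattern G A B)))"
    by (simp only: of_nat_le_iff flip: of_nat_sum)
  also have "\<dots> \<le> (\<Sum>G\<in>Pow HH. \<Sum>A\<in>TA G i. \<Sum>B\<in>TA G i'. c0 * w G * V * (\<Prod>p\<in>A. v p) * (\<Prod>p\<in>B. v p))"
    unfolding c0_def w_def V_def v_def
    by (intro sum_mono card_pattern_le) (auto simp: TA_def)
  also have "\<dots> = (\<Sum>G\<in>Pow HH. c0 * w G * V * ((\<Sum>A\<in>TA G i. \<Prod>p\<in>A. v p) * (\<Sum>B\<in>TA G i'. \<Prod>p\<in>B. v p)))"
    by (unfold sum_product, unfold sum_distrib_left mult.assoc, rule refl)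
  also have "\<dots> \<le> (\<Sum>G\<in>Pow HH. c0 * w G * (exp 10 / \<Lambda>))"
  proof (rule sum_mono)
    fix G assume G: "G \<in> Pow HH"
    have e: "0 \<le> (\<Sum>A\<in>TA G j. \<Prod>p\<in>A. v p) \<and> (\<Sum>A\<in>TA G j. \<Prod>p\<in>A. v p) \<le> exp \<Lambda> * (exp 1 / sqrt \<Lambda>)" for j
    proof
      show "0 \<le> (\<Sum>A\<in>TA G j. \<Prod>p\<in>A. v p)"
        using v0 by (intro sum_nonneg prod_nonneg) (auto simp: TA_def)
      have "(\<Sum>A\<in>TA G j. \<Prod>p\<in>A. v p) \<le> esym QQ v (j - card G)"
        unfolding esym_def
      proof (rule sum_mono2)
        show "finite {D. D \<subseteq> QQ \<and> card D = j - card G}"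
          by (rule finite_subset[of _ "Pow QQ"]) (use fin_QQ in blast)+
        show "TA G j \<subseteq> {D. D \<subseteq> QQ \<and> card D = j - card G}" by (auto simp: TA_def)
        show "0 \<le> (\<Prod>p\<in>D. v p)" if "D \<in> {D. D \<subseteq> QQ \<and> card D = j - card G} - TA G j" for D
          using that v0 by (intro prod_nonneg) blast
      qed
      also have "\<dots> \<le> \<Lambda> ^ (j - card G) / fact (j - card G)"
        unfolding \<Lambda>_def v_def by (rule esym_le[OF fin_QQ]) (rule QQ_factor_nonneg(2))
      also have "\<dots> = exp \<Lambda> * (exp (- \<Lambda>) * (\<Lambda> ^ (j - card G) / fact (j - card G)))"
        by (simp add: exp_minus)
      also have "\<dots> \<le> exp \<Lambda> * (exp 1 / sqrt \<Lambda>)"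
        using poisson_term_le[OF \<Lambda>0] by (intro mult_left_mono) auto
      finally show "(\<Sum>A\<in>TA G j. \<Prod>p\<in>A. v p) \<le> exp \<Lambda> * (exp 1 / sqrt \<Lambda>)" .
    qed
    have "V * ((\<Sum>A\<in>TA G i. \<Prod>p\<in>A. v p) * (\<Sum>B\<in>TA G i'. \<Prod>p\<in>B. v p)) \<le>
        exp (8 - 2 * \<Lambda>) * ((exp \<Lambda> * (exp 1 / sqrt \<Lambda>)) * (exp \<Lambda> * (exp 1 / sqrt \<Lambda>)))"
    proof (intro mult_mono)
      show "V \<le> exp (8 - 2 * \<Lambda>)" unfolding V_def \<Lambda>_def
        by (rule prod_one_minus_two_over_le[OF fin_QQ QQ_ge_3])
    qed (use e e[THEN conjunct1, THEN order_trans, OF e[THEN conjunct2]] in \<open>auto intro!: mult_nonneg_nonneg\<close>)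
    also have "\<dots> = (exp (8 - 2 * \<Lambda>) * exp \<Lambda> * exp \<Lambda> * exp 1 * exp 1) / (sqrt \<Lambda> * sqrt \<Lambda>)" by simp
    also have "exp (8 - 2 * \<Lambda>) * exp \<Lambda> * exp \<Lambda> * exp 1 * exp 1 = exp 10" by (simp flip: exp_add)
    also have "sqrt \<Lambda> * sqrt \<Lambda> = \<Lambda>" using \<Lambda>0 by simp
    finally have "c0 * w G * (V * ((\<Sum>A\<in>TA G i. \<Prod>p\<in>A. v p) * (\<Sum>B\<in>TA G i'. \<Prod>p\<in>B. v p))) \<le> c0 * w G * (exp 10 / \<Lambda>)"
      using c00 w0 by (intro mult_left_mono mult_nonneg_nonneg) auto
    thus "c0 * w G * V * ((\<Sum>A\<in>TA G i. \<Prod>p\<in>A. v p) * (\<Sum>B\<in>TA G i'. \<Prod>p\<in>B. v p)) \<le> c0 * w G * (exp 10 / \<Lambda>)"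
      by (simp only: mult.assoc)
  qed
  also have "\<dots> = c0 * (exp 10 / \<Lambda>) * (\<Sum>G\<in>Pow HH. w G)"
    by (simp only: sum_distrib_left mult_ac)
  \<comment> \<open>The common small primes contribute a probability distribution, so no singular series in \<open>h\<close> appears.\<close>
  also have "(\<Sum>G\<in>Pow HH. w G) = 1" unfolding w_def using fin_HH by (rule sum_subset_weights_eq_1)
  finally show ?thesis by (simp add: c0_def mult_ac)
qed

text \<open>The product of the primes in \<open>HH\<close> divides \<open>h\<close>, so there are at
  most \<open>t\<close> of them. Each contributes at most \<open>1 / 8\<close>, apart from an extra
  4 in total for those below 8. With \<open>S\<close> the full reciprocal sum, the loss is at most
  \<open>S / 4 + 36\<close>, which is at most \<open>S / 2\<close> since
  \<open>S \<ge> 200\<close>.\<close>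

lemma sum_QQ_ge:
  assumes "h < 2 ^ t" "real t \<le> 2 * (\<Sum>p\<in>PP. 1 / real p) + 256" "(\<Sum>p\<in>PP. 1 / real p) \<ge> 200"
  shows "(\<Sum>p\<in>QQ. 1 / (real p - 2)) \<ge> (\<Sum>p\<in>PP. 1 / real p) / 2"
proof -
  define S where "S = (\<Sum>p\<in>PP. 1 / real p)"
  have "card HH \<le> t"
  proof -
    have "(2::nat) ^ card HH = (\<Prod>p\<in>HH. 2)" by simp
    also have "\<dots> \<le> \<Prod>HH" by (intro prod_mono) (auto simp: prime_ge_2_nat)
    also have "\<dots> \<le> h"
      using prod_primes_dvd_iff[OF fin_HH, of h] h by (intro dvd_imp_le) auto
    also note assms(1)
    finally show ?thesis by simp
  qed
  have "(\<Sum>p\<in>HH. 1 / real p) \<le> (\<Sum>p\<in>HH. 1 / 8 + (if p < 8 then 1 / 2 else 0))"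
  proof (rule sum_mono)
    fix p assume p: "p \<in> HH"
    show "1 / real p \<le> 1 / 8 + (if p < 8 then 1 / 2 else 0)"
      using p prime_ge_2_nat[of p] by (auto simp: field_simps)
  qed
  also have "\<dots> = real (card HH) / 8 + (\<Sum>p\<in>HH. if p < 8 then 1 / 2 else 0)"
    by (simp add: sum.distrib)
  also have "(\<Sum>p\<in>HH. if p < 8 then 1 / 2 else 0) \<le> (\<Sum>p\<in>{..<8::nat}. 1 / 2 :: real)"
  proof -
    have "card {p \<in> HH. p < 8} \<le> card {..<8::nat}" by (rule card_mono) auto
    thus ?thesis using fin_HH by (subst sum.inter_filter[symmetric]) auto
  qed
  finally have "(\<Sum>p\<in>HH. 1 / real p) \<le> S / 2"
    using \<open>card HH \<le> t\<close> assms(2,3) unfolding S_def by simp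
  moreover have "S = (\<Sum>p\<in>HH. 1 / real p) + (\<Sum>p\<in>QQ. 1 / real p)"
  proof -
    have "(\<Sum>p\<in>HH \<union> QQ. 1 / real p) = (\<Sum>p\<in>HH. 1 / real p) + (\<Sum>p\<in>QQ. 1 / real p)"
      by (rule sum.union_disjoint[OF fin_HH fin_QQ]) blast
    moreover have "HH \<union> QQ = PP" by blast
    ultimately show ?thesis by (simp only: S_def)
  qed
  moreover have "(\<Sum>p\<in>QQ. 1 / real p) \<le> (\<Sum>p\<in>QQ. 1 / (real p - 2))"
  proof (rule sum_mono)
    fix p assume "p \<in> QQ"
    hence "real p \<ge> 3" using QQ_ge_3[of p] by simp
    thus "1 / real p \<le> 1 / (real p - 2)" by (simp add: field_simps)
  qed
  ultimately show ?thesis unfolding S_def by linarith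
qed

end

section \<open>The lower bound\<close>

lemma not_squarefree_nat_prime:
  assumes "\<not> squarefree (k::nat)" "k > 0"
  obtains p where "prime p" "p ^ 2 dvd k"
proof -
  obtain x where x: "x ^ 2 dvd k" "\<not> x dvd 1" using assms(1) by (auto simp: squarefree_def)
  hence "x \<noteq> 1" by simp
  then obtain p where "prime p" "p dvd x" using prime_factor_nat by blast
  moreover from this have "p ^ 2 dvd k" using x(1) by (meson dvd_power_same dvd_trans)
  ultimately show ?thesis using that by blast
qed

lemma divisor_tau_squarefree:
  assumes "squarefree (k::nat)" "k > 0"
  shows "divisor_tau k = 2 ^ card (prime_factors k)"
proof -
  have "multiplicity p k = 1" if "p \<in> prime_factors k" for p
    using that assms squarefree_factorial_semiring'[of k]
    by auto
  hence "(\<Prod>p\<in>prime_factors k. multiplicity p k + 1) = (\<Prod>p\<in>prime_factors k. 2)"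
    by (intro prod.cong) auto
  thus ?thesis using assms by (simp add: divisor_tau_eq_prod)
qed

text \<open>Cauchy-Schwarz on the fibre sizes: their sum is \<open>card K\<close> and the sum of
  their squares is the number of pairs.\<close>

lemma card_pairs_same_image:
  fixes f :: "nat \<Rightarrow> nat"
  assumes "finite K"
  shows "real (card K) ^ 2 \<le> real (card (f ` K)) * real (card {(k, k') \<in> K \<times> K. f k = f k'})"
proof -
  define r where "r n = card {k \<in> K. f k = n}" for n
  have fin: "finite (f ` K)" using assms by simp
  have "card K = (\<Sum>n\<in>f ` K. r n)"
    unfolding r_def using assms by (subst card_UN_disjoint[symmetric]) (auto intro!: arg_cong[of _ _ card])
  hence "real (card K) ^ 2 = (\<Sum>n\<in>f ` K. 1 * real (r n)) ^ 2" by simp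
  also have "\<dots> \<le> (\<Sum>n\<in>f ` K. 1 ^ 2) * (\<Sum>n\<in>f ` K. real (r n) ^ 2)"
    by (rule Cauchy_Schwarz_ineq_sum)
  also have "(\<Sum>n\<in>f ` K. real (r n) ^ 2) = real (\<Sum>n\<in>f ` K. card ({k \<in> K. f k = n} \<times> {k \<in> K. f k = n}))"
    by (simp add: r_def card_cartesian_product power2_eq_square)
  also have "(\<Sum>n\<in>f ` K. card ({k \<in> K. f k = n} \<times> {k \<in> K. f k = n})) = card {(k, k') \<in> K \<times> K. f k = f k'}"
    using assms by (subst card_UN_disjoint[symmetric]) (auto intro!: arg_cong[of _ _ card])
  finally show ?thesis by simp
qed


section \<open>Typical integers\<close>

lemma ln_prime_nonneg: "prime p \<Longrightarrow> 0 \<le> ln (real p)"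
  using prime_ge_1_nat[of p] by simp

definition prime_recip_sum :: "nat \<Rightarrow> real" where
  "prime_recip_sum J = (\<Sum>p\<in>PP J. 1 / real p)"

text \<open>The fourth root of \<open>X\<close> is chosen so that the moduli arising from two
  members multiply to at most \<open>sqrt X\<close>. The window of four standard deviations keeps
  the number of possible counts of order \<open>sqrt (prime_recip_sum J)\<close> and, for large
  \<open>X\<close>, excludes at most an eighth of the integers.\<close>

definition good_nats :: "nat \<Rightarrow> nat \<Rightarrow> nat set" where
  "good_nats J X = {k \<in> {1..X}. squarefree k \<and> (\<Prod>p | p \<in> PP J \<and> p dvd k. p) ^ 4 \<le> X
     \<and> \<bar>real (card {p \<in> PP J. p dvd k}) - prime_recip_sum J\<bar> < 4 * sqrt (prime_recip_sum J)}"

text \<open>The primes 2 and 3 give \<open>1/4\<close> and \<open>1/9\<close>; the last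
  \<open>1/4\<close> bounds the sum of inverse squares over all integers from 5 on.\<close>

lemma card_not_squarefree_le: "real (card {k \<in> {1..X}. \<not> squarefree k}) \<le> real X * (1/4 + 1/9 + 1/4)"
proof -
  let ?P = "{p. prime p \<and> p \<le> X}"
  have "{k \<in> {1..X}. \<not> squarefree k} \<subseteq> (\<Union>p\<in>?P. {k \<in> {1..X}. p ^ 2 dvd k})"
  proof
    fix k assume k: "k \<in> {k \<in> {1..X}. \<not> squarefree k}"
    then obtain p where p: "prime p" "p ^ 2 dvd k" using not_squarefree_nat_prime[of k] by auto
    have "p \<le> p ^ 2" by (simp add: power2_eq_square)
    also have "p ^ 2 \<le> k" using p k by (intro dvd_imp_le) auto
    finally show "k \<in> (\<Union>p\<in>?P. {k \<in> {1..X}. p ^ 2 dvd k})" using p k by auto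
  qed
  hence "card {k \<in> {1..X}. \<not> squarefree k} \<le> card (\<Union>p\<in>?P. {k \<in> {1..X}. p ^ 2 dvd k})"
    by (intro card_mono) auto
  also have "\<dots> \<le> (\<Sum>p\<in>?P. card {k \<in> {1..X}. p ^ 2 dvd k})" by (rule card_UN_le) simp
  finally have "real (card {k \<in> {1..X}. \<not> squarefree k}) \<le> (\<Sum>p\<in>?P. real (card {k \<in> {1..X}. p ^ 2 dvd k}))"
    by (simp only: of_nat_le_iff flip: of_nat_sum)
  also have "\<dots> \<le> (\<Sum>p\<in>?P. real X * (1 / real p ^ 2))"
  proof (rule sum_mono)
    fix p assume "p \<in> ?P"
    hence "p ^ 2 > 0" by (auto simp: prime_gt_0_nat)
    from card_multiples_le[OF this, of X]
    show "real (card {k \<in> {1..X}. p ^ 2 dvd k}) \<le> real X * (1 / real p ^ 2)" by simp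
  qed
  also have "\<dots> = real X * (\<Sum>p\<in>?P. 1 / real p ^ 2)" by (simp only: sum_distrib_left)
  also have "(\<Sum>p\<in>?P. 1 / real p ^ 2) \<le> (\<Sum>p\<in>{2,3} \<union> {5..X}. 1 / real p ^ 2)"
  proof (rule sum_mono2)
    show "?P \<subseteq> {2, 3} \<union> {5..X}"
    proof
      fix p assume p: "p \<in> ?P"
      have "p \<noteq> 4" using p prime_nat_iff[of 4] by (auto intro!: exI[of _ 2])
      thus "p \<in> {2, 3} \<union> {5..X}" using p prime_ge_2_nat[of p] by auto
    qed
  qed auto
  also have "\<dots> = 1/4 + 1/9 + (\<Sum>p\<in>{5..X}. 1 / real p ^ 2)"
    by (subst sum.union_disjoint) auto
  also have "(\<Sum>p\<in>{5..X}. 1 / real p ^ 2) \<le> 1 / real 4" by (rule sum_inverse_squares_le) auto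
  finally show ?thesis by (simp add: mult_left_mono)
qed

lemma card_large_smooth_part_le:
  assumes "X \<ge> 2 ^ (128 * 2 ^ J)"
  shows "real (card {k \<in> {1..X}. (\<Prod>p | p \<in> PP J \<and> p dvd k. p) ^ 4 > X}) \<le> real X / 16" (is "real (card ?B) \<le> _")
proof -
  \<comment> \<open>A quarter of \<open>ln (2 ^ (128 * 2 ^ J))\<close>. The logarithm
    \<open>l k\<close> of the small-prime part is at least \<open>L\<close> on the set to be
    counted, while its mean is at most \<open>L / 16\<close>, so this is Markov's
    inequality.\<close>
  define L where "L = 32 * 2 ^ J * ln (2::real)"
  have L0: "L > 0" by (simp add: L_def)
  define l where "l k = (\<Sum>p | p \<in> PP J \<and> p dvd k. ln (real p))" for k
  have l0: "l k \<ge> 0" for k unfolding l_def by (intro sum_nonneg) (auto simp: ln_prime_nonneg)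
  have "real (card ?B) * L = (\<Sum>k\<in>?B. L)" by simp
  also have "\<dots> \<le> (\<Sum>k\<in>?B. l k)"
  proof (rule sum_mono)
    fix k assume k: "k \<in> ?B"
    let ?m = "\<Prod>p | p \<in> PP J \<and> p dvd k. p"
    have m0: "?m > 0" by (intro prod_pos) (auto simp: prime_gt_0_nat)
    have "(2::nat) ^ (128 * 2 ^ J) \<le> ?m ^ 4" using k assms by simp
    hence "real ((2::nat) ^ (128 * 2 ^ J)) \<le> real (?m ^ 4)" by (simp only: of_nat_le_iff)
    hence "ln (2 ^ (128 * 2 ^ J)) \<le> ln (real ?m ^ 4)" using m0 by (subst ln_le_cancel_iff) auto
    also have "ln (real ?m ^ 4) = 4 * ln (real ?m)" using m0 by (subst ln_realpow) auto
    also have "ln (real ?m) = l k" unfolding l_def of_nat_prod by (subst ln_prod) (auto simp: prime_gt_0_nat)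
    finally show "L \<le> l k" by (simp add: L_def ln_realpow mult_ac)
  qed
  also have "\<dots> \<le> (\<Sum>k=1..X. l k)" using l0 by (intro sum_mono2) auto
  also have "\<dots> = (\<Sum>k=1..X. \<Sum>p\<in>PP J. if p dvd k then ln (real p) else 0)"
    unfolding l_def by (intro sum.cong[OF refl]) (rule sum.inter_filter, simp)
  also have "\<dots> = (\<Sum>p\<in>PP J. \<Sum>k=1..X. if p dvd k then ln (real p) else 0)" by (rule sum.swap)
  also have "\<dots> \<le> (\<Sum>p\<in>PP J. real X * (ln (real p) / real p))"
  proof (rule sum_mono)
    fix p assume p: "p \<in> PP J"
    have "(\<Sum>k=1..X. if p dvd k then ln (real p) else 0) = real (card {k \<in> {1..X}. p dvd k}) * ln (real p)"
      by (subst sum.inter_filter[symmetric]) auto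
    also have "\<dots> \<le> real X / real p * ln (real p)"
      using p by (intro mult_right_mono card_multiples_le) (auto simp: prime_gt_0_nat ln_prime_nonneg prime_ge_Suc_0_nat)
    finally show "(\<Sum>k=1..X. if p dvd k then ln (real p) else 0) \<le> real X * (ln (real p) / real p)" by simp
  qed
  also have "\<dots> = real X * (\<Sum>p\<in>PP J. ln (real p) / real p)" by (simp only: sum_distrib_left)
  also have "\<dots> \<le> real X * (2 * real (2 ^ J) * ln 2)"
    by (intro mult_left_mono sum_ln_over_primes_le) auto
  also have "\<dots> = real X / 16 * L" by (simp add: L_def)
  finally show ?thesis using L0 by simp
qed

text \<open>The exceptional sets have relative size at most \<open>11/18\<close>,
  \<open>1/16\<close> and \<open>1/8\<close>, which leaves more than \<open>1/8\<close>.\<close>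

lemma card_good_nats_ge:
  assumes X: "X \<ge> 2 ^ (128 * 2 ^ J)" and S: "prime_recip_sum J > 0"
  shows "real (card (good_nats J X)) \<ge> real X / 8"
proof -
  let ?S = "prime_recip_sum J"
  let ?A = "{k \<in> {1..X}. \<not> squarefree k}"
  let ?B = "{k \<in> {1..X}. (\<Prod>p | p \<in> PP J \<and> p dvd k. p) ^ 4 > X}"
  let ?C = "{k \<in> {1..X}. \<bar>real (card {p \<in> PP J. p dvd k}) - ?S\<bar> \<ge> 4 * sqrt ?S}"
  have "real (card ?C) * (4 * sqrt ?S)\<^sup>2 \<le> real X * ?S + 2 * ?S * real (card (PP J))"
    unfolding prime_recip_sum_def using S by (intro turan_deviation) (auto simp: prime_recip_sum_def)
  also have "(4 * sqrt ?S)\<^sup>2 = 16 * ?S" using S by (simp add: power_mult_distrib)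
  also have "real X * ?S + 2 * ?S * real (card (PP J)) = (real X + 2 * real (card (PP J))) * ?S"
    by (simp add: algebra_simps)
  finally have "(real (card ?C) * 16) * ?S \<le> (real X + 2 * real (card (PP J))) * ?S" by (simp add: mult_ac)
  hence C: "real (card ?C) * 16 \<le> real X + 2 * real (card (PP J))" using S by simp
  have "card (PP J) \<le> card {1..(2::nat) ^ 2 ^ J}" by (intro card_mono) (auto simp: prime_ge_1_nat prime_gt_0_nat Suc_le_eq)
  hence "2 * card (PP J) \<le> 2 * 2 ^ 2 ^ J" by simp
  also have "\<dots> = (2::nat) ^ (2 ^ J + 1)" by simp
  also have "\<dots> \<le> 2 ^ (128 * 2 ^ J)"
  proof (rule power_increasing)
    have "(1::nat) \<le> 2 ^ J" by simp
    thus "2 ^ J + 1 \<le> 128 * (2::nat) ^ J" by linarith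
  qed simp
  also note X
  finally have C2: "2 * real (card (PP J)) \<le> real X" by linarith
  have "{1..X} \<subseteq> good_nats J X \<union> (?A \<union> (?B \<union> ?C))" by (auto simp: good_nats_def)
  moreover have "finite (good_nats J X)" by (simp add: good_nats_def)
  ultimately have "card {1..X} \<le> card (good_nats J X \<union> (?A \<union> (?B \<union> ?C)))"
    by (intro card_mono) auto
  also have "\<dots> \<le> card (good_nats J X) + (card ?A + (card ?B + card ?C))"
    by (intro order_trans[OF card_Un_le] add_mono order_refl)
  finally have "real X \<le> real (card (good_nats J X)) + (real (card ?A) + (real (card ?B) + real (card ?C)))"
    by (simp flip: of_nat_add)
  thus ?thesis using C C2 card_not_squarefree_le[of X] card_large_smooth_part_le[OF X] by (simp add: field_simps)
qed

text \<open>Since \<open>k\<close> is smaller than the 256th power of the bound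
  \<open>2 ^ 2 ^ J\<close> for small primes, the uncontrolled large primes affect \<tau> only
  through an exponent below 256.\<close>

lemma divisor_tau_good_nats:
  assumes "k \<in> good_nats J X" "X < 2 ^ (256 * 2 ^ J)"
  shows "divisor_tau k = 2 ^ (card {p \<in> PP J. p dvd k} + card (prime_factors k - PP J))"
    and "card (prime_factors k - PP J) < 256"
proof -
  have k: "squarefree k" "k > 0" "k \<le> X" using assms by (auto simp: good_nats_def)
  have eq: "prime_factors k = {p \<in> PP J. p dvd k} \<union> (prime_factors k - PP J)"
    using k by (auto simp: prime_factors_dvd)
  have "card (prime_factors k) = card {p \<in> PP J. p dvd k} + card (prime_factors k - PP J)"
    by (subst eq, rule card_Un_disjoint) auto
  thus "divisor_tau k = 2 ^ (card {p \<in> PP J. p dvd k} + card (prime_factors k - PP J))"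
    using divisor_tau_squarefree[OF k(1,2)] by simp
  let ?R = "prime_factors k - PP J"
  have "(2::nat) ^ (2 ^ J * card ?R) = (\<Prod>p\<in>?R. 2 ^ 2 ^ J)" by (simp add: power_mult)
  also have "\<dots> \<le> \<Prod>?R" by (intro prod_mono) (auto simp: in_prime_factors_iff)
  also have "\<dots> \<le> k"
  proof (rule dvd_imp_le[OF _ k(2)])
    show "\<Prod>?R dvd k"
      by (subst prod_primes_dvd_iff) (auto simp: in_prime_factors_iff)
  qed
  also have "\<dots> < 2 ^ (256 * 2 ^ J)" using k assms by linarith
  finally have "2 ^ J * card ?R < 256 * 2 ^ J" by (rule power_less_imp_less_exp[rotated]) simp
  thus "card ?R < 256" by simp
qed

text \<open>\<open>81\<close> is the square of the window length \<open>9 * sqrt S\<close> divided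
  by \<open>S\<close>, \<open>65536 = 256 ^ 2\<close> counts the pairs of numbers of large primes,
  the factor 2 comes from \<open>\<Lambda> \<ge> S / 2\<close>, and the bracket is the constant of
  \<open>card_fixed_counts_le\<close>.\<close>

definition collision_const :: real where
  "collision_const = 81 * 65536 * 2 * (2 * (exp (exp 16) + 1) * exp 10)"

lemma collision_const_nonneg: "collision_const \<ge> 0"
  by (simp add: collision_const_def add_nonneg_nonneg)

text \<open>Prescribing the counts \<open>i\<close>, \<open>i'\<close> of small and
  \<open>r\<close>, \<open>r'\<close> of large primes determines both values of \<tau>, hence their
  difference \<open>h\<close>, so a colliding pair is determined by \<open>k\<close>. There are
  \<open>O(S)\<close> choices of counts with \<open>O(X / S)\<close> pairs each.\<close>

lemma card_collisions_le:
  assumes X: "X \<ge> 2 ^ (128 * 2 ^ J)" "X < 2 ^ (256 * 2 ^ J)" and S: "prime_recip_sum J \<ge> 200"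
  shows "real (card {(k, k') \<in> good_nats J X \<times> good_nats J X. k < k' \<and> k + divisor_tau k = k' + divisor_tau k'})
     \<le> collision_const * real X" (is "real (card ?Z) \<le> _")
proof -
  define S where "S = prime_recip_sum J"
  define W where "W k = card {p \<in> PP J. p dvd k}" for k
  define R where "R k = card (prime_factors k - PP J)" for k
  define I where "I = {i. \<bar>real i - S\<bar> < 4 * sqrt S}"
  define c0 where "c0 = 2 * (exp (exp 16) + 1) * exp (10::real)"
  have c00: "c0 \<ge> 0" by (simp add: c0_def add_nonneg_nonneg)
  have S0: "S \<ge> 200" using S by (simp add: S_def)
  have "14 ^ 2 \<le> S" using S0 by simp
  hence sq14: "14 \<le> sqrt S" by (rule real_le_rsqrt)
  have sqS: "sqrt S * sqrt S = S" using S0 by simp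
  have "14 * sqrt S \<le> sqrt S * sqrt S" using sq14 S0 by (intro mult_right_mono) auto
  hence sqS': "14 * sqrt S \<le> S" using sqS by simp
  have Isub: "I \<subseteq> {nat \<lceil>S - 4 * sqrt S\<rceil>..nat \<lfloor>S + 4 * sqrt S\<rfloor>}"
    unfolding I_def by (auto simp: abs_less_iff) linarith+
  hence finI: "finite I" using finite_subset by blast
  have cardI: "real (card I) \<le> 9 * sqrt S"
  proof -
    have "card I \<le> card {nat \<lceil>S - 4 * sqrt S\<rceil>..nat \<lfloor>S + 4 * sqrt S\<rfloor>}"
      using Isub by (intro card_mono) auto
    hence "card I \<le> Suc (nat \<lfloor>S + 4 * sqrt S\<rfloor>) - nat \<lceil>S - 4 * sqrt S\<rceil>" by simp
    moreover have a: "real (nat \<lceil>S - 4 * sqrt S\<rceil>) \<ge> S - 4 * sqrt S" "real (nat \<lceil>S - 4 * sqrt S\<rceil>) \<le> S - 4 * sqrt S + 1"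
      using sqS' sq14 by linarith+
    moreover have b: "real (nat \<lfloor>S + 4 * sqrt S\<rfloor>) \<le> S + 4 * sqrt S" "real (nat \<lfloor>S + 4 * sqrt S\<rfloor>) \<ge> S + 4 * sqrt S - 1"
      using sqS' sq14 by linarith+
    ultimately have "real (card I) \<le> 8 * sqrt S + 2" using sq14 by linarith
    thus ?thesis using sq14 by linarith
  qed
  define Z where "Z i r i' r' = {(k, k') \<in> ?Z. W k = i \<and> R k = r \<and> W k' = i' \<and> R k' = r'}" for i r i' r'
  have Z: "real (card (Z i r i' r')) \<le> c0 * real X / (S / 2)" if i: "i \<in> I" "i' \<in> I" and r: "r < 256" for i r i' r'
  proof (cases "Z i r i' r' = {}")
    case True
    thus ?thesis using c00 S0 by simp
  next
    case False
    \<comment> \<open>Natural subtraction is a true difference here: the class of pairs is nonempty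
      and has \<open>k < k'\<close>.\<close>
    define h where "h = 2 ^ (i + r) - (2::nat) ^ (i' + r')"
    have kk: "k' = k + h \<and> h > 0 \<and> k \<in> good_nats J X \<and> k + h \<in> good_nats J X \<and> W k = i \<and> W (k + h) = i'"
      if "(k, k') \<in> Z i r i' r'" for k k'
    proof -
      have *: "k \<in> good_nats J X" "k' \<in> good_nats J X" "k < k'" "k + divisor_tau k = k' + divisor_tau k'"
        "W k = i" "R k = r" "W k' = i'" "R k' = r'"
        using that by (auto simp: Z_def)
      have "divisor_tau k = 2 ^ (i + r)" "divisor_tau k' = 2 ^ (i' + r')"
        using divisor_tau_good_nats(1)[OF *(1) X(2)] divisor_tau_good_nats(1)[OF *(2) X(2)] * by (simp_all add: W_def R_def)
      moreover from this have "k' = k + h" using *(3,4) unfolding h_def by linarith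
      ultimately show ?thesis using * by auto
    qed
    have h0: "h > 0" using False kk by auto
    \<comment> \<open>Counts in the window are positive, so both powers of 2 are even, and with them
      \<open>h\<close>.\<close>
    have "real i' \<ge> 1" using i(2) sqS' sq14 unfolding I_def abs_less_iff mem_Collect_eq by linarith
    hence i'1: "i' \<ge> 1" by simp
    have "(2::nat) ^ (i' + r') < 2 ^ (i + r)" using h0 by (simp add: h_def)
    hence "i' + r' < i + r" by (rule power_less_imp_less_exp[rotated]) simp
    hence "0 < i + r" "0 < i' + r'" using i'1 by linarith+
    hence evh: "even h" unfolding h_def by (auto simp: even_diff_nat)
    have ht: "h < 2 ^ (i + r)" unfolding h_def by simp
    have "real i < S + 4 * sqrt S" using i(1) by (simp add: I_def abs_less_iff)
    moreover have "4 * sqrt S \<le> S" using sqS' sq14 by linarith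
    ultimately have it: "real (i + r) \<le> 2 * (\<Sum>p\<in>PP J. 1 / real p) + 256"
      using r by (simp add: S_def prime_recip_sum_def)
    define \<Lambda> where "\<Lambda> = (\<Sum>p\<in>QQ J h. 1 / (real p - 2))"
    have \<Lambda>: "\<Lambda> \<ge> S / 2"
      unfolding \<Lambda>_def S_def prime_recip_sum_def using S
      by (intro sum_QQ_ge[OF X(1) h0 evh ht it]) (simp add: prime_recip_sum_def)
    hence \<Lambda>0: "\<Lambda> > 0" using S0 by simp
    have "inj_on fst (Z i r i' r')" 
    proof (rule inj_onI)
      fix x y assume xy: "x \<in> Z i r i' r'" "y \<in> Z i r i' r'" "fst x = fst y"
      have "snd x = fst x + h" using kk[of "fst x" "snd x"] xy(1) by simp
      moreover have "snd y = fst y + h" using kk[of "fst y" "snd y"] xy(2) by simp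
      ultimately show "x = y" using xy(3) by (simp add: prod_eq_iff)
    qed
    hence "card (Z i r i' r') = card (fst ` Z i r i' r')" by (simp add: card_image)
    also have "\<dots> \<le> card {k \<in> {1..X}. card {p \<in> PP J. p dvd k} = i \<and> card {p \<in> PP J. p dvd k + h} = i'
      \<and> (\<Prod>p | p \<in> PP J \<and> p dvd k. p) ^ 4 \<le> X \<and> (\<Prod>p | p \<in> PP J \<and> p dvd k + h. p) ^ 4 \<le> X}" (is "_ \<le> card ?C")
    proof (rule card_mono)
      show "fst ` Z i r i' r' \<subseteq> ?C"
      proof
        fix k assume "k \<in> fst ` Z i r i' r'"
        then obtain k' where "(k, k') \<in> Z i r i' r'" by auto
        from kk[OF this] show "k \<in> ?C" unfolding good_nats_def W_def by blast
      qed
    qed simp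
    finally have "real (card (Z i r i' r')) \<le> real (card ?C)" by simp
    also have "\<dots> \<le> c0 * real X / \<Lambda>"
      unfolding c0_def \<Lambda>_def using \<Lambda>0 by (intro card_fixed_counts_le[OF X(1) h0 evh]) (simp add: \<Lambda>_def)
    also have "\<dots> \<le> c0 * real X / (S / 2)"
      using \<Lambda> S0 c00 by (intro divide_left_mono) auto
    finally show ?thesis .
  qed
  have "?Z \<subseteq> (\<Union>i\<in>I. \<Union>r\<in>{..<256}. \<Union>i'\<in>I. \<Union>r'\<in>{..<256}. Z i r i' r')"
  proof (clarify)
    fix k k' assume kk: "k \<in> good_nats J X" "k' \<in> good_nats J X" "k < k'" "k + divisor_tau k = k' + divisor_tau k'"
    have "W k \<in> I" "W k' \<in> I" using kk by (auto simp: good_nats_def I_def W_def S_def)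
    moreover have "R k < 256" "R k' < 256"
      using divisor_tau_good_nats(2)[OF kk(1) X(2)] divisor_tau_good_nats(2)[OF kk(2) X(2)] by (simp_all add: R_def)
    moreover have "(k, k') \<in> Z (W k) (R k) (W k') (R k')" using kk by (simp add: Z_def)
    ultimately show "(k, k') \<in> (\<Union>i\<in>I. \<Union>r\<in>{..<256}. \<Union>i'\<in>I. \<Union>r'\<in>{..<256}. Z i r i' r')"
      by blast
  qed
  moreover have finZ: "finite ?Z"
    by (rule finite_subset[of _ "good_nats J X \<times> good_nats J X"]) (auto simp: good_nats_def)
  moreover have "finite (Z i r i' r')" for i r i' r'
    by (rule finite_subset[OF _ finZ]) (auto simp: Z_def)
  ultimately have "card ?Z \<le> card (\<Union>i\<in>I. \<Union>r\<in>{..<256}. \<Union>i'\<in>I. \<Union>r'\<in>{..<256}. Z i r i' r')"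
    using finI by (intro card_mono) blast+
  also have "\<dots> \<le> (\<Sum>i\<in>I. \<Sum>r\<in>{..<256}. \<Sum>i'\<in>I. \<Sum>r'\<in>{..<256}. card (Z i r i' r'))"
    using finI by (intro order_trans[OF card_UN_le] sum_mono) auto
  finally have "real (card ?Z) \<le> (\<Sum>i\<in>I. \<Sum>r\<in>{..<256}. \<Sum>i'\<in>I. \<Sum>r'\<in>{..<256}. real (card (Z i r i' r')))"
    by (simp only: of_nat_le_iff flip: of_nat_sum)
  also have "\<dots> \<le> (\<Sum>i\<in>I. \<Sum>r\<in>{..<256::nat}. \<Sum>i'\<in>I. \<Sum>r'\<in>{..<256::nat}. c0 * real X / (S / 2))"
    using Z by (intro sum_mono) auto
  also have "\<dots> = (real (card I) * real (card I)) * (65536 * (c0 * real X / (S / 2)))" by simp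
  also have "\<dots> \<le> ((9 * sqrt S) * (9 * sqrt S)) * (65536 * (c0 * real X / (S / 2)))"
    using cardI c00 S0 by (intro mult_right_mono mult_mono) auto
  also have "(9 * sqrt S) * (9 * sqrt S) = 81 * S" using sqS by simp
  also have "81 * S * (65536 * (c0 * real X / (S / 2))) = collision_const * real X"
    using S0 by (simp add: collision_const_def c0_def)
  finally show ?thesis .
qed

text \<open>All pairs with equal image are the diagonal and two copies of the ordered collisions.
  Cauchy-Schwarz then divides \<open>(X / 8) ^ 2\<close> by their number.\<close>

lemma card_image_good_nats_ge:
  assumes X: "X \<ge> 2 ^ (128 * 2 ^ J)" "X < 2 ^ (256 * 2 ^ J)" and S: "prime_recip_sum J \<ge> 200"
  shows "real (card ((\<lambda>k. k + divisor_tau k) ` good_nats J X)) \<ge> real X / (64 * (1 + 2 * collision_const))"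
proof -
  let ?K = "good_nats J X" and ?f = "\<lambda>k. k + divisor_tau k"
  let ?Z = "{(k, k') \<in> ?K \<times> ?K. k < k' \<and> ?f k = ?f k'}"
  have finK: "finite ?K" by (simp add: good_nats_def)
  have X0: "real X > 0" using X(1) by (metis of_nat_0_less_iff less_le_trans zero_less_numeral zero_less_power)
  have finZ: "finite ?Z" by (rule finite_subset[of _ "?K \<times> ?K"]) (use finK in auto)
  have "{(k, k') \<in> ?K \<times> ?K. ?f k = ?f k'} \<subseteq> (\<lambda>k. (k, k)) ` ?K \<union> (?Z \<union> prod.swap ` ?Z)"
    by (auto simp: image_iff prod.swap_def)
  hence "card {(k, k') \<in> ?K \<times> ?K. ?f k = ?f k'} \<le> card ((\<lambda>k. (k, k)) ` ?K \<union> (?Z \<union> prod.swap ` ?Z))"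
    using finK finZ by (intro card_mono) auto
  also have "\<dots> \<le> card ?K + (card ?Z + card ?Z)"
    using finK finZ by (intro order_trans[OF card_Un_le] add_mono card_image_le order_refl) auto
  finally have "real (card {(k, k') \<in> ?K \<times> ?K. ?f k = ?f k'}) \<le> real (card ?K) + 2 * real (card ?Z)" by linarith
  moreover have "card ?K \<le> card {1..X}" by (intro card_mono) (auto simp: good_nats_def)
  hence "real (card ?K) \<le> real X" by simp
  ultimately have pairs: "real (card {(k, k') \<in> ?K \<times> ?K. ?f k = ?f k'}) \<le> (1 + 2 * collision_const) * real X"
    using card_collisions_le[OF X S] by (simp add: algebra_simps)
  have "(real X / 8) ^ 2 \<le> real (card ?K) ^ 2"
    using card_good_nats_ge[OF X(1)] S by (intro power_mono) auto
  also have "\<dots> \<le> real (card (?f ` ?K)) * real (card {(k, k') \<in> ?K \<times> ?K. ?f k = ?f k'})"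
    by (rule card_pairs_same_image[OF finK])
  also have "\<dots> \<le> real (card (?f ` ?K)) * ((1 + 2 * collision_const) * real X)"
    using pairs by (intro mult_left_mono) auto
  finally have "real X * (real X / 64) \<le> real X * (real (card (?f ` ?K)) * (1 + 2 * collision_const))"
    by (simp add: power2_eq_square mult_ac)
  hence "real X / 64 \<le> real (card (?f ` ?K)) * (1 + 2 * collision_const)"
    using mult_le_cancel_left_pos[OF X0] by blast
  hence "real X / 64 / (1 + 2 * collision_const) \<le> real (card (?f ` ?K))"
    using collision_const_nonneg by (subst pos_divide_le_eq) auto
  thus ?thesis by simp
qed

theorem N_plus_tau_lower: "\<exists>c > 0. \<exists>x0. \<forall>x \<ge> x0. c * x \<le> real (N_plus_tau x)"
proof -
  define c where "c = 1 / (64 * (1 + 2 * collision_const))"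
  have c0: "c > 0" using collision_const_nonneg by (simp add: c_def)
  obtain N0 where N0: "\<And>N. N \<ge> N0 \<Longrightarrow> (\<Sum>p | prime p \<and> p \<le> N. 1 / real p) \<ge> 200"
    using sum_inverse_primes_unbounded[of 200] by blast
  have J0: "prime_recip_sum J \<ge> 200" if "J \<ge> N0" for J
  proof -
    have "J < 2 ^ J" "2 ^ J < (2::nat) ^ 2 ^ J" by (rule less_exp)+
    hence "N0 \<le> 2 ^ 2 ^ J" using that by linarith
    from N0[OF this] show ?thesis by (simp add: prime_recip_sum_def)
  qed
  have main: "c / 4 * x \<le> real (N_plus_tau x)" if x: "x \<ge> 2 * 2 ^ (128 * 2 ^ N0) + 2" for x :: real
  proof -
    \<comment> \<open>Half of \<open>x\<close>, because
      \<open>k + \<tau>(k) \<le> 2 * k\<close>.\<close>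
    define X where "X = nat \<lfloor>x / 2\<rfloor>"
    have "x \<ge> 2" using x zero_le_power[of "2::real" "128 * 2 ^ N0"] by linarith
    have "real ((2::nat) ^ (128 * 2 ^ N0)) \<le> x / 2" using x by simp
    hence X0: "2 ^ (128 * 2 ^ N0) \<le> X" unfolding X_def using \<open>x \<ge> 2\<close> by (subst le_nat_iff) (auto simp: le_floor_iff)
    \<comment> \<open>The upper end of the range for \<open>J\<close> is the lower end for
      \<open>Suc J\<close>, so the ranges cover all large \<open>X\<close>.\<close>
    have "\<exists>J\<ge>N0. 2 ^ (128 * 2 ^ J) \<le> X \<and> X < 2 ^ (128 * 2 ^ Suc J)"
    proof -
      have ex: "\<exists>J. X < 2 ^ (128 * 2 ^ J)"
      proof
        have "X < 2 ^ X" by (rule less_exp)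
        moreover from this have "X \<le> 128 * 2 ^ X" by linarith
        ultimately show "X < 2 ^ (128 * 2 ^ X)" using power_increasing[of X "128 * 2 ^ X" "2::nat"] by linarith
      qed
      define J where "J = (LEAST J. X < 2 ^ (128 * 2 ^ J))"
      have J: "X < 2 ^ (128 * 2 ^ J)" unfolding J_def using ex by (rule LeastI_ex)
      have "N0 < J"
      proof (rule ccontr)
        assume "\<not> N0 < J"
        hence "128 * 2 ^ J \<le> 128 * (2::nat) ^ N0" by (simp add: power_increasing)
        hence "(2::nat) ^ (128 * 2 ^ J) \<le> 2 ^ (128 * 2 ^ N0)" by (rule power_increasing) simp
        thus False using J X0 by linarith
      qed
      then obtain J' where J': "J = Suc J'" "N0 \<le> J'" by (cases J) auto
      have "\<not> X < 2 ^ (128 * 2 ^ J')" using J' unfolding J_def by (intro not_less_Least) simp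
      thus ?thesis using J J' by (intro exI[of _ J']) auto
    qed
    then obtain J where J: "J \<ge> N0" "2 ^ (128 * 2 ^ J) \<le> X" "X < 2 ^ (128 * 2 ^ Suc J)" by blast
    have J3: "X < 2 ^ (256 * 2 ^ J)" using J(3) by (simp only: power_Suc mult.assoc[symmetric]) simp
    have "real X * c \<le> real (card ((\<lambda>k. k + divisor_tau k) ` good_nats J X))"
      using card_image_good_nats_ge[OF J(2) J3 J0[OF J(1)]] by (simp add: c_def)
    also have "\<dots> \<le> real (N_plus_tau x)"
      unfolding N_plus_tau_def
    proof (rule of_nat_mono, rule card_mono)
      show "finite {n. 0 < n \<and> real n \<le> x \<and> (\<exists>k>0. n = k + divisor_tau k)}"
        by (rule finite_subset[of _ "{..nat \<lfloor>x\<rfloor>}"]) (auto simp: le_nat_floor)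
      show "(\<lambda>k. k + divisor_tau k) ` good_nats J X \<subseteq> {n. 0 < n \<and> real n \<le> x \<and> (\<exists>k>0. n = k + divisor_tau k)}"
      proof (clarify)
        fix k assume "k \<in> good_nats J X"
        hence k: "k > 0" "k \<le> X" by (auto simp: good_nats_def)
        have "k + divisor_tau k \<le> 2 * X" using divisor_tau_le[OF k(1)] k by linarith
        hence "real (k + divisor_tau k) \<le> 2 * real X" by linarith
        also have "2 * real X \<le> x" using \<open>x \<ge> 2\<close> unfolding X_def by linarith
        finally show "0 < k + divisor_tau k \<and> real (k + divisor_tau k) \<le> x \<and>
            (\<exists>k'>0. k + divisor_tau k = k' + divisor_tau k')" using k by auto
      qed
    qed
    finally have "real X * c \<le> real (N_plus_tau x)" .
    moreover have "x / 4 \<le> real X"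
    proof -
      have "x \<ge> 4" using x one_le_power[of "2::real" "128 * 2 ^ N0"] by linarith
      thus ?thesis unfolding X_def by linarith
    qed
    hence "x / 4 * c \<le> real X * c" using c0 by (intro mult_right_mono) auto
    ultimately show ?thesis by (simp add: mult_ac)
  qed
  show ?thesis using main c0
    by (intro exI[of _ "c / 4"] conjI exI[of _ "2 * 2 ^ (128 * 2 ^ N0) + 2"]) auto
qed

section \<open>An L-function modulo 6\<close>

lemma complex_powr_diff_bound:
  fixes s :: complex and a b :: real
  assumes "0 < a" "a \<le> b" "Re s \<ge> 0"
  shows "norm (of_real b powr (- s) - of_real a powr (- s)) \<le> norm s * (b - a) * a powr (- Re s - 1)"
proof -
  have "norm (of_real b powr (- s) - of_real a powr (- s)) \<le> (norm s * a powr (- Re s - 1)) * norm (of_real b - of_real a :: complex)"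
  proof (rule field_differentiable_bound[of "closed_segment (of_real a) (of_real b)" _ "\<lambda>z. - s * z powr (- s - 1)"])
    fix z :: complex assume "z \<in> closed_segment (of_real a) (of_real b)"
    then obtain t where t: "z = of_real t" "t \<in> closed_segment a b"
      by (auto simp: closed_segment_of_real)
    hence ta: "t \<ge> a" using assms by (auto simp: closed_segment_eq_real_ivl split: if_splits)
    have t0: "t > 0" using ta assms by linarith
    show "((\<lambda>z. z powr (- s)) has_field_derivative - s * z powr (- s - 1)) (at z within closed_segment (of_real a) (of_real b))"
      using t t0 by (intro has_field_derivative_at_within[OF has_field_derivative_powr]) (auto simp: complex_nonpos_Reals_iff)
    have "t powr (- Re s - 1) \<le> a powr (- Re s - 1)"
      using ta assms by (intro powr_mono2') auto
    thus "norm (- s * z powr (- s - 1)) \<le> norm s * a powr (- Re s - 1)"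
      using t t0 by (simp add: norm_mult norm_powr_real_powr mult_left_mono)
  qed auto
  thus ?thesis using assms by (simp add: mult_ac norm_of_real flip: of_real_diff)
qed

text \<open>The nonprincipal character modulo 6. It vanishes at even numbers because the weights of
  the upper bound depend on the 2-adic valuation, so mean values are first taken over odd
  parts.\<close>

definition psi :: "nat \<Rightarrow> real" where
  "psi n = (if n mod 6 = 1 then 1 else if n mod 6 = 5 then - 1 else 0)"

lemma mod6_cases: "n mod 6 \<in> {0, 1, 2, 3, 4, 5::nat}"
proof -
  have "n mod 6 < 6" by simp
  thus ?thesis by auto
qed

lemma psi_mult: "psi (m * n) = psi m * psi n"
proof -
  have "psi (a * b) = psi a * psi b" if "a \<in> {0, 1, 2, 3, 4, 5}" "b \<in> {0, 1, 2, 3, 4, 5}" for a b :: nat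
    using that by (elim insertE emptyE; hypsubst; simp add: psi_def)
  from this[OF mod6_cases mod6_cases, of m n] show ?thesis
    by (simp only: psi_def mod_mult_eq mod_mod_trivial)
qed

lemma psi_shift: "psi (6 * k + j) = psi j"
  by (simp add: psi_def)

lemma psi_0 [simp]: "psi 0 = 0" and psi_1 [simp]: "psi 1 = 1" "psi (Suc 0) = 1"
  by (simp_all add: psi_def)

lemma psi_power: "psi (n ^ e) = psi n ^ e"
  by (induction e) (auto simp: psi_mult)

lemma abs_psi_le: "\<bar>psi n\<bar> \<le> 1"
  by (simp add: psi_def)

lemma psi_cube: "psi n ^ 3 = psi n"
  by (simp add: psi_def)

lemma psi_square: "psi n \<noteq> 0 \<Longrightarrow> psi n ^ 2 = 1"
  by (auto simp: psi_def split: if_splits)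

definition psi_term :: "complex \<Rightarrow> nat \<Rightarrow> complex" where
  "psi_term s n = of_real (psi n) * of_nat n powr (- s)"

definition chi0_term :: "complex \<Rightarrow> nat \<Rightarrow> complex" where
  "chi0_term s n = of_real (psi n ^ 2) * of_nat n powr (- s)"

text \<open>Consecutive nonzero terms are paired. The paired series converges for
  \<open>Re s > 0\<close> and thus continues the Dirichlet series across the line
  \<open>Re s = 1\<close>.\<close>

definition Lfun :: "complex \<Rightarrow> complex" where
  "Lfun s = (\<Sum>k. of_real (6 * real k + 1) powr (- s) - of_real (6 * real k + 5) powr (- s))"

text \<open>As \<open>psi n ^ 2\<close> is the principal character modulo 6, for
  \<open>Re s > 1\<close> this is the Riemann zeta function without its Euler factors at 2 and
  3.\<close>

definition zeta6 :: "complex \<Rightarrow> complex" where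
  "zeta6 s = (\<Sum>n. chi0_term s n)"

lemma norm_nat_powr: "n > 0 \<Longrightarrow> norm (of_nat n powr s :: complex) = real n powr Re s"
  using norm_powr_real_powr[of "of_nat n" s] by simp

lemma summable_bounded_dirichlet:
  fixes c :: "nat \<Rightarrow> real"
  assumes "\<And>n. \<bar>c n\<bar> \<le> 1" "Re s > 1"
  shows "summable (\<lambda>n. norm (of_real (c n) * of_nat n powr (- s) :: complex))"
proof (rule summable_comparison_test')
  show "summable (\<lambda>n. real n powr (- Re s))" using assms by (subst summable_real_powr_iff) auto
  show "norm (norm (of_real (c n) * of_nat n powr (- s) :: complex)) \<le> real n powr (- Re s)" if "n \<ge> 0" for n
  proof (cases "n = 0")
    case False
    thus ?thesis using assms(1)[of n] by (simp add: norm_mult norm_nat_powr mult_left_le_one_le)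
  qed simp
qed

lemma summable_psi_term: "Re s > 1 \<Longrightarrow> summable (\<lambda>n. norm (psi_term s n))"
  unfolding psi_term_def by (rule summable_bounded_dirichlet) (auto simp: abs_psi_le)

lemma summable_chi0_term: "Re s > 1 \<Longrightarrow> summable (\<lambda>n. norm (chi0_term s n))"
  unfolding chi0_term_def by (rule summable_bounded_dirichlet) (auto simp: psi_def)

lemma sum_block6: "(\<Sum>n = k * 6..<k * 6 + 6. f n) = f (6*k) + f (6*k+1) + f (6*k+2) + f (6*k+3) + f (6*k+4) + f (6*k+5)"
  for f :: "nat \<Rightarrow> complex"
proof -
  have "{k * 6..<k * 6 + 6} = {6*k, 6*k+1, 6*k+2, 6*k+3, 6*k+4, 6*k+5}" by auto
  thus ?thesis by simp
qed

lemma psi_term_block: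
  "(\<Sum>n = k * 6..<k * 6 + 6. psi_term s n) = of_real (6 * real k + 1) powr (- s) - of_real (6 * real k + 5) powr (- s)"
proof -
  have "psi (6 * k) = 0" "psi (6 * k + 1) = 1" "psi (6 * k + 2) = 0" "psi (6 * k + 3) = 0" "psi (6 * k + 4) = 0"
    "psi (6 * k + 5) = - 1"
    unfolding psi_shift by (simp_all add: psi_def)
  thus ?thesis unfolding sum_block6 psi_term_def by (simp only:) (simp add: add.commute)
qed

lemma chi0_term_block:
  "(\<Sum>n = k * 6..<k * 6 + 6. chi0_term s n) = of_real (6 * real k + 1) powr (- s) + of_real (6 * real k + 5) powr (- s)"
proof -
  have "psi (6 * k) = 0" "psi (6 * k + 1) = 1" "psi (6 * k + 2) = 0" "psi (6 * k + 3) = 0" "psi (6 * k + 4) = 0"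
    "psi (6 * k + 5) = - 1"
    unfolding psi_shift by (simp_all add: psi_def)
  thus ?thesis unfolding sum_block6 chi0_term_def by (simp only:) (simp add: add.commute)
qed

lemma psi_term_sums_Lfun: assumes "Re s > 1" shows "psi_term s sums Lfun s"
proof -
  have "psi_term s sums (\<Sum>n. psi_term s n)"
    by (rule summable_sums[OF summable_norm_cancel[OF summable_psi_term[OF assms]]])
  from sums_group[OF this, of 6] have "(\<Sum>n. psi_term s n) = Lfun s"
    unfolding psi_term_block Lfun_def by (simp add: sums_iff)
  thus ?thesis using summable_sums[OF summable_norm_cancel[OF summable_psi_term[OF assms]]] by simp
qed

lemma summable_6k1_powr: "x > 1 \<Longrightarrow> summable (\<lambda>k. (6 * real k + 1) powr (- x))"
proof (rule summable_comparison_test'[of "\<lambda>k. real k powr (- x)" 1])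
  assume "x > 1"
  thus "summable (\<lambda>k. real k powr (- x))" by (subst summable_real_powr_iff) auto
  fix k :: nat assume "k \<ge> 1"
  thus "norm ((6 * real k + 1) powr (- x)) \<le> real k powr (- x)"
    using \<open>x > 1\<close> by (simp add: powr_mono2')
qed

lemma norm_Lfun_term_le:
  assumes "Re s \<ge> 0"
  shows "norm (of_real (6 * real k + 1) powr (- s) - of_real (6 * real k + 5) powr (- s))
    \<le> 4 * norm s * (6 * real k + 1) powr (- Re s - 1)"
  using complex_powr_diff_bound[of "6 * real k + 1" "6 * real k + 5" s] assms
  by (simp add: norm_minus_commute)

text \<open>By the mean value inequality a pair is of order
  \<open>norm s * (6 * k + 1) powr (- Re s - 1)\<close>. Discs of radius \<open>Re s / 2\<close>
  keep the real part bounded away from 0, so the convergence is locally uniform and preserves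
  differentiability.\<close>

lemma Lfun_sums_and_differentiable:
  assumes "Re s > 0"
  shows "(\<lambda>k. of_real (6 * real k + 1) powr (- s) - of_real (6 * real k + 5) powr (- s)) sums Lfun s"
    and "Lfun field_differentiable (at s)"
proof -
  let ?f = "\<lambda>k s. of_real (6 * real k + 1) powr (- s) - of_real (6 * real k + 5) powr (- s) :: complex"
  let ?S = "{s. Re s > 0}"
  have op: "open ?S" by (rule open_halfspace_Re_gt)
  have nz: "6 * real k + 1 > 0" "6 * real k + 5 > 0" for k by linarith+
  obtain g where g: "\<And>s. s \<in> ?S \<Longrightarrow> (\<lambda>k. ?f k s) sums g s" "\<And>s. s \<in> ?S \<Longrightarrow> g field_differentiable (at s)"
  proof (rule series_differentiable_comparison_complex[OF op, of ?f])
    fix n s assume "s \<in> ?S"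
    have "of_real (6 * real n + 1) \<noteq> (0::complex)" "of_real (6 * real n + 5) \<noteq> (0::complex)"
      using nz[of n] by (simp_all only: of_real_eq_0_iff)
    hence "(\<lambda>s. ?f n s) holomorphic_on UNIV"
      by (intro holomorphic_intros)
    thus "?f n field_differentiable (at s)"
      by (auto simp: holomorphic_on_def)
  next
    fix s assume s: "s \<in> ?S"
    define d where "d = Re s / 2"
    have d: "d > 0" using s by (simp add: d_def)
    define h where "h n = complex_of_real (4 * (norm s + d) * (6 * real n + 1) powr (- (1 + d)))" for n
    have sm: "summable h" unfolding h_def
      using summable_6k1_powr[of "1 + d"] d by (intro summable_of_real summable_mult) auto
    have rg: "range h \<subseteq> \<real>\<^sub>\<ge>\<^sub>0"
      unfolding h_def using d by (auto intro!: mult_nonneg_nonneg add_nonneg_nonneg)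
    have bd: "norm (?f n y) \<le> norm (h n)" if y: "y \<in> ball s d \<inter> ?S" for n y
    proof -
      have "norm y \<le> norm s + d" using y norm_triangle_sub[of y s] by (auto simp: dist_norm norm_minus_commute)
      moreover have "\<bar>Re s - Re y\<bar> \<le> norm (s - y)" using abs_Re_le_cmod[of "s - y"] by simp
      hence "Re y \<ge> d" using y by (auto simp: dist_norm d_def)
      hence "(6 * real n + 1) powr (- Re y - 1) \<le> (6 * real n + 1) powr (- (1 + d))" by (intro powr_mono) auto
      ultimately have "4 * norm y * (6 * real n + 1) powr (- Re y - 1) \<le> 4 * (norm s + d) * (6 * real n + 1) powr (- (1 + d))"
        using d by (intro mult_mono mult_nonneg_nonneg add_nonneg_nonneg) auto
      moreover have "norm (h n) = 4 * (norm s + d) * (6 * real n + 1) powr (- (1 + d))"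
        unfolding h_def norm_of_real using d by (intro abs_of_nonneg mult_nonneg_nonneg add_nonneg_nonneg) auto
      ultimately show ?thesis using norm_Lfun_term_le[of y n] y by auto
    qed
    show "\<exists>d h. 0 < d \<and> summable h \<and> range h \<subseteq> \<real>\<^sub>\<ge>\<^sub>0 \<and>
        (\<forall>\<^sub>F n in sequentially. \<forall>y\<in>ball s d \<inter> ?S. norm (?f n y) \<le> cmod (h n))"
      by (intro exI[of _ d] exI[of _ h] conjI always_eventually allI ballI d sm rg bd)
  qed blast
  have geq: "g s = Lfun s" if "s \<in> ?S" for s
    using g(1)[OF that] by (simp add: Lfun_def sums_iff)
  show "(\<lambda>k. ?f k s) sums Lfun s" using g(1)[of s] geq[of s] assms by simp
  show "Lfun field_differentiable (at s)"
  proof -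
    have "s \<in> ?S" using assms by simp
    from g(2)[OF this] obtain D where "(g has_field_derivative D) (at s)" by (auto simp: field_differentiable_def)
    hence "(Lfun has_field_derivative D) (at s)"
      by (rule has_field_derivative_transform_within_open[OF _ op \<open>s \<in> ?S\<close> geq])
    thus ?thesis by (auto simp: field_differentiable_def)
  qed
qed

lemma Lfun_holomorphic: "Lfun holomorphic_on {s. Re s > 0}"
  using Lfun_sums_and_differentiable(2) by (auto simp: holomorphic_on_def intro: field_differentiable_at_within)

text \<open>At 1 every pair is positive.\<close>

lemma Lfun_1_nonzero: "Lfun 1 \<noteq> 0"
proof -
  let ?f = "\<lambda>k. 1 / (6 * real k + 1) - 1 / (6 * real k + 5)"
  have eq: "of_real (6 * real k + 1) powr (- 1) - of_real (6 * real k + 5) powr (- 1) = (of_real (?f k) :: complex)" for k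
  proof -
    have "of_real (6 * real k + 1) powr (- 1 :: complex) = of_real ((6 * real k + 1) powr (- 1))"
      using powr_of_real[of "6 * real k + 1" "- 1"] by simp
    moreover have "of_real (6 * real k + 5) powr (- 1 :: complex) = of_real ((6 * real k + 5) powr (- 1))"
      using powr_of_real[of "6 * real k + 5" "- 1"] by simp
    ultimately show ?thesis by (simp add: powr_minus_divide)
  qed
  have "(\<lambda>k. of_real (?f k) :: complex) sums Lfun 1"
    using Lfun_sums_and_differentiable(1)[of 1] unfolding eq by simp
  hence "summable (\<lambda>k. of_real (?f k) :: complex)" by (rule sums_summable)
  hence sm: "summable ?f" by (simp only: summable_of_real_iff)
  hence "Lfun 1 = of_real (\<Sum>k. ?f k)"
    using \<open>(\<lambda>k. of_real (?f k) :: complex) sums Lfun 1\<close> sums_unique2[OF _ sums_of_real[OF summable_sums[OF sm]]] by blast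
  moreover have "(\<Sum>k. ?f k) > 0"
  proof (rule suminf_pos[OF sm])
    fix n :: nat
    have "1 / (6 * real n + 5) < 1 / (6 * real n + 1)"
      by (intro divide_strict_left_mono mult_pos_pos add_nonneg_pos) auto
    thus "0 < ?f n" by simp
  qed
  ultimately show ?thesis by simp
qed

text \<open>The logarithm of the left side is a series with terms
  \<open>- r ^ n / n * (3 + 4 * Re w + Re (w ^ 2))\<close>, where \<open>w = u ^ n\<close> lies on
  the unit circle, and there the bracket equals \<open>2 * (1 + Re w) ^ 2\<close>. This is one Euler
  factor of the 3-4-1 inequality.\<close>

lemma mertens_factor_le_1:
  fixes u :: complex and r :: real
  assumes "0 \<le> r" "r < 1" "norm u = 1"
  shows "(1 - r) ^ 3 * norm (1 - of_real r * u) ^ 4 * norm (1 - of_real r * u ^ 2) \<le> 1"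
proof -
  have ser: "(\<lambda>n. - (r ^ n / real n * Re (w ^ n))) sums ln (norm (1 - of_real r * w))" if "norm w = 1" for w :: complex
  proof -
    have n1: "norm (- (of_real r * w)) < 1" using that assms by (simp add: norm_mult)
    hence "1 - of_real r * w \<noteq> 0" by (metis eq_iff_diff_eq_0 less_irrefl norm_minus_cancel norm_one)
    have "(\<lambda>n. - ((- (- (of_real r * w))) ^ n) / of_nat n) sums ln (1 + - (of_real r * w))"
      by (rule Ln_series'[OF n1])
    from sums_Re[OF this] have "(\<lambda>n. Re (- ((of_real r * w) ^ n) / of_nat n)) sums Re (ln (1 - of_real r * w))" by simp
    moreover have "Re (- ((of_real r * w) ^ n) / of_nat n) = - (r ^ n / real n * Re (w ^ n))" for n
    proof -
      have "- ((of_real r * w) ^ n) / of_nat n = of_real (- (r ^ n / real n)) * w ^ n"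
        by (simp add: power_mult_distrib)
      thus ?thesis by (simp add: power_mult_distrib flip: of_real_power)
    qed
    ultimately show ?thesis using Re_Ln[OF \<open>1 - of_real r * w \<noteq> 0\<close>] by (simp only:)
  qed
  have nz: "norm (1 - of_real r * w) > 0" if "norm w = 1" for w :: complex
  proof -
    have "norm (of_real r * w) < 1" using that assms by (simp add: norm_mult)
    hence "of_real r * w \<noteq> 1" by auto
    thus ?thesis by simp
  qed
  have u2: "norm (u ^ 2) = 1" using assms by (simp add: norm_power)
  have S: "(\<lambda>n. 3 * - (r ^ n / real n * Re (1 ^ n)) + 4 * - (r ^ n / real n * Re (u ^ n)) + - (r ^ n / real n * Re ((u ^ 2) ^ n)))
     sums (3 * ln (norm (1 - of_real r * 1 :: complex)) + 4 * ln (norm (1 - of_real r * u)) + ln (norm (1 - of_real r * u ^ 2)))"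
    using assms u2 by (intro sums_add sums_mult ser) auto
  have N: "3 * - (r ^ n / real n * Re (1 ^ n)) + 4 * - (r ^ n / real n * Re (u ^ n)) + - (r ^ n / real n * Re ((u ^ 2) ^ n)) \<le> 0" for n
  proof -
    define w where "w = u ^ n"
    have "norm w = 1" using assms by (simp add: w_def norm_power)
    hence "Re w ^ 2 + Im w ^ 2 = 1" by (metis cmod_power2 one_power2)
    hence R2: "Re (w ^ 2) = 2 * Re w ^ 2 - 1" by (simp add: power2_eq_square)
    have uw: "(u ^ 2) ^ n = w ^ 2" by (simp add: w_def flip: power_mult) (simp add: mult.commute)
    have "3 * - (r ^ n / real n * Re (1 ^ n)) + 4 * - (r ^ n / real n * Re (u ^ n)) + - (r ^ n / real n * Re ((u ^ 2) ^ n))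
       = - (r ^ n / real n * (2 * (1 + Re w) ^ 2))"
      unfolding uw R2 w_def[symmetric] by (simp add: power2_eq_square algebra_simps)
    thus ?thesis using assms by simp
  qed
  have le: "3 * ln (norm (1 - of_real r * 1 :: complex)) + 4 * ln (norm (1 - of_real r * u)) + ln (norm (1 - of_real r * u ^ 2)) \<le> 0"
    by (rule sums_le[OF N S sums_zero])
  have r1: "norm (1 - of_real r * 1 :: complex) = 1 - r"
    using assms by (metis abs_of_pos diff_gt_0_iff_gt mult.right_neutral norm_of_real of_real_1 of_real_diff)
  have "ln ((1 - r) ^ 3 * norm (1 - of_real r * u) ^ 4 * norm (1 - of_real r * u ^ 2)) =
      3 * ln (1 - r) + 4 * ln (norm (1 - of_real r * u)) + ln (norm (1 - of_real r * u ^ 2))"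
    using assms nz[OF assms(3)] nz[OF u2] by (simp add: ln_mult ln_realpow)
  also have "\<dots> \<le> 0" using le unfolding r1 .
  finally show ?thesis
    using assms nz[OF assms(3)] nz[OF u2] by (subst (asm) ln_le_zero_iff) auto
qed


section \<open>The Dirichlet series of psi times tau3\<close>

definition tau3 :: "nat \<Rightarrow> real" where
  "tau3 n = (if divisor_tau n mod 3 = 1 then 1 else if divisor_tau n mod 3 = 2 then - 1 else 0)"

text \<open>The factor of \<open>\<Sum> \<psi>(n) f(n) n\<^sup>-\<^sup>s\<close> at a prime \<open>p\<close> is \<open>(1 - z) / (1 - z\<^sup>3)\<close> with
  \<open>z = \<psi>(p) p\<^sup>-\<^sup>s\<close>, because \<open>\<tau>(p\<^sup>e) = e + 1\<close>; this is why the series is \<open>L(3s) / L(s)\<close>.\<close>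

definition G_term :: "complex \<Rightarrow> nat \<Rightarrow> complex" where
  "G_term s n = of_real (psi n * tau3 n) * of_nat n powr (- s)"

text \<open>Nine pairs of residues. Both \<open>tau3\<close> and \<open>chi3\<close> are this
  symbol, the former evaluated at \<tau>(n).\<close>

lemma symbol3_mult:
  fixes a b :: nat
  defines "f \<equiv> \<lambda>a::nat. if a mod 3 = 1 then 1 else if a mod 3 = 2 then - 1 else (0::real)"
  shows "f (a * b) = f a * f b"
proof -
  have *: "f (x * y) = f x * f y" if "x \<in> {0, 1, 2}" "y \<in> {0, 1, 2}" for x y :: nat
    using that unfolding f_def by (elim insertE emptyE; hypsubst; simp)
  have "n mod 3 \<in> {0, 1, 2::nat}" for n
  proof -
    have "n mod 3 < 3" by simp
    thus ?thesis by auto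
  qed
  from *[OF this this, of a b] show ?thesis by (simp only: f_def mod_mult_eq mod_mod_trivial)
qed

lemma tau3_prime_power_mult:
  assumes "prime p" "\<not> p dvd m"
  shows "tau3 (p ^ e * m) = tau3 (p ^ e) * tau3 m"
  unfolding tau3_def divisor_tau_prime_power_mult[OF assms] divisor_tau_prime_power[OF assms(1)]
  by (rule symbol3_mult)

lemma tau3_prime_power: "prime p \<Longrightarrow> tau3 (p ^ e) = (if e mod 3 = 0 then 1 else if e mod 3 = 1 then - 1 else 0)"
proof -
  assume "prime p"
  have "(e + 1) mod 3 = 1 \<longleftrightarrow> e mod 3 = 0" "(e + 1) mod 3 = 2 \<longleftrightarrow> e mod 3 = 1" by presburger+
  thus ?thesis by (simp add: tau3_def divisor_tau_prime_power[OF \<open>prime p\<close>])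
qed

lemma abs_tau3_le: "\<bar>tau3 n\<bar> \<le> 1" by (simp add: tau3_def)

lemma of_nat_mult_powr: "of_nat (m * n) powr s = (of_nat m powr s * of_nat n powr s :: complex)"
  using powr_times_real[of "of_nat m" "of_nat n" s] by simp

lemma of_nat_power_powr: "of_nat (m ^ n) powr s = ((of_nat m powr s) ^ n :: complex)" if "m > 0"
  using that by (induction n) (auto simp: of_nat_mult_powr simp del: of_nat_power of_nat_mult)

text \<open>The third equation rests on \<open>psi p ^ 3 = psi p\<close>: the cube of the Euler
  parameter at \<open>s\<close> is the parameter of the same L-function at
  \<open>3 * s\<close>.\<close>

lemma prime_psi_z:
  fixes s :: complex
  assumes "prime p" "Re s > 1"
  defines "z \<equiv> of_real (psi p) * of_nat p powr (- s)"
  shows "psi_term s (p ^ e) = z ^ e" "G_term s (p ^ e) = of_real (tau3 (p ^ e)) * z ^ e"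
    "psi_term (3 * s) (p ^ e) = (z ^ 3) ^ e" "norm z < 1"
proof -
  have p0: "p > 0" "p > 1" using assms prime_gt_0_nat prime_gt_1_nat by auto
  show "psi_term s (p ^ e) = z ^ e" "G_term s (p ^ e) = of_real (tau3 (p ^ e)) * z ^ e"
    unfolding psi_term_def G_term_def z_def psi_power of_nat_power_powr[OF p0(1)]
    by (simp_all add: power_mult_distrib)
  have "of_nat p powr (- (3 * s)) = ((of_nat p powr (- s)) ^ 3 :: complex)"
    using p0 by (simp add: powr_def flip: exp_of_nat_mult) (simp add: mult_ac)?
  hence "psi_term (3 * s) p = of_real (psi p ^ 3) * (of_nat p powr (- s)) ^ 3"
    by (simp add: psi_term_def psi_cube)
  hence "psi_term (3 * s) p = z ^ 3" by (simp add: z_def power_mult_distrib)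
  moreover have "psi_term (3 * s) (p ^ e) = psi_term (3 * s) p ^ e"
    unfolding psi_term_def psi_power of_nat_power_powr[OF p0(1)] by (simp add: power_mult_distrib)
  ultimately show "psi_term (3 * s) (p ^ e) = (z ^ 3) ^ e" by simp
  have "norm z \<le> 1 * real p powr (- Re s)"
    unfolding z_def norm_mult using abs_psi_le[of p] p0 by (intro mult_mono) (auto simp: norm_nat_powr)
  also have "\<dots> < 1" using p0 assms by (simp add: powr_less_one)
  finally show "norm z < 1" .
qed

text \<open>The coefficients repeat 1, -1, 0, so blocks of three give \<open>1 - z\<close> times a
  geometric series in \<open>z ^ 3\<close>.\<close>

lemma suminf_tau3_powers:
  fixes z :: complex
  assumes "norm z < 1" "prime p"
  shows "(\<Sum>e. of_real (tau3 (p ^ e)) * z ^ e) = (1 - z) / (1 - z ^ 3)"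
proof -
  have z3: "norm (z ^ 3) < 1" using assms by (simp add: norm_power power_less_one_iff)
  have sm: "summable (\<lambda>e. of_real (tau3 (p ^ e)) * z ^ e)"
  proof (rule summable_comparison_test')
    show "summable (\<lambda>e. norm z ^ e)" using assms by (intro summable_geometric) auto
    show "norm (of_real (tau3 (p ^ e)) * z ^ e) \<le> norm z ^ e" if "e \<ge> 0" for e
      using abs_tau3_le[of "p ^ e"] by (simp add: norm_mult norm_power mult_left_le_one_le)
  qed
  have blk: "(\<Sum>e = k * 3..<k * 3 + 3. of_real (tau3 (p ^ e)) * z ^ e) = (z ^ 3) ^ k * (1 - z)" for k
  proof -
    have "{k * 3..<k * 3 + 3} = {3 * k, 3 * k + 1, 3 * k + 2}" by auto
    moreover have "tau3 (p ^ (3 * k)) = 1" "tau3 (p ^ (3 * k + 1)) = - 1" "tau3 (p ^ (3 * k + 2)) = 0"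
    proof -
      have "(3 * k) mod 3 = 0" "(3 * k + 1) mod 3 = 1" "(3 * k + 2) mod 3 = 2" by presburger+
      thus "tau3 (p ^ (3 * k)) = 1" "tau3 (p ^ (3 * k + 1)) = - 1" "tau3 (p ^ (3 * k + 2)) = 0"
        unfolding tau3_prime_power[OF assms(2)] by (simp_all only:) simp_all
    qed
    moreover have "z ^ (3 * k) = (z ^ 3) ^ k" "z ^ (3 * k + 1) = (z ^ 3) ^ k * z" by (simp_all add: power_mult)
    ultimately show ?thesis by (simp add: algebra_simps)
  qed
  have "(\<lambda>k. (z ^ 3) ^ k * (1 - z)) sums (\<Sum>e. of_real (tau3 (p ^ e)) * z ^ e)"
    using sums_group[OF summable_sums[OF sm], of 3] unfolding blk by simp
  moreover have "(\<lambda>k. (z ^ 3) ^ k * (1 - z)) sums (1 / (1 - z ^ 3) * (1 - z))"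
    by (intro sums_mult2 geometric_sums z3)
  ultimately show ?thesis by (simp add: sums_iff)
qed

lemma psi_term_mult: "psi_term s (m * n) = psi_term s m * psi_term s n"
  unfolding psi_term_def psi_mult of_nat_mult_powr by simp

lemma chi0_term_mult: "chi0_term s (m * n) = chi0_term s m * chi0_term s n"
  unfolding chi0_term_def psi_mult of_nat_mult_powr by (simp add: power_mult_distrib)

lemma psi_term_simps [simp]: "psi_term s 0 = 0" "psi_term s 1 = 1" "psi_term s (Suc 0) = 1"
  by (simp_all add: psi_term_def)

lemma chi0_term_simps [simp]: "chi0_term s 0 = 0" "chi0_term s 1 = 1" "chi0_term s (Suc 0) = 1"
  by (simp_all add: chi0_term_def)

lemma tau3_1 [simp]: "tau3 1 = 1" "tau3 (Suc 0) = 1"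
  by (simp_all add: tau3_def divisor_tau_def)

lemma summable_G_term: "Re s > 1 \<Longrightarrow> summable (\<lambda>n. norm (G_term s n))"
  unfolding G_term_def
proof (rule summable_bounded_dirichlet)
  show "\<bar>psi n * tau3 n\<bar> \<le> 1" for n
    unfolding abs_mult using abs_psi_le[of n] abs_tau3_le[of n] by (intro mult_le_one) auto
qed auto

text \<open>The product form holds without knowing that \<open>Lfun\<close> has no zeros; the
  quotient is taken after nonvanishing is established.\<close>

theorem G_series_times_Lfun:
  assumes "Re s > 1"
  shows "(\<Sum>n. G_term s n) * Lfun s = Lfun (3 * s)"
proof -
  let ?P = "\<lambda>N. {p::nat. prime p \<and> p \<le> N}"
  have s3: "Re (3 * s) > 1" using assms by simp
  have L: "(\<lambda>N. \<Prod>p\<in>?P N. \<Sum>e. psi_term t (p ^ e)) \<longlonglongrightarrow> Lfun t" if "Re t > 1" for t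
    using euler_product_tendsto[OF _ _ summable_psi_term[OF that]] psi_term_sums_Lfun[OF that]
    by (simp add: psi_term_mult sums_iff)
  have G: "(\<lambda>N. \<Prod>p\<in>?P N. \<Sum>e. G_term s (p ^ e)) \<longlonglongrightarrow> (\<Sum>n. G_term s n)"
  proof (rule euler_product_tendsto[OF _ _ summable_G_term[OF assms]])
    fix p e m :: nat assume p: "prime p" "\<not> p dvd m"
    show "G_term s (p ^ e * m) = G_term s (p ^ e) * G_term s m"
      unfolding G_term_def psi_mult tau3_prime_power_mult[OF p] of_nat_mult_powr by simp
  qed (simp_all add: G_term_def)
  have "(\<Prod>p\<in>?P N. \<Sum>e. G_term s (p ^ e)) * (\<Prod>p\<in>?P N. \<Sum>e. psi_term s (p ^ e)) =
      (\<Prod>p\<in>?P N. \<Sum>e. psi_term (3 * s) (p ^ e))" for N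
    unfolding prod.distrib[symmetric]
  proof (intro prod.cong refl)
    fix p assume "p \<in> ?P N"
    hence p: "prime p" by simp
    define z where "z = of_real (psi p) * of_nat p powr (- s)"
    note z = prime_psi_z[OF p assms, folded z_def]
    have z3: "norm (z ^ 3) < 1" using z(4) by (simp add: norm_power power_less_one_iff)
    have "z \<noteq> 1" using z(4) by auto
    thus "(\<Sum>e. G_term s (p ^ e)) * (\<Sum>e. psi_term s (p ^ e)) = (\<Sum>e. psi_term (3 * s) (p ^ e))"
      unfolding z(1-3) suminf_tau3_powers[OF z(4) p] suminf_geometric[OF z(4)] suminf_geometric[OF z3] by simp
  qed
  hence "(\<lambda>N. \<Prod>p\<in>?P N. \<Sum>e. psi_term (3 * s) (p ^ e)) \<longlonglongrightarrow> (\<Sum>n. G_term s n) * Lfun s"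
    using tendsto_mult[OF G L[OF assms]] by simp
  thus ?thesis using L[OF s3] LIMSEQ_unique by blast
qed

section \<open>Nonvanishing of the L-function for real part at least 1\<close>

lemma three_four_one:
  assumes "\<sigma> > 1"
  shows "norm (zeta6 (of_real \<sigma>)) ^ 3 * norm (Lfun (Complex \<sigma> t)) ^ 4 * norm (zeta6 (Complex \<sigma> (2 * t))) \<ge> 1"
proof -
  let ?P = "\<lambda>N. {p::nat. prime p \<and> p \<le> N}"
  let ?s = "Complex \<sigma> t" and ?s2 = "Complex \<sigma> (2 * t)"
  have re: "Re (of_real \<sigma>) > 1" "Re ?s > 1" "Re ?s2 > 1" using assms by auto
  have L: "(\<lambda>N. \<Prod>p\<in>?P N. \<Sum>e. psi_term s (p ^ e)) \<longlonglongrightarrow> Lfun s" if "Re s > 1" for s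
    using euler_product_tendsto[OF _ _ summable_psi_term[OF that]] psi_term_sums_Lfun[OF that]
    by (simp add: psi_term_mult sums_iff)
  have Z: "(\<lambda>N. \<Prod>p\<in>?P N. \<Sum>e. chi0_term s (p ^ e)) \<longlonglongrightarrow> zeta6 s" if "Re s > 1" for s
    using euler_product_tendsto[OF _ _ summable_chi0_term[OF that]]
    by (simp add: chi0_term_mult zeta6_def)
  let ?T = "\<lambda>N. norm (\<Prod>p\<in>?P N. \<Sum>e. chi0_term (of_real \<sigma>) (p ^ e)) ^ 3 *
      norm (\<Prod>p\<in>?P N. \<Sum>e. psi_term ?s (p ^ e)) ^ 4 * norm (\<Prod>p\<in>?P N. \<Sum>e. chi0_term ?s2 (p ^ e))"
  have "?T \<longlonglongrightarrow> norm (zeta6 (of_real \<sigma>)) ^ 3 * norm (Lfun ?s) ^ 4 * norm (zeta6 ?s2)"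
    by (intro tendsto_intros L Z re)
  moreover have "?T N \<ge> 1" for N
  proof -
    have "?T N = (\<Prod>p\<in>?P N. norm (\<Sum>e. chi0_term (of_real \<sigma>) (p ^ e)) ^ 3 * norm (\<Sum>e. psi_term ?s (p ^ e)) ^ 4 *
        norm (\<Sum>e. chi0_term ?s2 (p ^ e)))"
      by (simp only: prod.distrib prod_norm[symmetric] prod_power_distrib)
    also have "\<dots> \<ge> 1"
    proof (rule prod_ge_1)
      fix p assume "p \<in> ?P N"
      hence p: "prime p" by simp
      have p0: "p > 0" using p prime_gt_0_nat by blast
      have geo: "norm (\<Sum>e. x ^ e) = inverse (norm (1 - x))" if "norm x < 1" for x :: complex
        using suminf_geometric[OF that] by (simp add: norm_divide norm_inverse inverse_eq_divide)
      have chi0_pow: "chi0_term s (p ^ e) = chi0_term s p ^ e" for s e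
        by (induction e) (auto simp: chi0_term_mult)
      have psi_pow: "psi_term s (p ^ e) = psi_term s p ^ e" for s e
        by (induction e) (auto simp: psi_term_mult)
      show "1 \<le> norm (\<Sum>e. chi0_term (of_real \<sigma>) (p ^ e)) ^ 3 * norm (\<Sum>e. psi_term ?s (p ^ e)) ^ 4 *
        norm (\<Sum>e. chi0_term ?s2 (p ^ e))"
      proof (cases "psi p = 0")
        \<comment> \<open>At the primes 2 and 3 all three Euler factors are 1.\<close>
        case True
        have "(\<Sum>e. (0::complex) ^ e) = 1" using suminf_geometric[of "0::complex"] by simp
        thus ?thesis using True unfolding chi0_pow psi_pow by (simp add: chi0_term_def psi_term_def)
      next
        case False
        \<comment> \<open>Since \<open>psi p ^ 2 = 1\<close>, the three Euler parameters are
          \<open>r\<close>, \<open>r * u\<close> and \<open>r * u ^ 2\<close> with \<open>u\<close>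
          on the unit circle. This is why \<open>zeta6\<close> and not \<open>Lfun\<close> stands at
          \<open>2 * t\<close>.\<close>
        define r where "r = real p powr (- \<sigma>)"
        have r: "0 < r" "r < 1" using p0 prime_gt_1_nat[OF p] assms by (auto simp: r_def powr_less_one)
        define u where "u = psi_term ?s p / of_real r"
        have ps: "psi_term ?s p = of_real r * u" using r by (simp add: u_def)
        have sq: "psi p ^ 2 = 1" using psi_square[OF False] .
        hence ap: "\<bar>psi p\<bar> = 1" by (simp add: power2_eq_1_iff abs_if) auto
        have c1: "chi0_term (of_real \<sigma>) p = of_real r"
          using p0 powr_of_real[of "real p" "- \<sigma>"] by (simp add: chi0_term_def sq r_def)
        have nu: "norm u = 1"
          using ap p0 r by (simp add: u_def norm_divide psi_term_def norm_mult norm_nat_powr r_def)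
        have c2: "chi0_term ?s2 p = of_real r * u ^ 2"
        proof -
          have "(of_nat p powr (- ?s)) ^ 2 = (of_nat p powr (- ?s - ?s) :: complex)"
            by (simp add: power2_eq_square powr_add[symmetric] algebra_simps)
          also have "- ?s - ?s = - ?s2 - of_real \<sigma>" by (simp add: complex_eq_iff)
          also have "of_nat p powr (- ?s2 - of_real \<sigma>) = (of_nat p powr (- ?s2) * of_nat p powr (- of_real \<sigma>) :: complex)"
            by (simp flip: powr_add)
          also have "of_nat p powr (- of_real \<sigma>) = (of_real r :: complex)"
            using c1 by (simp add: chi0_term_def sq)
          finally have "of_nat p powr (- ?s2) = (of_nat p powr (- ?s)) ^ 2 / (of_real r :: complex)" using r by simp
          moreover have "u ^ 2 = (of_nat p powr (- ?s)) ^ 2 / of_real r ^ 2"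
            using sq by (simp add: u_def psi_term_def power_divide power_mult_distrib flip: of_real_power)
          ultimately show ?thesis using r by (simp only: chi0_term_def sq) (simp add: power2_eq_square)
        qed
        have small: "norm (of_real r :: complex) < 1" "norm (of_real r * u) < 1" "norm (of_real r * u ^ 2) < 1"
          using r nu by (simp_all add: norm_mult norm_power)
        have nz: "norm (1 - x) > 0" if "norm x < 1" for x :: complex using that by auto
        define M where "M = (1 - r) ^ 3 * norm (1 - of_real r * u) ^ 4 * norm (1 - of_real r * u ^ 2)"
        have M1: "M \<le> 1" unfolding M_def using r nu by (intro mertens_factor_le_1) auto
        have M0: "M > 0" unfolding M_def using r nz[OF small(2)] nz[OF small(3)] by simp
        have "norm (1 - of_real r :: complex) = 1 - r"
          using r by (metis abs_of_pos diff_gt_0_iff_gt norm_of_real of_real_1 of_real_diff)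
        hence "norm (\<Sum>e. chi0_term (of_real \<sigma>) (p ^ e)) ^ 3 * norm (\<Sum>e. psi_term ?s (p ^ e)) ^ 4 *
            norm (\<Sum>e. chi0_term ?s2 (p ^ e)) = inverse M"
          unfolding chi0_pow psi_pow c1 c2 ps geo[OF small(1)] geo[OF small(2)] geo[OF small(3)] M_def
          by (simp add: power_inverse)
        thus ?thesis using M0 M1 by (simp add: one_le_inverse)
      qed
    qed
    finally show ?thesis .
  qed
  ultimately show ?thesis by (intro LIMSEQ_le_const) auto
qed


text \<open>\<open>of_real a powr (- s)\<close> is compared with the increment of the power with
  exponent \<open>1 - s\<close> over a step of length 6, the spacing of a progression modulo 6. The
  mean value inequality is applied twice.\<close>

lemma complex_powr_second_diff_bound:
  fixes s :: complex and a :: real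
  assumes "0 < a" "Re s \<ge> 0"
  shows "norm (of_real (a + 6) powr (1 - s) - of_real a powr (1 - s) - 6 * (1 - s) * of_real a powr (- s))
     \<le> 36 * norm (s - 1) * norm s * a powr (- Re s - 1)"
proof -
  let ?\<phi> = "\<lambda>z. z powr (1 - s) - (1 - s) * of_real a powr (- s) * z"
  let ?B = "norm (s - 1) * (norm s * 6 * a powr (- Re s - 1))"
  have "norm (?\<phi> (of_real (a + 6)) - ?\<phi> (of_real a)) \<le> ?B * norm (of_real (a + 6) - of_real a :: complex)"
  proof (rule field_differentiable_bound[of "closed_segment (of_real a) (of_real (a + 6))" _
      "\<lambda>z. (1 - s) * (z powr (- s) - of_real a powr (- s))"])
    fix z :: complex assume "z \<in> closed_segment (of_real a) (of_real (a + 6))"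
    then obtain t where t: "z = of_real t" "t \<in> closed_segment a (a + 6)"
      by (auto simp: closed_segment_of_real simp del: of_real_add)
    hence ta: "t \<ge> a" "t \<le> a + 6" by (auto simp: closed_segment_eq_real_ivl)
    have z: "z \<notin> \<real>\<^sub>\<le>\<^sub>0" using t ta assms by (auto simp: complex_nonpos_Reals_iff)
    have d1: "((\<lambda>z. z powr (1 - s)) has_field_derivative (1 - s) * z powr (1 - s - 1)) (at z)"
      using z by (rule has_field_derivative_powr)
    have "1 - s - 1 = - s" by simp
    hence "(?\<phi> has_field_derivative (1 - s) * z powr (- s) - (1 - s) * of_real a powr (- s) * 1) (at z)"
      using d1 by (intro DERIV_diff DERIV_cmult DERIV_ident) (simp only:)
    hence "(?\<phi> has_field_derivative (1 - s) * (z powr (- s) - of_real a powr (- s))) (at z)"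
      by (simp add: algebra_simps)
    thus "(?\<phi> has_field_derivative (1 - s) * (z powr (- s) - of_real a powr (- s)))
        (at z within closed_segment (of_real a) (of_real (a + 6)))"
      by (rule has_field_derivative_at_within)
    have "norm (z powr (- s) - of_real a powr (- s)) \<le> norm s * (t - a) * a powr (- Re s - 1)"
      unfolding t(1) using ta assms by (intro complex_powr_diff_bound) auto
    also have "\<dots> \<le> norm s * 6 * a powr (- Re s - 1)"
      using ta by (intro mult_right_mono mult_left_mono) auto
    finally show "norm ((1 - s) * (z powr (- s) - of_real a powr (- s))) \<le> ?B"
      unfolding norm_mult by (intro mult_mono) (auto simp: norm_minus_commute)
  qed auto
  moreover have eq: "?\<phi> (of_real (a + 6)) - ?\<phi> (of_real a) =
      of_real (a + 6) powr (1 - s) - of_real a powr (1 - s) - 6 * (1 - s) * of_real a powr (- s)"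
    by (simp add: algebra_simps)
  moreover have n6: "norm (of_real (a + 6) - of_real a :: complex) = 6" by simp
  ultimately have "norm (of_real (a + 6) powr (1 - s) - of_real a powr (1 - s) - 6 * (1 - s) * of_real a powr (- s)) \<le> ?B * 6"
    by (simp only:)
  also have "?B * 6 = 36 * norm (s - 1) * norm s * a powr (- Re s - 1)" by simp
  finally show ?thesis .
qed

text \<open>The increments telescope, which evaluates \<open>6 * (1 - s)\<close> times the series up
  to an error of order \<open>norm (s - 1) * norm s\<close>. Dividing shows growth like a simple
  pole at 1 and a bound that is uniform up to the line \<open>Re s = 1\<close> away from 1.\<close>

lemma progression_sum_bound:
  fixes s :: complex and a :: real
  assumes "Re s > 1" "a \<ge> 1" and sm: "summable (\<lambda>k. of_real (6 * real k + a) powr (- s) :: complex)"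
  shows "norm (\<Sum>k. of_real (6 * real k + a) powr (- s) :: complex) \<le>
     1 / norm (s - 1) + 6 * norm s * (\<Sum>k. (6 * real k + 1) powr (- 2))"
proof -
  let ?T = "\<Sum>k. of_real (6 * real k + a) powr (- s) :: complex"
  define E where "E k = of_real (6 * real k + a + 6) powr (1 - s) - of_real (6 * real k + a) powr (1 - s)
     - 6 * (1 - s) * of_real (6 * real k + a) powr (- s)" for k
  have s1: "s \<noteq> 1" using assms by auto
  have sm2: "summable (\<lambda>k. (6 * real k + 1) powr (- 2))" using summable_6k1_powr[of 2] by simp
  have lim: "(\<lambda>k. of_real (6 * real k + a) powr (1 - s) :: complex) \<longlonglongrightarrow> 0"
  proof (rule tendsto_norm_zero_cancel)
    have "(\<lambda>k. (6 * real k + a) powr (1 - Re s)) \<longlonglongrightarrow> 0"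
    proof (rule tendsto_neg_powr)
      show "filterlim (\<lambda>k. 6 * real k + a) at_top sequentially"
        by (rule filterlim_at_top_mono[OF filterlim_real_sequentially]) (use assms in auto)
    qed (use assms in auto)
    moreover have "norm (of_real (6 * real k + a) powr (1 - s) :: complex) = (6 * real k + a) powr (1 - Re s)" for k
      using norm_powr_real_powr[of "of_real (6 * real k + a)" "1 - s"] assms by simp
    ultimately show "(\<lambda>k. norm (of_real (6 * real k + a) powr (1 - s) :: complex)) \<longlonglongrightarrow> 0" by simp
  qed
  have tele: "(\<lambda>k. of_real (6 * real k + a + 6) powr (1 - s) - of_real (6 * real k + a) powr (1 - s) :: complex)
     sums (0 - of_real a powr (1 - s))"
    using telescope_sums[OF lim] by (simp add: algebra_simps)
  have Es: "E sums (0 - of_real a powr (1 - s) - 6 * (1 - s) * ?T)"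
    unfolding E_def by (rule sums_diff[OF tele sums_mult[OF summable_sums[OF sm]]])
  have Eb: "norm (E k) \<le> 36 * norm (s - 1) * norm s * (6 * real k + 1) powr (- 2)" for k
  proof -
    have "norm (E k) \<le> 36 * norm (s - 1) * norm s * (6 * real k + a) powr (- Re s - 1)"
      unfolding E_def using assms by (intro complex_powr_second_diff_bound) auto
    also have "(6 * real k + a) powr (- Re s - 1) \<le> (6 * real k + a) powr (- 2)"
      using assms by (intro powr_mono) auto
    also have "\<dots> \<le> (6 * real k + 1) powr (- 2)" using assms by (intro powr_mono2') auto
    finally show ?thesis by (simp add: mult_left_mono)
  qed
  have "norm (\<Sum>k. E k) \<le> (\<Sum>k. 36 * norm (s - 1) * norm s * (6 * real k + 1) powr (- 2))"
    using Eb by (intro norm_suminf_le summable_mult sm2)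
  also have "\<dots> = 36 * norm (s - 1) * norm s * (\<Sum>k. (6 * real k + 1) powr (- 2))"
    by (rule suminf_mult[OF sm2])
  finally have "norm (- (of_real a powr (1 - s)) - 6 * (1 - s) * ?T) \<le> 36 * norm (s - 1) * norm s * (\<Sum>k. (6 * real k + 1) powr (- 2))"
    using sums_unique[OF Es] by simp
  moreover have "norm (6 * (1 - s) * ?T) \<le> norm (- (of_real a powr (1 - s)) - 6 * (1 - s) * ?T) + norm (of_real a powr (1 - s))"
  proof -
    have "norm y \<le> norm (- x - y) + norm x" for x y :: complex
      using norm_triangle_ineq[of "- x - y" x] by simp
    thus ?thesis .
  qed
  moreover have "norm (of_real a powr (1 - s) :: complex) \<le> 1"
    using norm_powr_real_powr[of "of_real a" "1 - s"] assms powr_mono[of "1 - Re s" 0 a] by simp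
  ultimately have le: "norm (6 * (1 - s) * ?T) \<le> 36 * norm (s - 1) * norm s * (\<Sum>k. (6 * real k + 1) powr (- 2)) + 1"
    by linarith
  have "6 * norm (s - 1) * norm ?T \<le> 6 * norm (s - 1) * (6 * norm s * (\<Sum>k. (6 * real k + 1) powr (- 2))) + 1"
  proof -
    have "norm (6 * (1 - s) * ?T) = 6 * norm (s - 1) * norm ?T"
      by (simp only: norm_mult norm_minus_commute[of 1 s]) simp
    moreover have "36 * norm (s - 1) * norm s * Z = 6 * norm (s - 1) * (6 * norm s * Z)" for Z by simp
    ultimately show ?thesis using le by linarith
  qed
  hence "norm ?T \<le> (6 * norm (s - 1) * (6 * norm s * (\<Sum>k. (6 * real k + 1) powr (- 2))) + 1) / (6 * norm (s - 1))"
    using s1 by (subst pos_le_divide_eq) (auto simp: mult_ac)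
  also have "\<dots> = 6 * norm s * (\<Sum>k. (6 * real k + 1) powr (- 2)) + 1 / (6 * norm (s - 1))"
    using s1 by (simp add: add_divide_distrib)
  also have "1 / (6 * norm (s - 1)) \<le> 1 / norm (s - 1)" using s1 by (intro divide_left_mono) auto
  finally show ?thesis by simp
qed

lemma zeta6_bound:
  obtains B where "B \<ge> 0" "\<And>s. Re s > 1 \<Longrightarrow> norm (zeta6 s) \<le> 2 / norm (s - 1) + B * norm s"
proof
  let ?Z = "\<Sum>k. (6 * real k + 1) powr (- 2)"
  show "12 * ?Z \<ge> 0" using summable_6k1_powr[of 2] by (simp add: suminf_nonneg)
  fix s :: complex assume s: "Re s > 1"
  have sm: "summable (\<lambda>k. of_real (6 * real k + a) powr (- s) :: complex)" if "a \<ge> 1" for a :: real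
  proof (rule summable_comparison_test')
    show "summable (\<lambda>k. (6 * real k + 1) powr (- Re s))" using s by (rule summable_6k1_powr)
    show "norm (of_real (6 * real k + a) powr (- s) :: complex) \<le> (6 * real k + 1) powr (- Re s)" if "k \<ge> 0" for k
      using norm_powr_real_powr[of "of_real (6 * real k + a)" "- s"] \<open>a \<ge> 1\<close> s by (simp add: powr_mono2')
  qed
  have "chi0_term s sums zeta6 s"
    unfolding zeta6_def by (rule summable_sums[OF summable_norm_cancel[OF summable_chi0_term[OF s]]])
  from sums_group[OF this, of 6]
  have "(\<lambda>k. of_real (6 * real k + 1) powr (- s) + of_real (6 * real k + 5) powr (- s)) sums zeta6 s"
    unfolding chi0_term_block by simp
  moreover have "(\<lambda>k. of_real (6 * real k + 1) powr (- s) + of_real (6 * real k + 5) powr (- s)) sums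
      ((\<Sum>k. of_real (6 * real k + 1) powr (- s)) + (\<Sum>k. of_real (6 * real k + 5) powr (- s) :: complex))"
    by (intro sums_add summable_sums sm) auto
  ultimately have "zeta6 s = (\<Sum>k. of_real (6 * real k + 1) powr (- s)) + (\<Sum>k. of_real (6 * real k + 5) powr (- s))"
    by (rule sums_unique2)
  thus "norm (zeta6 s) \<le> 2 / norm (s - 1) + 12 * ?Z * norm s"
    using norm_triangle_ineq[of "\<Sum>k. of_real (6 * real k + 1) powr (- s) :: complex" "\<Sum>k. of_real (6 * real k + 5) powr (- s)"]
      progression_sum_bound[OF s, of 1] progression_sum_bound[OF s, of 5] sm[of 1] sm[of 5]
    by (simp add: mult_ac)
qed

text \<open>If \<open>Lfun\<close> vanished at \<open>s\<close> with \<open>Re s = 1\<close> and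
  \<open>Im s = t \<noteq> 0\<close>, then in the 3-4-1 inequality at \<open>s + \<delta>\<close>
  the cube of \<open>zeta6\<close> would be of order at most \<open>1 / \<delta> ^ 3\<close>, the
  fourth power of \<open>Lfun\<close> of order at most \<open>\<delta> ^ 4\<close>, and the last
  factor bounded, so the product would tend to 0. For \<open>Re s > 1\<close> the inequality
  excludes a zero at once, and \<open>t = 0\<close> is \<open>Lfun_1_nonzero\<close>.\<close>

theorem Lfun_nonzero:
  assumes "Re s \<ge> 1"
  shows "Lfun s \<noteq> 0"
proof
  assume L0: "Lfun s = 0"
  define t where "t = Im s"
  have seq: "s = Complex (Re s) t" by (simp add: t_def)
  have "\<not> Re s > 1"
  proof
    assume "Re s > 1"
    from three_four_one[OF this, of t] show False using L0 by (simp add: seq[symmetric])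
  qed
  hence s1: "Re s = 1" using assms by simp
  have t0: "t \<noteq> 0"
  proof
    assume "t = 0"
    hence "s = 1" using s1 seq by (simp add: complex_eq_iff)
    thus False using L0 Lfun_1_nonzero by simp
  qed
  obtain B where B: "B \<ge> 0" "\<And>s. Re s > 1 \<Longrightarrow> norm (zeta6 s) \<le> 2 / norm (s - 1) + B * norm s"
    by (rule zeta6_bound) blast
  obtain D where D: "(Lfun has_field_derivative D) (at s)"
    using Lfun_sums_and_differentiable(2)[of s] s1 by (auto simp: field_differentiable_def)
  define K where "K = (2 + 2 * B) ^ 3 * (2 / (2 * \<bar>t\<bar>) + B * (2 + 2 * \<bar>t\<bar>))"
  have bound: "1 \<le> K * \<delta> * norm (Lfun (s + of_real \<delta>) / of_real \<delta>) ^ 4" if \<delta>: "0 < \<delta>" "\<delta> < 1" for \<delta> :: real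
  proof -
    have c: "Complex (1 + \<delta>) t = s + of_real \<delta>" using s1 by (simp add: complex_eq_iff t_def)
    have z1: "norm (zeta6 (of_real (1 + \<delta>))) \<le> (2 + 2 * B) / \<delta>"
    proof -
      have "norm (zeta6 (of_real (1 + \<delta>))) \<le> 2 / norm (of_real (1 + \<delta>) - 1 :: complex) + B * norm (of_real (1 + \<delta>) :: complex)"
        using \<delta> by (intro B(2)) auto
      also have "norm (of_real (1 + \<delta>) - 1 :: complex) = \<delta>" using \<delta> by simp
      also have "norm (of_real (1 + \<delta>) :: complex) = 1 + \<delta>" using \<delta> unfolding norm_of_real by simp
      also have "B * (1 + \<delta>) \<le> 2 * B / \<delta>"
      proof -
        have "B * ((1 + \<delta>) * \<delta>) \<le> B * (2 * 1)" using \<delta> B by (intro mult_left_mono mult_mono) auto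
        thus ?thesis using \<delta> by (simp add: pos_le_divide_eq mult_ac)
      qed
      finally show ?thesis by (simp add: add_divide_distrib)
    qed
    have z2: "norm (zeta6 (Complex (1 + \<delta>) (2 * t))) \<le> 2 / (2 * \<bar>t\<bar>) + B * (2 + 2 * \<bar>t\<bar>)"
    proof -
      let ?w = "Complex (1 + \<delta>) (2 * t)"
      have "norm (zeta6 ?w) \<le> 2 / norm (?w - 1) + B * norm ?w" using \<delta> by (intro B(2)) auto
      also have "2 / norm (?w - 1) \<le> 2 / (2 * \<bar>t\<bar>)"
      proof -
        have "2 * \<bar>t\<bar> \<le> norm (?w - 1)" using abs_Im_le_cmod[of "?w - 1"] by simp
        thus ?thesis using t0 by (intro divide_left_mono mult_pos_pos) auto
      qed
      also have "B * norm ?w \<le> B * (2 + 2 * \<bar>t\<bar>)"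
        using cmod_le[of ?w] \<delta> B by (intro mult_left_mono) auto
      finally show ?thesis by simp
    qed
    have "1 \<le> norm (zeta6 (of_real (1 + \<delta>))) ^ 3 * norm (Lfun (s + of_real \<delta>)) ^ 4 * norm (zeta6 (Complex (1 + \<delta>) (2 * t)))"
      using three_four_one[of "1 + \<delta>" t] \<delta> unfolding c by simp
    also have "\<dots> \<le> ((2 + 2 * B) / \<delta>) ^ 3 * norm (Lfun (s + of_real \<delta>)) ^ 4 * (2 / (2 * \<bar>t\<bar>) + B * (2 + 2 * \<bar>t\<bar>))"
      using z1 z2 \<delta> B by (intro mult_mono power_mono mult_nonneg_nonneg) auto
    also have "\<dots> = K * \<delta> * norm (Lfun (s + of_real \<delta>) / of_real \<delta>) ^ 4"
      using \<delta> by (simp add: K_def norm_divide power_divide field_simps power3_eq_cube power4_eq_xxxx)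
    finally show ?thesis .
  qed
  have "((\<lambda>\<delta>. Lfun (s + of_real \<delta>) / of_real \<delta>) \<longlongrightarrow> D) (at_right 0)"
  proof -
    have "((\<lambda>h. (Lfun (s + h) - Lfun s) / h) \<longlongrightarrow> D) (at 0)" using D by (simp add: DERIV_def)
    moreover have "filterlim (\<lambda>\<delta>. of_real \<delta> :: complex) (at 0) (at_right 0)"
      unfolding filterlim_at by (auto intro!: tendsto_eq_intros simp: eventually_at_filter)
    ultimately show ?thesis using L0 by (auto dest: filterlim_compose)
  qed
  hence "((\<lambda>\<delta>. K * \<delta> * norm (Lfun (s + of_real \<delta>) / of_real \<delta>) ^ 4) \<longlongrightarrow> K * 0 * norm D ^ 4) (at_right 0)"
    by (intro tendsto_intros)
  moreover have "\<forall>\<^sub>F \<delta> in at_right 0. 1 \<le> K * \<delta> * norm (Lfun (s + of_real \<delta>) / of_real \<delta>) ^ 4"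
    unfolding eventually_at_right_field using bound by (intro exI[of _ 1]) auto
  ultimately have "1 \<le> K * 0 * norm D ^ 4" by (rule tendsto_lowerbound) simp
  thus False by simp
qed

section \<open>Newman's Tauberian theorem\<close>

lemma powr_mvt:
  fixes a b c :: real
  assumes "0 < a" "a < b"
  shows "\<exists>\<xi>>a. \<xi> < b \<and> b powr c - a powr c = (b - a) * (c * \<xi> powr (c - 1))"
  using assms by (intro MVT2) (auto intro!: has_real_derivative_powr)

lemma sum_powr_tail_le:
  fixes y :: real and N :: nat
  assumes "y > 0" "N \<ge> 1"
  shows "summable (\<lambda>n. real (n + N + 1) powr (- 1 - y))"
    and "(\<Sum>n. real (n + N + 1) powr (- 1 - y)) \<le> real N powr (- y) / y"
proof -
  have lim: "(\<lambda>n. real (n + N) powr (- y)) \<longlonglongrightarrow> 0"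
  proof (rule tendsto_neg_powr)
    show "filterlim (\<lambda>n. real (n + N)) at_top sequentially"
      by (rule filterlim_at_top_mono[OF filterlim_real_sequentially]) auto
  qed (use assms in auto)
  have "(\<lambda>n. real (n + N) powr (- y) - real (Suc n + N) powr (- y)) sums (real (0 + N) powr (- y) - 0)"
    using telescope_sums'[OF lim] by simp
  hence t: "(\<lambda>n. (real (n + N) powr (- y) - real (n + N + 1) powr (- y)) / y) sums (real N powr (- y) / y)"
    using sums_divide[of _ "real N powr (- y)" y] by (simp add: add_ac)
  have le: "real (n + N + 1) powr (- 1 - y) \<le> (real (n + N) powr (- y) - real (n + N + 1) powr (- y)) / y" for n
  proof -
    obtain \<xi> where \<xi>: "real (n + N) < \<xi>" "\<xi> < real (n + N + 1)"
      "real (n + N + 1) powr (- y) - real (n + N) powr (- y) = (real (n + N + 1) - real (n + N)) * (- y * \<xi> powr (- y - 1))"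
      using powr_mvt[of "real (n + N)" "real (n + N + 1)" "- y"] assms by auto
    have "real (n + N + 1) powr (- y - 1) \<le> \<xi> powr (- y - 1)"
      using \<xi> assms by (intro powr_mono2') auto
    hence "y * real (n + N + 1) powr (- y - 1) \<le> y * \<xi> powr (- y - 1)" using assms by (intro mult_left_mono) auto
    also have "\<dots> = real (n + N) powr (- y) - real (n + N + 1) powr (- y)" using \<xi>(3) by simp
    also have "- y - 1 = - 1 - y" by simp
    finally show ?thesis using assms by (simp add: pos_le_divide_eq mult.commute)
  qed
  show sm: "summable (\<lambda>n. real (n + N + 1) powr (- 1 - y))"
    using le by (intro summable_comparison_test'[OF sums_summable[OF t], of 0]) auto
  show "(\<Sum>n. real (n + N + 1) powr (- 1 - y)) \<le> real N powr (- y) / y"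
    using sums_le[OF le summable_sums[OF sm] t] .
qed

text \<open>The power with exponent \<open>y - 1\<close> changes its monotonicity at
  \<open>y = 1\<close>. For \<open>y \<le> 1\<close> each term is compared with the unit step to its
  left, otherwise with the one to its right, and then the last term is left over.\<close>

lemma sum_powr_head_le:
  fixes y :: real and N :: nat
  assumes "y > 0" "N \<ge> 1"
  shows "(\<Sum>n=1..N. real n powr (y - 1)) \<le> real N powr y / y + real N powr (y - 1)"
proof (cases "y \<le> 1")
  case True
  have le: "real n powr (y - 1) \<le> (real n powr y - real (n - 1) powr y) / y" if "n \<ge> 1" for n
  proof (cases "n = 1")
    case False
    hence n: "n \<ge> 2" using that by simp
    then obtain \<xi> where \<xi>: "real (n - 1) < \<xi>" "\<xi> < real n" "real n powr y - real (n - 1) powr y = (real n - real (n - 1)) * (y * \<xi> powr (y - 1))"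
      using powr_mvt[of "real (n - 1)" "real n" y] by auto
    have "real n powr (y - 1) \<le> \<xi> powr (y - 1)" using \<xi> True n by (intro powr_mono2') auto
    moreover have "real n powr y - real (n - 1) powr y = y * \<xi> powr (y - 1)" using \<xi>(3) n by (simp add: of_nat_diff)
    ultimately show ?thesis using assms by simp
  qed (use True assms in simp)
  have "(\<Sum>n=1..N. real n powr (y - 1)) \<le> (\<Sum>n=1..N. (real n powr y - real (n - 1) powr y) / y)"
    using le by (intro sum_mono) auto
  also have "\<dots> = real N powr y / y"
    using assms(2)
  proof (induction N rule: dec_induct)
    case (step N)
    thus ?case by (simp add: diff_divide_distrib)
  qed simp
  finally show ?thesis by (simp add: add_increasing2)
next
  case False
  have le: "real n powr (y - 1) \<le> (real (Suc n) powr y - real n powr y) / y" if n1: "n \<ge> 1" for n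
  proof -
    obtain \<xi> where \<xi>: "real n < \<xi>" "\<xi> < real (Suc n)" "real (Suc n) powr y - real n powr y = (real (Suc n) - real n) * (y * \<xi> powr (y - 1))"
      using powr_mvt[of "real n" "real (Suc n)" y] n1 by auto
    have "real n powr (y - 1) \<le> \<xi> powr (y - 1)" using \<xi> False by (intro powr_mono2) auto
    thus ?thesis using \<xi>(3) assms by simp
  qed
  have "(\<Sum>n=1..N. real n powr (y - 1)) = (\<Sum>n\<in>{1..<N}. real n powr (y - 1)) + real N powr (y - 1)"
    using assms(2) by (simp add: sum.last_plus add.commute)
  also have "(\<Sum>n\<in>{1..<N}. real n powr (y - 1)) \<le> (\<Sum>n\<in>{1..<N}. (real (Suc n) powr y - real n powr y) / y)"
    using le by (intro sum_mono) auto
  also have "\<dots> = (real N powr y - real 1 powr y) / y"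
    using sum_Suc_diff'[of 1 N "\<lambda>n. real n powr y"] assms(2) by (simp flip: sum_divide_distrib)
  also have "\<dots> \<le> real N powr y / y" using assms(1) by (intro divide_right_mono) auto
  finally show ?thesis by simp
qed

lemma contour_integral_circle_halves:
  fixes f g :: "complex \<Rightarrow> complex"
  assumes "(f has_contour_integral I1) (part_circlepath 0 R 0 pi)"
    and "(f has_contour_integral I2) (part_circlepath 0 R pi (2 * pi))"
    and "(f has_contour_integral I) (circlepath 0 R)"
  shows "I = I1 + I2"
proof -
  have "((\<lambda>t. f (0 + R * cis t) * R * \<i> * cis t) has_integral I1 + I2) {0..2 * pi}"
    using assms(1,2) by (intro has_integral_combine[of 0 pi "2 * pi"])
      (auto simp: has_contour_integral_part_circlepath_iff)
  moreover have "((\<lambda>t. f (0 + R * cis t) * R * \<i> * cis t) has_integral I) {0..2 * pi}"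
    using assms(3) by (simp add: circlepath_def has_contour_integral_part_circlepath_iff)
  ultimately show ?thesis by (rule has_integral_unique[symmetric])
qed

text \<open>The Dirichlet series at \<open>1 + z\<close> extends past the line
  \<open>Re z = 0\<close>. The normalisation \<open>G 0 = 0\<close> makes 0 the expected limit of
  the partial sums at \<open>z = 0\<close> and removes the pole of \<open>G z / z\<close>.\<close>

locale newman =
  fixes a :: "nat \<Rightarrow> complex" and C :: real and U :: "complex set" and G :: "complex \<Rightarrow> complex"
  assumes C: "C > 0" "\<And>n. norm (a n) \<le> C"
    and U: "open U" "{z. Re z \<ge> 0} \<subseteq> U" and G: "G holomorphic_on U" "G 0 = 0"
    and ser: "\<And>z. Re z > 0 \<Longrightarrow> (\<lambda>n. a n * of_nat n powr (- (1 + z))) sums G z"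
begin

text \<open>The contour argument takes place in the coordinate \<open>w = \<i> z\<close>, so that the arcs on which
  the series converges and diverges are the upper and the lower half of a circle, in the
  standard parametrisation.\<close>

definition H :: "complex \<Rightarrow> complex" where "H w = G (- \<i> * w)"

definition S :: "nat \<Rightarrow> complex \<Rightarrow> complex" where
  "S N w = (\<Sum>n=1..N. a n * of_nat n powr (- (1 - \<i> * w)))"

text \<open>Newman's kernel \<open>N powr z * (1 + z ^ 2 / R ^ 2)\<close>, written in
  \<open>w\<close>, for which \<open>z ^ 2 = - (w ^ 2)\<close>.\<close>

definition K :: "real \<Rightarrow> nat \<Rightarrow> complex \<Rightarrow> complex" where
  "K R N w = of_nat N powr (- \<i> * w) * (1 - w ^ 2 / of_real R ^ 2)"

text \<open>On the circle \<open>w * cnj w = R ^ 2\<close>, so the second factor of the kernel is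
  proportional to \<open>Im w\<close>. This zero compensates the reciprocal of
  \<open>\<bar>Im w\<bar>\<close> in the bounds for the sums.\<close>

lemma norm_kernel:
  assumes "N \<ge> 1" "norm w = R" "R > 0"
  shows "norm (K R N w / w) = real N powr Im w * (2 * \<bar>Im w\<bar> / R ^ 2)"
proof -
  have w0: "w \<noteq> 0" using assms by auto
  have "w * cnj w = of_real R ^ 2" using complex_norm_square[of w] assms by simp
  hence "1 - w ^ 2 / of_real R ^ 2 = (cnj w - w) * w / of_real R ^ 2"
    using assms by (simp add: field_simps power2_eq_square)
  hence "K R N w / w = of_nat N powr (- \<i> * w) * ((cnj w - w) / of_real R ^ 2)"
    using w0 by (simp add: K_def)
  moreover have "norm (cnj w - w) = 2 * \<bar>Im w\<bar>"
  proof -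
    have "cnj w - w = - 2 * \<i> * of_real (Im w)" by (simp add: complex_eq_iff)
    thus ?thesis by (simp add: norm_mult)
  qed
  ultimately show ?thesis using assms
    by (simp add: norm_mult norm_divide norm_power norm_nat_powr)
qed

text \<open>\<open>H w - S N w\<close> is the tail of the series, at most
  \<open>C * N powr (- y) / y\<close> with \<open>y = Im w\<close>. The kernel contributes
  \<open>N powr y * (2 * y / R ^ 2)\<close>, and all dependence on \<open>N\<close> and
  \<open>y\<close> cancels.\<close>

lemma bound_upper:
  assumes "N \<ge> 1" "norm w = R" "R > 0" "Im w > 0"
  shows "norm ((H w - S N w) * K R N w / w) \<le> 2 * C / R ^ 2"
proof -
  let ?y = "Im w"
  have z: "Re (- \<i> * w) > 0" using assms by simp
  have "(\<lambda>n. a n * of_nat n powr (- (1 + (- \<i> * w)))) sums H w"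
    unfolding H_def by (rule ser[OF z])
  from sums_split_initial_segment[OF this, of "N + 1"]
  have "(\<lambda>n. a (n + (N + 1)) * of_nat (n + (N + 1)) powr (- (1 + (- \<i> * w)))) sums
     (H w - (\<Sum>n<N + 1. a n * of_nat n powr (- (1 + (- \<i> * w)))))" .
  moreover have "(\<Sum>n<N + 1. a n * of_nat n powr (- (1 + (- \<i> * w)))) = S N w"
  proof -
    have "{..<N + 1} = insert 0 {1..N}" by auto
    thus ?thesis by (simp add: S_def)
  qed
  ultimately have t: "(\<lambda>n. a (n + (N + 1)) * of_nat (n + (N + 1)) powr (- (1 + (- \<i> * w)))) sums (H w - S N w)" by simp
  have le: "norm (a (n + (N + 1)) * of_nat (n + (N + 1)) powr (- (1 + (- \<i> * w)))) \<le> C * real (n + N + 1) powr (- 1 - ?y)" for n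
  proof -
    have "norm (of_nat (n + (N + 1)) powr (- (1 + (- \<i> * w))) :: complex) = real (n + N + 1) powr (- 1 - ?y)"
    proof -
      have "Re (- (1 + (- \<i> * w))) = - 1 - ?y" by simp
      thus ?thesis by (subst norm_nat_powr) (simp_all only: add_gr_0 zero_less_one add.assoc disj_not1 simp_thms)
    qed
    thus ?thesis unfolding norm_mult using C by (simp add: mult_right_mono)
  qed
  note tail = sum_powr_tail_le[OF assms(4,1)]
  have "norm (H w - S N w) \<le> (\<Sum>n. C * real (n + N + 1) powr (- 1 - ?y))"
    using norm_suminf_le[OF le summable_mult[OF tail(1)]] sums_unique[OF t] by simp
  also have "\<dots> = C * (\<Sum>n. real (n + N + 1) powr (- 1 - ?y))" by (rule suminf_mult[OF tail(1)])
  also have "\<dots> \<le> C * (real N powr (- ?y) / ?y)" using tail(2) C by (intro mult_left_mono) auto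
  finally have "norm (H w - S N w) * norm (K R N w / w) \<le> C * (real N powr (- ?y) / ?y) * (real N powr ?y * (2 * ?y / R ^ 2))"
    unfolding norm_kernel[OF assms(1-3)] using assms C(1) by (intro mult_mono) auto
  also have "\<dots> = 2 * C / R ^ 2" using assms by (simp add: powr_minus field_simps)
  finally show ?thesis by (simp add: norm_mult norm_divide)
qed

text \<open>\<open>S N\<close> is entire, so it can be estimated on the lower half of the circle
  itself, outside the domain of \<open>H\<close>. The second summand comes from the boundary term of
  \<open>sum_powr_head_le\<close>.\<close>

lemma bound_lower:
  assumes "N \<ge> 1" "norm w = R" "R > 0" "Im w < 0"
  shows "norm (S N w * K R N w / w) \<le> 2 * C / R ^ 2 + 2 * C / (R * real N)"
proof -
  define y where "y = - Im w"
  have y: "y > 0" "y \<le> R" using assms abs_Im_le_cmod[of w] by (auto simp: y_def)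
  have "norm (S N w) \<le> (\<Sum>n=1..N. C * real n powr (y - 1))"
    unfolding S_def
  proof (rule sum_norm_le)
    fix n assume "n \<in> {1..N}"
    hence "norm (of_nat n powr (- (1 - \<i> * w)) :: complex) = real n powr (y - 1)"
      by (subst norm_nat_powr) (auto simp: y_def)
    thus "norm (a n * of_nat n powr (- (1 - \<i> * w))) \<le> C * real n powr (y - 1)"
      unfolding norm_mult using C by (simp add: mult_right_mono)
  qed
  also have "\<dots> = C * (\<Sum>n=1..N. real n powr (y - 1))" by (simp add: sum_distrib_left)
  also have "\<dots> \<le> C * (real N powr y / y + real N powr (y - 1))"
    using sum_powr_head_le[OF y(1) assms(1)] C by (intro mult_left_mono) auto
  finally have S: "norm (S N w) \<le> C * (real N powr y / y + real N powr (y - 1))" .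
  have "norm (S N w) * norm (K R N w / w) \<le> C * (real N powr y / y + real N powr (y - 1)) * (real N powr (- y) * (2 * y / R ^ 2))"
  proof -
    have ay: "Im w = - y" "\<bar>- y\<bar> = y" using y by (auto simp: y_def)
    show ?thesis unfolding norm_kernel[OF assms(1-3)] ay using S y C
      by (intro mult_mono mult_nonneg_nonneg add_nonneg_nonneg divide_nonneg_nonneg) auto
  qed
  also have "\<dots> = 2 * C / R ^ 2 + 2 * C * y / (R ^ 2 * real N)"
  proof -
    have "real N powr (y - 1) = real N powr y / real N" using assms by (simp add: powr_diff)
    thus ?thesis using y assms by (simp add: powr_minus field_simps)
  qed
  also have "2 * C * y / (R ^ 2 * real N) \<le> 2 * C * R / (R ^ 2 * real N)"
    using y C by (intro divide_right_mono mult_left_mono) auto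
  also have "\<dots> = 2 * C / (R * real N)" using assms by (simp add: power2_eq_square)
  finally show ?thesis by (simp add: norm_mult norm_divide)
qed

text \<open>Compactness of the real segment yields a strip of some depth below it inside the domain
  of \<open>H\<close>; points with \<open>Im w \<ge> 0\<close> belong to the domain by
  hypothesis.\<close>

lemma strip:
  assumes "R > 0"
  obtains e where "e > 0" "ball 0 (R + e) \<inter> {w. Im w > - e} \<subseteq> {w. - \<i> * w \<in> U}"
proof -
  let ?U = "{w. - \<i> * w \<in> U}"
  have op: "open ?U" 
  proof -
    have "open ((\<lambda>w. - \<i> * w) -` U)" by (intro open_vimage U continuous_intros)
    thus ?thesis by (simp add: vimage_def)
  qed
  have cp: "compact (closed_segment (- of_real R) (of_real R) :: complex set)" by (rule compact_segment)
  have seg: "x \<in> closed_segment (- of_real R) (of_real R) \<longleftrightarrow> Im x = 0 \<and> \<bar>Re x\<bar> \<le> R" for x :: complex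
  proof -
    have "closed_segment (- of_real R) (of_real R :: complex) = of_real ` {- R..R}"
      using closed_segment_of_real[of "- R" R] assms by (simp add: closed_segment_eq_real_ivl)
    thus ?thesis by (auto simp: image_iff complex_eq_iff intro!: bexI[of _ "Re x"])
  qed
  have sub: "closed_segment (- of_real R) (of_real R) \<subseteq> ?U"
    using U(2) by (auto simp: seg)
  obtain e where e: "e > 0" "(\<Union>x\<in>closed_segment (- of_real R) (of_real R). ball x e) \<subseteq> ?U"
    using compact_subset_open_imp_ball_epsilon_subset[OF cp op sub] by blast
  have "ball 0 (R + e / 2) \<inter> {w. Im w > - (e / 2)} \<subseteq> ?U"
  proof
    fix w assume w: "w \<in> ball 0 (R + e / 2) \<inter> {w. Im w > - (e / 2)}"
    show "w \<in> ?U"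
    proof (cases "Im w \<ge> 0")
      case True
      hence "Re (- \<i> * w) \<ge> 0" by simp
      thus ?thesis using U(2) by blast
    next
      case False
      \<comment> \<open>The point of the segment nearest to \<open>Re w\<close>. Halving
        \<open>e\<close> leaves room for both the horizontal and the vertical distance.\<close>
      define x where "x = max (- R) (min R (Re w))"
      have "\<bar>Re w\<bar> < R + e / 2" using w abs_Re_le_cmod[of w] by auto
      hence "\<bar>Re w - x\<bar> < e / 2" "\<bar>x\<bar> \<le> R" using assms e(1) by (auto simp: x_def max_def min_def abs_if split: if_splits)
      moreover have "\<bar>Im w\<bar> < e / 2" using False w by auto
      ultimately have "dist (of_real x) w < e"
        using cmod_le[of "w - of_real x"] by (simp add: dist_norm norm_minus_commute)
      moreover have "of_real x \<in> closed_segment (- of_real R) (of_real R :: complex)"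
        using \<open>\<bar>x\<bar> \<le> R\<close> by (simp add: seg)
      ultimately have "w \<in> (\<Union>x\<in>closed_segment (- of_real R) (of_real R). ball x e)" by (intro UN_I) auto
      thus ?thesis using e(2) by blast
    qed
  qed
  thus ?thesis using that[of "e / 2"] e(1) by simp
qed

lemma H_holomorphic: "H holomorphic_on {w. - \<i> * w \<in> U}"
proof -
  have "(G \<circ> (\<lambda>w. - \<i> * w)) holomorphic_on {w. - \<i> * w \<in> U}"
    by (intro holomorphic_on_compose_gen[OF _ G(1)] holomorphic_intros) auto
  moreover have "G \<circ> (\<lambda>w. - \<i> * w) = H" by (simp add: H_def fun_eq_iff)
  ultimately show ?thesis by simp
qed

lemma K_holomorphic: "N \<ge> 1 \<Longrightarrow> R > 0 \<Longrightarrow> K R N holomorphic_on A"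
  unfolding K_def by (intro holomorphic_intros) auto

lemma S_holomorphic: "S N holomorphic_on A"
  unfolding S_def by (intro holomorphic_intros) auto

text \<open>The kernel vanishes at both ends of the segment, so at depth \<open>y\<close> it is of
  order \<open>y * N powr (- y)\<close>, and this is at most \<open>1 / ln N\<close> uniformly in
  \<open>y\<close>.\<close>

lemma norm_K_side_le:
  assumes "N \<ge> 2" "R > 0" "\<bar>Re w\<bar> = R" "- \<delta> \<le> Im w" "Im w \<le> 0"
  shows "norm (K R N w) \<le> (2 * R + \<delta>) / (R ^ 2 * ln (real N))"
proof -
  define y where "y = - Im w"
  have y: "0 \<le> y" "y \<le> \<delta>" using assms by (auto simp: y_def)
  have L: "ln (real N) > 0" using assms by simp
  define r where "r = Re w"
  have r2: "r ^ 2 = R ^ 2" using assms(3) by (metis power2_abs r_def)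
  have w: "w = of_real r - \<i> * of_real y" by (simp add: complex_eq_iff r_def y_def)
  have "of_real r ^ 2 - w ^ 2 = \<i> * of_real y * (2 * of_real r - \<i> * of_real y)"
    unfolding w by (simp add: power2_eq_square algebra_simps)
  hence "norm (of_real R ^ 2 - w ^ 2) = y * norm (2 * of_real r - \<i> * of_real y)"
    using y r2 by (simp add: norm_mult flip: of_real_power)
  also have "norm (2 * of_real r - \<i> * of_real y) \<le> 2 * R + \<delta>"
    using norm_triangle_ineq4[of "2 * of_real r" "\<i> * of_real y"] y assms(3) by (simp add: norm_mult r_def)
  finally have n1: "norm (of_real R ^ 2 - w ^ 2) \<le> y * (2 * R + \<delta>)" using y by (simp add: mult_left_mono)
  have "1 - w ^ 2 / of_real R ^ 2 = (of_real R ^ 2 - w ^ 2) / of_real R ^ 2" using assms by (simp add: diff_divide_distrib)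
  hence n2: "norm (1 - w ^ 2 / of_real R ^ 2) \<le> y * (2 * R + \<delta>) / R ^ 2"
    using n1 by (simp add: norm_divide norm_power divide_right_mono)
  have "y * real N powr (- y) \<le> 1 / ln (real N)"
  proof -
    have "y * ln (real N) \<le> exp (y * ln (real N))" using exp_ge_add_one_self[of "y * ln (real N)"] by linarith
    hence "y * ln (real N) * exp (- (y * ln (real N))) \<le> exp (y * ln (real N)) * exp (- (y * ln (real N)))"
      by (intro mult_right_mono) auto
    also have "\<dots> = 1" by (simp flip: exp_add)
    finally show ?thesis using L assms by (simp add: powr_def pos_le_divide_eq mult_ac)
  qed
  hence n3: "(y * real N powr (- y)) * ((2 * R + \<delta>) / R ^ 2) \<le> 1 / ln (real N) * ((2 * R + \<delta>) / R ^ 2)"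
    using assms y by (intro mult_right_mono divide_nonneg_nonneg) auto
  have "norm (K R N w) = real N powr (- y) * norm (1 - w ^ 2 / of_real R ^ 2)"
    unfolding K_def norm_mult using assms by (subst norm_nat_powr) (auto simp: y_def)
  also have "\<dots> \<le> real N powr (- y) * (y * (2 * R + \<delta>) / R ^ 2)" using n2 by (intro mult_left_mono) auto
  also have "\<dots> = (y * real N powr (- y)) * ((2 * R + \<delta>) / R ^ 2)" by simp
  also note n3
  finally show ?thesis by (simp add: mult.commute)
qed

lemma norm_K_bottom_le:
  assumes "N \<ge> 1" "R > 0" "\<bar>Re w\<bar> \<le> R" "Im w = - \<delta>" "\<delta> \<ge> 0"
  shows "norm (K R N w) \<le> real N powr (- \<delta>) * (1 + (R + \<delta>) ^ 2 / R ^ 2)"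
proof -
  have "norm w \<le> R + \<delta>" using cmod_le[of w] assms by simp
  hence "norm w ^ 2 \<le> (R + \<delta>) ^ 2" by (intro power_mono) auto
  hence "norm (1 - w ^ 2 / of_real R ^ 2) \<le> 1 + (R + \<delta>) ^ 2 / R ^ 2"
    using norm_triangle_ineq4[of 1 "w ^ 2 / of_real R ^ 2"] divide_right_mono[of "norm w ^ 2" "(R + \<delta>) ^ 2" "R ^ 2"]
    by (simp add: norm_divide norm_power)
  moreover have "norm (of_nat N powr (- \<i> * w) :: complex) = real N powr (- \<delta>)"
    using assms by (subst norm_nat_powr) auto
  ultimately show ?thesis unfolding K_def norm_mult by (simp add: mult_left_mono)
qed

text \<open>The integral of \<open>H w / w * K R N w\<close> over the upper arc is moved to three
  segments just below the real axis, where it tends to 0 with \<open>N\<close>. The integral of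
  \<open>S N w * K R N w / w\<close> over the whole circle gives \<open>S N 0\<close> by Cauchy's
  formula. There remain \<open>H - S N\<close> on the upper arc and \<open>S N\<close> on the lower
  one, which after division by \<open>2 * pi\<close> contribute
  \<open>2 * C / R + C / N\<close>.\<close>

lemma main_estimate:
  assumes "R > 0"
  obtains \<beta> where "\<beta> \<longlonglongrightarrow> 0" "\<And>N. N \<ge> 2 \<Longrightarrow> norm (S N 0) \<le> 2 * C / R + C / real N + \<beta> N"
proof -
  obtain e where e: "e > 0" "ball 0 (R + e) \<inter> {w. Im w > - e} \<subseteq> {w. - \<i> * w \<in> U}" using strip[OF assms] by blast
  define V where "V = ball 0 (R + e) \<inter> {w. Im w > - e}"
  have opV: "open V" unfolding V_def by (intro open_Int open_ball open_halfspace_Im_gt)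
  have cvV: "convex V" unfolding V_def by (intro convex_Int convex_ball convex_halfspace_Im_gt)
  define \<delta> where "\<delta> = e / 2"
  have \<delta>: "\<delta> > 0" using e by (simp add: \<delta>_def)
  have H0: "H 0 = 0" using G(2) by (simp add: H_def)
  have HV: "H holomorphic_on V" using H_holomorphic e(2) unfolding V_def by (rule holomorphic_on_subset)
  \<comment> \<open>The singularity of \<open>H w / w\<close> at 0 is removable because
    \<open>H 0 = 0\<close>.\<close>
  define q where "q w = (if w = 0 then deriv H 0 else (H w - H 0) / (w - 0))" for w
  have "0 \<in> V" using e assms by (simp add: V_def)
  hence "0 \<in> interior V" using opV by (simp add: interior_open)
  hence q: "q holomorphic_on V" using pole_lemma[OF HV, of 0] unfolding q_def[abs_def] by blast
  have qw: "q w = H w / w" if "w \<noteq> 0" for w using that H0 by (simp add: q_def)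
  define b1 b2 where "b1 = Complex (- R) (- \<delta>)" and "b2 = Complex R (- \<delta>)"
  define Z where "Z = closed_segment (- of_real R) b1 \<union> (closed_segment b1 b2 \<union> closed_segment b2 (of_real R))"
  have seg1: "\<bar>Re w\<bar> = R \<and> - \<delta> \<le> Im w \<and> Im w \<le> 0" if "w \<in> closed_segment (- of_real R) b1" for w
  proof -
    from that obtain u where u: "0 \<le> u" "u \<le> 1" "w = (1 - u) *\<^sub>R (- of_real R) + u *\<^sub>R b1" by (auto simp: closed_segment_def)
    have "Re w = - R" by (subst u(3)) (simp add: b1_def algebra_simps)
    moreover have "Im w = - (u * \<delta>)" by (subst u(3)) (simp add: b1_def)
    moreover have "0 \<le> u * \<delta>" "u * \<delta> \<le> 1 * \<delta>" using u \<delta> by (auto intro: mult_right_mono)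
    ultimately show ?thesis using assms by simp
  qed
  have seg3: "\<bar>Re w\<bar> = R \<and> - \<delta> \<le> Im w \<and> Im w \<le> 0" if "w \<in> closed_segment b2 (of_real R)" for w
  proof -
    from that obtain u where u: "0 \<le> u" "u \<le> 1" "w = (1 - u) *\<^sub>R b2 + u *\<^sub>R of_real R" by (auto simp: closed_segment_def)
    have "Re w = R" by (subst u(3)) (simp add: b2_def algebra_simps)
    moreover have "Im w = - ((1 - u) * \<delta>)" by (subst u(3)) (simp add: b2_def)
    moreover have "0 \<le> (1 - u) * \<delta>" "(1 - u) * \<delta> \<le> 1 * \<delta>" using u \<delta> by (auto intro: mult_right_mono)
    ultimately show ?thesis using assms by simp
  qed
  have seg2: "\<bar>Re w\<bar> \<le> R \<and> Im w = - \<delta>" if "w \<in> closed_segment b1 b2" for w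
  proof -
    from that obtain u where u: "0 \<le> u" "u \<le> 1" "w = (1 - u) *\<^sub>R b1 + u *\<^sub>R b2" by (auto simp: closed_segment_def)
    have "Re w = (2 * u - 1) * R" "Im w = - \<delta>" by (subst u(3), simp add: b1_def b2_def algebra_simps)+
    moreover have "\<bar>(2 * u - 1) * R\<bar> \<le> 1 * R" unfolding abs_mult using u assms by (intro mult_mono) auto
    ultimately show ?thesis by simp
  qed
  have ZV: "Z \<subseteq> V"
  proof
    fix w assume "w \<in> Z"
    hence w: "\<bar>Re w\<bar> \<le> R" "- \<delta> \<le> Im w" "Im w \<le> 0" using seg1 seg2 seg3 \<delta> by (force simp: Z_def)+
    have "norm w \<le> R + \<delta>" using cmod_le[of w] w by simp
    thus "w \<in> V" using w e by (auto simp: V_def \<delta>_def)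
  qed
  have "compact (q ` Z)" unfolding Z_def
    using q ZV unfolding Z_def
    by (intro compact_continuous_image compact_Un compact_segment) (meson continuous_on_subset holomorphic_on_imp_continuous_on)
  \<comment> \<open>\<open>M\<close> is independent of \<open>N\<close>; the decay comes from the
    kernel alone.\<close>
  then obtain M where M: "M > 0" "\<And>w. w \<in> Z \<Longrightarrow> norm (q w) \<le> M"
    using compact_imp_bounded bounded_pos by (metis imageI)
  define B1 where "B1 N = M * ((2 * R + \<delta>) / (R ^ 2 * ln (real N)))" for N :: nat
  define B2 where "B2 N = M * (real N powr (- \<delta>) * (1 + (R + \<delta>) ^ 2 / R ^ 2))" for N :: nat
  define \<beta> where "\<beta> N = B1 N * \<delta> + (B2 N * (2 * R) + B1 N * \<delta>)" for N
  have "(\<lambda>N. real N powr (- \<delta>)) \<longlonglongrightarrow> 0" using \<delta> by (intro tendsto_neg_powr filterlim_real_sequentially) auto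
  hence "B2 \<longlonglongrightarrow> M * (0 * (1 + (R + \<delta>) ^ 2 / R ^ 2))" unfolding B2_def by (intro tendsto_intros)
  moreover have "(\<lambda>N. M * (2 * R + \<delta>) / R ^ 2 / ln (real N)) \<longlonglongrightarrow> 0"
    by (intro tendsto_divide_0[OF tendsto_const] filterlim_at_top_imp_at_infinity
        filterlim_compose[OF ln_at_top filterlim_real_sequentially])
  hence "B1 \<longlonglongrightarrow> 0" by (simp add: B1_def[abs_def] mult.commute)
  ultimately have "\<beta> \<longlonglongrightarrow> 0 * \<delta> + (M * (0 * (1 + (R + \<delta>) ^ 2 / R ^ 2)) * (2 * R) + 0 * \<delta>)"
    unfolding \<beta>_def by (intro tendsto_intros)
  hence \<beta>0: "\<beta> \<longlonglongrightarrow> 0" by simp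
  let ?A = "part_circlepath 0 R 0 pi" and ?A' = "part_circlepath 0 R pi (2 * pi)"
  have imA: "norm w = R \<and> Im w \<ge> 0 \<and> (w \<notin> {of_real R, - of_real R} \<longrightarrow> Im w > 0)" if wA: "w \<in> path_image ?A" for w
  proof -
    have n: "norm w = R" using in_path_image_part_circlepath[OF wA] assms by simp
    from wA obtain t where t: "0 \<le> t" "t \<le> pi" "w = of_real R * cis t"
      unfolding path_image_part_circlepath' by (auto simp: closed_segment_eq_real_ivl)
    have i: "Im w \<ge> 0" using t assms by (simp add: sin_ge_zero)
    have "Im w \<noteq> 0" if "w \<notin> {of_real R, - of_real R}"
    proof
      assume "Im w = 0"
      hence "\<bar>Re w\<bar> = R" using n by (simp add: cmod_eq_Re)
      thus False using that \<open>Im w = 0\<close> by (auto simp: complex_eq_iff abs_if split: if_splits)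
    qed
    thus ?thesis using n i by auto
  qed
  have imA': "norm w = R \<and> (w \<notin> {of_real R, - of_real R} \<longrightarrow> Im w < 0)" if wA: "w \<in> path_image ?A'" for w
  proof -
    have n: "norm w = R" using in_path_image_part_circlepath[OF wA] assms by simp
    from wA obtain t where t: "pi \<le> t" "t \<le> 2 * pi" "w = of_real R * cis t"
      unfolding path_image_part_circlepath' by (auto simp: closed_segment_eq_real_ivl split: if_splits)
    have "sin t \<le> 0" using sin_ge_zero[of "t - pi"] t by (simp add: sin_diff)
    hence i: "Im w \<le> 0" using t assms by (simp add: mult_nonneg_nonpos)
    have "Im w \<noteq> 0" if "w \<notin> {of_real R, - of_real R}"
    proof
      assume "Im w = 0"
      hence "\<bar>Re w\<bar> = R" using n by (simp add: cmod_eq_Re)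
      thus False using that \<open>Im w = 0\<close> by (auto simp: complex_eq_iff abs_if split: if_splits)
    qed
    thus ?thesis using n i by auto
  qed
  have AV: "path_image ?A \<subseteq> V" using imA e by (force simp: V_def)
  have est: "norm (S N 0) \<le> 2 * C / R + C / real N + \<beta> N" if N: "N \<ge> 2" for N
  proof -
    have N1: "N \<ge> 1" using N by simp
    define F where "F w = q w * K R N w" for w
    have FV: "F holomorphic_on V" unfolding F_def by (intro holomorphic_intros q K_holomorphic N1 assms)
    have Fc: "continuous_on T F" if "T \<subseteq> V" for T
      using FV that by (meson continuous_on_subset holomorphic_on_imp_continuous_on)
    obtain IA where IA: "(F has_contour_integral IA) ?A"
      using contour_integrable_continuous_part_circlepath[OF Fc[OF AV]] by (auto simp: contour_integrable_on_def)
    obtain I1 where I1: "(F has_contour_integral I1) (linepath (- of_real R) b1)"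
      using contour_integrable_continuous_linepath[OF Fc, of "- of_real R" b1] ZV by (auto simp: contour_integrable_on_def Z_def)
    obtain I2 where I2: "(F has_contour_integral I2) (linepath b1 b2)"
      using contour_integrable_continuous_linepath[OF Fc, of b1 b2] ZV by (auto simp: contour_integrable_on_def Z_def)
    obtain I3 where I3: "(F has_contour_integral I3) (linepath b2 (of_real R))"
      using contour_integrable_continuous_linepath[OF Fc, of b2 "of_real R"] ZV by (auto simp: contour_integrable_on_def Z_def)
    let ?\<gamma> = "?A +++ (linepath (- of_real R) b1 +++ (linepath b1 b2 +++ linepath b2 (of_real R)))"
    have ends: "pathstart ?A = of_real R" "pathfinish ?A = - of_real R" by (auto simp: pathstart_def pathfinish_def part_circlepath_def linepath_def)
    have "(F has_contour_integral (IA + (I1 + (I2 + I3)))) ?\<gamma>"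
      by (intro has_contour_integral_join IA I1 I2 I3) (auto intro!: valid_path_join simp: ends)
    moreover have "(F has_contour_integral 0) ?\<gamma>"
    proof (rule Cauchy_theorem_convex_simple[OF FV cvV])
      show "path_image ?\<gamma> \<subseteq> V"
        using AV ZV by (subst path_image_join | simp add: ends Z_def)+
    qed (auto intro!: valid_path_join simp: ends)
    ultimately have closed: "IA + (I1 + (I2 + I3)) = 0" by (rule has_contour_integral_unique)
    define T where "T w = S N w * K R N w / w" for w
    have Tc: "continuous_on X T" if "0 \<notin> X" for X
      unfolding T_def using that holomorphic_on_imp_continuous_on[OF S_holomorphic] holomorphic_on_imp_continuous_on[OF K_holomorphic[OF N1 assms]]
      by (intro continuous_intros) auto
    have "0 \<notin> path_image ?A" "0 \<notin> path_image ?A'" using imA imA' assms by force+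
    then obtain JA JA' where JA: "(T has_contour_integral JA) ?A" and JA': "(T has_contour_integral JA') ?A'"
      using contour_integrable_continuous_part_circlepath[OF Tc] by (meson contour_integrable_on_def)
    have "((\<lambda>u. (S N u * K R N u) / (u - 0)) has_contour_integral (2 * of_real pi * \<i> * (S N 0 * K R N 0))) (circlepath 0 R)"
      using assms by (intro Cauchy_integral_circlepath_simple holomorphic_intros S_holomorphic K_holomorphic N1) auto
    moreover have "K R N 0 = 1" using N1 by (simp add: K_def)
    ultimately have "(T has_contour_integral (2 * of_real pi * \<i> * S N 0)) (circlepath 0 R)"
      by (simp add: T_def[abs_def])
    from contour_integral_circle_halves[OF JA JA' this]
    have tot: "2 * of_real pi * \<i> * S N 0 = JA + JA'" .
    \<comment> \<open>The two endpoints of the arc are exempted, because the pointwise bounds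
      require \<open>Im w \<noteq> 0\<close>.\<close>
    have mA: "norm (IA - JA) \<le> 2 * C / R ^ 2 * R * (pi - 0)"
    proof (rule has_contour_integral_bound_part_circlepath_strong[OF has_contour_integral_diff[OF IA JA], of "{of_real R, - of_real R}"])
      fix w assume "w \<in> path_image ?A - {of_real R, - of_real R}"
      hence w: "norm w = R" "Im w > 0" using imA by auto
      have "F w - T w = (H w - S N w) * K R N w / w"
        using w assms qw[of w] by (auto simp: F_def T_def field_simps)
      thus "norm (F w - T w) \<le> 2 * C / R ^ 2" using bound_upper[OF N1 w(1) assms w(2)] by simp
    qed (use C assms in auto)
    have mA': "norm JA' \<le> (2 * C / R ^ 2 + 2 * C / (R * real N)) * R * (2 * pi - pi)"
    proof (rule has_contour_integral_bound_part_circlepath_strong[OF JA', of "{of_real R, - of_real R}"])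
      fix w assume "w \<in> path_image ?A' - {of_real R, - of_real R}"
      hence w: "norm w = R" "Im w < 0" using imA' by auto
      show "norm (T w) \<le> 2 * C / R ^ 2 + 2 * C / (R * real N)"
        unfolding T_def by (rule bound_lower[OF N1 w(1) assms w(2)])
    qed (use C assms in auto)
    have side: "norm (F w) \<le> B1 N" if "w \<in> Z" "\<bar>Re w\<bar> = R \<and> - \<delta> \<le> Im w \<and> Im w \<le> 0" for w
      unfolding F_def B1_def norm_mult using that norm_K_side_le[OF N assms] M by (intro mult_mono) auto
    have B1n: "0 \<le> B1 N" unfolding B1_def using M N assms \<delta> by (intro mult_nonneg_nonneg divide_nonneg_nonneg) auto
    have n1: "norm I1 \<le> B1 N * norm (b1 - (- of_real R))"
      using side seg1 B1n by (intro has_contour_integral_bound_linepath[OF I1]) (auto simp: Z_def)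
    have n3: "norm I3 \<le> B1 N * norm (of_real R - b2)"
      using side seg3 B1n by (intro has_contour_integral_bound_linepath[OF I3]) (auto simp: Z_def)
    have n2: "norm I2 \<le> B2 N * norm (b2 - b1)"
    proof (rule has_contour_integral_bound_linepath[OF I2])
      show "0 \<le> B2 N" unfolding B2_def using M by (intro mult_nonneg_nonneg add_nonneg_nonneg) auto
      fix w assume w: "w \<in> closed_segment b1 b2"
      show "norm (F w) \<le> B2 N" unfolding F_def B2_def norm_mult
        using w seg2[OF w] norm_K_bottom_le[OF N1 assms] M \<delta> by (intro mult_mono) (auto simp: Z_def)
    qed
    have "b1 - (- of_real R) = - \<i> * of_real \<delta>" "of_real R - b2 = \<i> * of_real \<delta>" "b2 - b1 = of_real (2 * R)"
      by (simp_all add: b1_def b2_def complex_eq_iff)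
    hence lens: "norm (b1 - (- of_real R)) = \<delta>" "norm (of_real R - b2) = \<delta>" "norm (b2 - b1) = 2 * R"
      using \<delta> assms by (simp_all only: norm_mult norm_of_real) simp_all
    \<comment> \<open>Subtracting the vanishing integral over the closed contour replaces
      \<open>JA\<close> by the small difference \<open>IA - JA\<close>.\<close>
    have "2 * of_real pi * \<i> * S N 0 = - (IA - JA) + JA' - (I1 + (I2 + I3))"
      unfolding tot using closed by (simp add: algebra_simps eq_neg_iff_add_eq_0)
    hence "norm (2 * of_real pi * \<i> * S N 0) \<le> norm (IA - JA) + norm JA' + (norm I1 + (norm I2 + norm I3))"
      using norm_triangle_ineq4[of "- (IA - JA) + JA'" "I1 + (I2 + I3)"] norm_triangle_ineq[of "- (IA - JA)" JA']
        norm_triangle_ineq[of I1 "I2 + I3"] norm_triangle_ineq[of I2 I3] by (simp only: norm_minus_cancel)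
    also have "norm (2 * of_real pi * \<i> * S N 0) = 2 * pi * norm (S N 0)" by (simp add: norm_mult)
    finally have fin: "2 * pi * norm (S N 0) \<le> norm (IA - JA) + norm JA' + (norm I1 + (norm I2 + norm I3))" .
    have "norm I1 + (norm I2 + norm I3) \<le> \<beta> N" using n1 n2 n3 unfolding lens \<beta>_def by linarith
    moreover have "\<beta> N \<le> 2 * pi * \<beta> N"
    proof -
      have "0 \<le> \<beta> N" using \<open>norm I1 + (norm I2 + norm I3) \<le> \<beta> N\<close> norm_ge_zero[of I1] norm_ge_zero[of I2] norm_ge_zero[of I3] by linarith
      moreover have "1 \<le> 2 * pi" using pi_gt3 by linarith
      ultimately show ?thesis using mult_right_mono[of 1 "2 * pi" "\<beta> N"] by simp
    qed
    moreover have "2 * C / R ^ 2 * R * (pi - 0) + (2 * C / R ^ 2 + 2 * C / (R * real N)) * R * (2 * pi - pi) = 2 * pi * (2 * C / R + C / real N)"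
      using assms by (simp add: field_simps power2_eq_square)
    ultimately have "2 * pi * norm (S N 0) \<le> 2 * pi * (2 * C / R + C / real N + \<beta> N)"
      using fin mA mA' unfolding distrib_left by linarith
    thus ?thesis by simp
  qed
  show ?thesis by (rule that[OF \<beta>0 est])
qed

lemma S_tendsto_0: "(\<lambda>N. S N 0) \<longlonglongrightarrow> 0"
proof (rule tendsto_norm_zero_cancel, rule LIMSEQ_I)
  fix r :: real assume r: "r > 0"
  \<comment> \<open>This makes \<open>2 * C / R = r / 2\<close>; with \<open>R\<close> fixed, the
    other terms vanish as \<open>N\<close> grows.\<close>
  define R where "R = 4 * C / r"
  have R: "R > 0" using r C by (simp add: R_def)
  obtain \<beta> where \<beta>: "\<beta> \<longlonglongrightarrow> 0" "\<And>N. N \<ge> 2 \<Longrightarrow> norm (S N 0) \<le> 2 * C / R + C / real N + \<beta> N"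
    using main_estimate[OF R] by blast
  have "(\<lambda>N. 2 * C / R + C / real N + \<beta> N) \<longlonglongrightarrow> 2 * C / R + 0 + 0"
    by (intro tendsto_intros \<beta>(1) lim_const_over_n)
  moreover have "2 * C / R + 0 + 0 = r / 2" using C r by (simp add: R_def)
  ultimately have "(\<lambda>N. 2 * C / R + C / real N + \<beta> N) \<longlonglongrightarrow> r / 2" by (simp only:)
  from order_tendstoD(2)[OF this, of r] r
  have "\<forall>\<^sub>F N in sequentially. 2 * C / R + C / real N + \<beta> N < r" by simp
  hence "\<forall>\<^sub>F N in sequentially. norm (S N 0) < r"
    using eventually_ge_at_top[of 2] by eventually_elim (use \<beta>(2) in force)
  thus "\<exists>N0. \<forall>N\<ge>N0. norm (norm (S N 0) - 0) < r" by (simp add: eventually_at_top_linorder)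
qed

end

section \<open>Mean values\<close>

definition has_mean :: "(nat \<Rightarrow> real) \<Rightarrow> real \<Rightarrow> bool" where
  "has_mean u M \<longleftrightarrow> (\<lambda>N. (\<Sum>n=1..N. u n) / real N) \<longlonglongrightarrow> M"

text \<open>Summation by parts expresses the mean as the remainder \<open>d N\<close> minus the
  arithmetic mean of earlier remainders, and both tend to 0.\<close>

lemma kronecker_mean_zero:
  fixes b :: "nat \<Rightarrow> real"
  assumes "(\<lambda>N. \<Sum>n=1..N. b n / real n) \<longlonglongrightarrow> l"
  shows "has_mean b 0"
proof -
  define d where "d N = (\<Sum>n=1..N. b n / real n) - l" for N
  have d0: "d \<longlonglongrightarrow> 0" using assms unfolding d_def by (simp add: LIM_zero_iff)
  have abel: "(\<Sum>n=1..N. b n) = real N * d N - (\<Sum>n<N. d n)" for N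
  proof (induction N)
    case (Suc N)
    have "d (Suc N) = d N + b (Suc N) / real (Suc N)" by (simp add: d_def)
    hence "real (Suc N) * d (Suc N) = real (Suc N) * d N + b (Suc N)" by (simp add: distrib_left)
    thus ?case using Suc by (simp add: algebra_simps)
  qed simp
  have "(\<lambda>N. (\<Sum>n<N. \<bar>d n\<bar>) / real N) \<longlonglongrightarrow> 0"
  proof (rule LIMSEQ_I)
    fix r :: real assume r: "r > 0"
    from LIMSEQ_D[OF d0, of "r / 2"] r obtain M where M: "\<And>n. n \<ge> M \<Longrightarrow> \<bar>d n\<bar> < r / 2" by auto
    define K where "K = (\<Sum>n<M. \<bar>d n\<bar>)"
    have "norm ((\<Sum>n<N. \<bar>d n\<bar>) / real N - 0) < r" if N: "N \<ge> Suc (M + nat \<lceil>2 * K / r\<rceil>)" for N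
    proof -
      have "(\<Sum>n\<in>{..<M} \<union> {M..<N}. \<bar>d n\<bar>) = K + (\<Sum>n\<in>{M..<N}. \<bar>d n\<bar>)"
        unfolding K_def by (rule sum.union_disjoint) auto
      moreover have "{..<M} \<union> {M..<N} = {..<N}" using N by auto
      ultimately have "(\<Sum>n<N. \<bar>d n\<bar>) = K + (\<Sum>n\<in>{M..<N}. \<bar>d n\<bar>)" by (simp only:)
      also have "(\<Sum>n\<in>{M..<N}. \<bar>d n\<bar>) \<le> (\<Sum>n\<in>{M..<N}. r / 2)"
        using M by (intro sum_mono) (auto intro: less_imp_le)
      also have "\<dots> \<le> real N * (r / 2)" using r by simp
      finally have le: "(\<Sum>n<N. \<bar>d n\<bar>) \<le> K + real N * (r / 2)" by simp
      have "real N > 2 * K / r" using N by linarith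
      hence "K < real N * (r / 2)" using r by (simp add: field_simps)
      hence "(\<Sum>n<N. \<bar>d n\<bar>) < real N * r" using le by linarith
      hence "(\<Sum>n<N. \<bar>d n\<bar>) / real N < r" using N by (simp add: divide_less_eq mult.commute)
      thus ?thesis by (simp add: sum_nonneg)
    qed
    thus "\<exists>N0. \<forall>N\<ge>N0. norm ((\<Sum>n<N. \<bar>d n\<bar>) / real N - 0) < r" by blast
  qed
  hence "(\<lambda>N. \<bar>d N\<bar> + (\<Sum>n<N. \<bar>d n\<bar>) / real N) \<longlonglongrightarrow> 0 + 0"
    using d0 by (intro tendsto_add tendsto_rabs_zero)
  hence lim: "(\<lambda>N. \<bar>d N\<bar> + (\<Sum>n<N. \<bar>d n\<bar>) / real N) \<longlonglongrightarrow> 0" by simp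
  show ?thesis unfolding has_mean_def
  proof (rule Lim_null_comparison[OF _ lim], rule eventually_sequentiallyI[of 1])
    fix N :: nat assume N: "N \<ge> 1"
    have "(\<Sum>n=1..N. b n) / real N = d N - (\<Sum>n<N. d n) / real N" unfolding abel using N by (simp add: diff_divide_distrib)
    also have "\<bar>\<dots>\<bar> \<le> \<bar>d N\<bar> + \<bar>(\<Sum>n<N. d n) / real N\<bar>" by (rule abs_triangle_ineq4)
    also have "\<bar>(\<Sum>n<N. d n) / real N\<bar> \<le> (\<Sum>n<N. \<bar>d n\<bar>) / real N"
      using sum_abs[of d "{..<N}"] by (simp add: divide_right_mono)
    finally show "norm ((\<Sum>n=1..N. b n) / real N) \<le> \<bar>d N\<bar> + (\<Sum>n<N. \<bar>d n\<bar>) / real N" by simp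
  qed
qed

text \<open>Newman's theorem shows that the series of \<open>psi n * tau3 n / n\<close> converges,
  to \<open>Lfun 3 / Lfun 1\<close>, and Kronecker's lemma turns convergence into mean value
  0.\<close>

theorem psi_tau3_mean_zero: "has_mean (\<lambda>n. psi n * tau3 n) 0"
proof -
  define c where "c = Lfun 3 / Lfun 1"
  \<comment> \<open>Lowering the coefficient at 1 by \<open>c\<close> subtracts the constant
    \<open>c\<close> from the Dirichlet series and so makes the continued function vanish at
    0.\<close>
  define a where "a n = of_real (psi n * tau3 n) - (if n = 1 then c else 0)" for n :: nat
  define U where "U = {z. Re z > - 1} \<inter> (\<lambda>z. Lfun (1 + z)) -` (- {0})"
  define G where "G z = Lfun (3 * (1 + z)) / Lfun (1 + z) - c" for z
  have hol1: "(\<lambda>z. Lfun (1 + z)) holomorphic_on {z. Re z > - 1}"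
    using holomorphic_on_compose_gen[of "\<lambda>z. 1 + z" "{z. Re z > - 1}" Lfun "{s. Re s > 0}"] Lfun_holomorphic
    by (simp add: o_def holomorphic_intros image_subset_iff)
  have hol3: "(\<lambda>z. Lfun (3 * (1 + z))) holomorphic_on {z. Re z > - 1}"
    using holomorphic_on_compose_gen[of "\<lambda>z. 3 * (1 + z)" "{z. Re z > - 1}" Lfun "{s. Re s > 0}"] Lfun_holomorphic
    by (simp add: o_def holomorphic_intros image_subset_iff)
  interpret newman a "2 + norm c" U G
  proof
    show "2 + norm c > 0" by (simp add: add_pos_nonneg)
    show "norm (a n) \<le> 2 + norm c" for n
    proof -
      have "\<bar>psi n * tau3 n\<bar> \<le> 1"
        unfolding abs_mult using abs_psi_le[of n] abs_tau3_le[of n] by (intro mult_le_one) auto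
      hence "norm (of_real (psi n * tau3 n) :: complex) \<le> 1" by (simp only: norm_of_real)
      moreover have "norm (if n = 1 then c else 0) \<le> norm c" by simp
      ultimately show ?thesis unfolding a_def
        using norm_triangle_ineq4[of "of_real (psi n * tau3 n)" "if n = 1 then c else 0"] by linarith
    qed
    show "open U" unfolding U_def
      by (intro continuous_open_preimage holomorphic_on_imp_continuous_on[OF hol1] open_halfspace_Re_gt) auto
    show "{z. Re z \<ge> 0} \<subseteq> U" unfolding U_def using Lfun_nonzero by auto
    show "G holomorphic_on U" unfolding G_def U_def
      by (intro holomorphic_intros holomorphic_on_subset[OF hol1] holomorphic_on_subset[OF hol3]) auto
    show "G 0 = 0" by (simp add: G_def c_def)
    fix z :: complex assume z: "Re z > 0"
    hence s: "Re (1 + z) > 1" by simp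
    have L: "Lfun (1 + z) \<noteq> 0" using Lfun_nonzero[of "1 + z"] z by simp
    have "G_term (1 + z) sums (\<Sum>n. G_term (1 + z) n)"
      by (rule summable_sums[OF summable_norm_cancel[OF summable_G_term[OF s]]])
    moreover have "(\<Sum>n. G_term (1 + z) n) = Lfun (3 * (1 + z)) / Lfun (1 + z)"
      using G_series_times_Lfun[OF s] L by (simp add: eq_divide_eq)
    ultimately have "G_term (1 + z) sums (Lfun (3 * (1 + z)) / Lfun (1 + z))" by (simp only:)
    from sums_diff[OF this sums_single[of 1 "\<lambda>_. c"]]
    have "(\<lambda>n. G_term (1 + z) n - (if n = 1 then c else 0)) sums (Lfun (3 * (1 + z)) / Lfun (1 + z) - c)" .
    moreover have "G_term (1 + z) n - (if n = 1 then c else 0) = a n * of_nat n powr (- (1 + z))" for n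
      by (simp add: a_def G_term_def left_diff_distrib)
    ultimately show "(\<lambda>n. a n * of_nat n powr (- (1 + z))) sums G z" by (simp add: G_def)
  qed
  have S0: "S N 0 = of_real (\<Sum>n=1..N. psi n * tau3 n / real n) - c" if "N \<ge> 1" for N
  proof -
    have "of_nat n powr (- (1 - \<i> * 0)) = (1 / of_nat n :: complex)" if "n \<in> {1..N}" for n
      using that by (simp add: powr_minus divide_inverse)
    hence "S N 0 = (\<Sum>n=1..N. of_real (psi n * tau3 n / real n) - (if n = 1 then c else 0))"
      unfolding S_def a_def by (intro sum.cong refl) (auto simp: diff_divide_distrib)
    also have "\<dots> = of_real (\<Sum>n=1..N. psi n * tau3 n / real n) - c"
      using that by (simp add: sum_subtractf sum.delta)
    finally show ?thesis .
  qed
  have "(\<lambda>N. of_real (\<Sum>n=1..N. psi n * tau3 n / real n) - c) \<longlonglongrightarrow> 0"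
    by (rule Lim_transform_eventually[OF S_tendsto_0]) (use S0 in \<open>auto intro!: eventually_sequentiallyI[of 1]\<close>)
  hence "(\<lambda>N. of_real (\<Sum>n=1..N. psi n * tau3 n / real n)) \<longlonglongrightarrow> c" by (simp add: LIM_zero_iff)
  from tendsto_Re[OF this] show ?thesis by (intro kronecker_mean_zero[of _ "Re c"]) simp
qed

section \<open>Mean values of functions of finitely many valuations\<close>

lemma has_mean_cmult: "has_mean u M \<Longrightarrow> has_mean (\<lambda>n. c * u n) (c * M)"
  unfolding has_mean_def by (drule tendsto_mult_left[of _ _ _ c]) (simp add: sum_distrib_left)

lemma has_mean_sum:
  assumes "finite A" "\<And>a. a \<in> A \<Longrightarrow> has_mean (u a) (M a)"
  shows "has_mean (\<lambda>n. \<Sum>a\<in>A. u a n) (\<Sum>a\<in>A. M a)"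
proof -
  have "(\<lambda>N. \<Sum>a\<in>A. (\<Sum>n=1..N. u a n) / real N) \<longlonglongrightarrow> (\<Sum>a\<in>A. M a)"
    using assms(2) unfolding has_mean_def by (intro tendsto_sum) auto
  moreover have "(\<Sum>a\<in>A. (\<Sum>n=1..N. u a n) / real N) = (\<Sum>n=1..N. \<Sum>a\<in>A. u a n) / real N" for N
    by (subst sum.swap) (simp add: sum_divide_distrib)
  ultimately show ?thesis by (simp add: has_mean_def)
qed

lemma has_mean_diff: "has_mean u M \<Longrightarrow> has_mean v K \<Longrightarrow> has_mean (\<lambda>n. u n - v n) (M - K)"
  unfolding has_mean_def by (drule (1) tendsto_diff) (simp add: sum_subtractf diff_divide_distrib)

definition dilate :: "nat \<Rightarrow> (nat \<Rightarrow> real) \<Rightarrow> nat \<Rightarrow> real" where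
  "dilate d u n = (if d dvd n then u (n div d) else 0)"

lemma sum_dilate:
  assumes "d > 0"
  shows "(\<Sum>n=1..N. dilate d u n) = (\<Sum>m=1..N div d. u m)"
proof -
  have "(\<Sum>n=1..N. dilate d u n) = (\<Sum>n\<in>{n \<in> {1..N}. d dvd n}. u (n div d))"
    unfolding dilate_def by (subst sum.inter_filter) auto
  also have "\<dots> = (\<Sum>m=1..N div d. u m)"
  proof (rule sum.reindex_bij_witness[of _ "\<lambda>m. d * m" "\<lambda>n. n div d"])
    fix n assume n: "n \<in> {n \<in> {1..N}. d dvd n}"
    then obtain m where m: "n = d * m" by auto
    show "d * (n div d) = n" using n by auto
    have "m > 0" using m n by (intro Nat.gr0I) auto
    thus "n div d \<in> {1..N div d}" using m n assms div_le_mono[of n N d] by auto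
  next
    fix m assume "m \<in> {1..N div d}"
    hence m: "1 \<le> m" "m \<le> N div d" by auto
    have "d * m \<le> N" using m assms by (simp add: less_eq_div_iff_mult_less_eq mult.commute)
    thus "d * m \<in> {n \<in> {1..N}. d dvd n}" using m assms by (simp add: Suc_le_eq)
    show "d * m div d = m" using assms by simp
  qed auto
  finally show ?thesis .
qed

lemma has_mean_dilate:
  assumes "has_mean u M" "d > 0"
  shows "has_mean (dilate d u) (M / real d)"
proof -
  have fl: "filterlim (\<lambda>N. N div d) at_top sequentially"
    unfolding filterlim_at_top
  proof
    fix Z :: nat
    have "Z \<le> N div d" if "N \<ge> Z * d" for N using div_le_mono[OF that, of d] assms by simp
    thus "\<forall>\<^sub>F N in sequentially. Z \<le> N div d" by (intro eventually_sequentiallyI) auto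
  qed
  have 1: "(\<lambda>N. (\<Sum>m=1..N div d. u m) / real (N div d)) \<longlonglongrightarrow> M"
    using filterlim_compose[OF assms(1)[unfolded has_mean_def] fl] .
  have 2: "(\<lambda>N. real (N div d) / real N) \<longlonglongrightarrow> 1 / real d"
  proof (rule tendsto_sandwich[of "\<lambda>N. 1 / real d - 1 / real N" _ _ "\<lambda>N. 1 / real d"])
    show "\<forall>\<^sub>F N in sequentially. 1 / real d - 1 / real N \<le> real (N div d) / real N"
    proof (rule eventually_sequentiallyI[of 1])
      fix N :: nat assume "N \<ge> 1"
      thus "1 / real d - 1 / real N \<le> real (N div d) / real N"
        using divide_right_mono[OF card_multiples_ge[OF assms(2), of N], of "real N"]
        by (simp add: card_multiples[OF assms(2), simplified] diff_divide_distrib)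
    qed
    show "\<forall>\<^sub>F N in sequentially. real (N div d) / real N \<le> 1 / real d"
    proof (rule eventually_sequentiallyI[of 1])
      fix N :: nat assume "N \<ge> 1"
      thus "real (N div d) / real N \<le> 1 / real d"
        using divide_right_mono[OF card_multiples_le[OF assms(2), of N], of "real N"]
        by (simp add: card_multiples[OF assms(2), simplified])
    qed
    have "(\<lambda>N. 1 / real d - 1 / real N) \<longlonglongrightarrow> 1 / real d - 0" by (intro tendsto_intros lim_const_over_n)
    thus "(\<lambda>N. 1 / real d - 1 / real N) \<longlonglongrightarrow> 1 / real d" by simp
  qed simp
  have "(\<lambda>N. (\<Sum>m=1..N div d. u m) / real (N div d) * (real (N div d) / real N)) \<longlonglongrightarrow> M * (1 / real d)"
    by (rule tendsto_mult[OF 1 2])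
  moreover have "(\<Sum>m=1..N div d. u m) / real (N div d) * (real (N div d) / real N) = (\<Sum>n=1..N. dilate d u n) / real N" for N
    unfolding sum_dilate[OF assms(2)] by (cases "N div d = 0") auto
  moreover have "M * (1 / real d) = M / real d" by simp
  ultimately show ?thesis by (simp only: has_mean_def)
qed

lemma has_mean_approx:
  assumes "\<And>\<epsilon>. \<epsilon> > 0 \<Longrightarrow> \<exists>v K. has_mean v K \<and> \<bar>K - M\<bar> \<le> \<epsilon> \<and> (\<forall>N. \<bar>(\<Sum>n=1..N. u n) - (\<Sum>n=1..N. v n)\<bar> \<le> \<epsilon> * real N)"
  shows "has_mean u M"
  unfolding has_mean_def
proof (rule LIMSEQ_I)
  fix r :: real assume r: "r > 0"
  then obtain v K where v: "has_mean v K" "\<bar>K - M\<bar> \<le> r / 4" "\<And>N. \<bar>(\<Sum>n=1..N. u n) - (\<Sum>n=1..N. v n)\<bar> \<le> r / 4 * real N"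
    using assms[of "r / 4"] by auto
  from LIMSEQ_D[OF v(1)[unfolded has_mean_def], of "r / 4"] r
  obtain N0 where N0: "\<And>N. N \<ge> N0 \<Longrightarrow> \<bar>(\<Sum>n=1..N. v n) / real N - K\<bar> < r / 4" by auto
  have "norm ((\<Sum>n=1..N. u n) / real N - M) < r" if N: "N \<ge> max N0 1" for N
  proof -
    have "\<bar>(\<Sum>n=1..N. u n) - (\<Sum>n=1..N. v n)\<bar> / real N \<le> r / 4"
      using v(3)[of N] N by (simp add: divide_le_eq)
    hence "\<bar>(\<Sum>n=1..N. u n) / real N - (\<Sum>n=1..N. v n) / real N\<bar> \<le> r / 4"
      by (simp flip: diff_divide_distrib)
    thus ?thesis using N0[of N] v(2) N r unfolding real_norm_def abs_less_iff abs_le_iff by linarith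
  qed
  thus "\<exists>N0. \<forall>N\<ge>N0. norm ((\<Sum>n=1..N. u n) / real N - M) < r" by blast
qed

text \<open>As \<open>u\<close> ignores factors of \<open>p\<close>, it is independent of the
  multiplicity of \<open>p\<close>, which equals \<open>e\<close> with density
  \<open>(1 - 1 / p) * (1 / p) ^ e\<close>. The difference of two dilates of \<open>u\<close>
  selects an exact multiplicity, and multiplicities from \<open>E\<close> on concern at most a
  proportion \<open>(1 / p) ^ E\<close> of the integers.\<close>

lemma has_mean_prime_factor:
  fixes u :: "nat \<Rightarrow> real" and h :: "nat \<Rightarrow> real"
  assumes p: "prime p" and u: "\<And>n. \<bar>u n\<bar> \<le> 1" "\<And>m. m > 0 \<Longrightarrow> u (p * m) = u m" "has_mean u M"
    and h: "\<And>e. \<bar>h e\<bar> \<le> 1" "(\<lambda>e. h e * ((1 - 1 / real p) * (1 / real p) ^ e)) sums c"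
  shows "has_mean (\<lambda>n. h (multiplicity p n) * u n) (c * M)"
proof (rule has_mean_approx)
  fix \<epsilon> :: real assume \<epsilon>: "\<epsilon> > 0"
  have p1: "p > 1" using p prime_gt_1_nat by blast
  have M0: "0 < \<bar>M\<bar> + 1" by simp
  from LIMSEQ_D[OF h(2)[unfolded sums_def], of "\<epsilon> / (\<bar>M\<bar> + 1)"] \<epsilon> M0 obtain E1 where
    E1: "\<And>E. E \<ge> E1 \<Longrightarrow> \<bar>(\<Sum>e<E. h e * ((1 - 1 / real p) * (1 / real p) ^ e)) - c\<bar> < \<epsilon> / (\<bar>M\<bar> + 1)" by auto
  obtain E2 where E2: "(1 / real p) ^ E2 < \<epsilon>" using real_arch_pow_inv[OF \<epsilon>, of "1 / real p"] p1 by auto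
  define E where "E = max E1 E2"
  have pE: "(1 / real p) ^ E \<le> \<epsilon>"
  proof -
    have "(1 / real p) ^ E \<le> (1 / real p) ^ E2" using p1 by (intro power_decreasing) (auto simp: E_def)
    thus ?thesis using E2 by linarith
  qed
  define v where "v n = (\<Sum>e<E. h e * (dilate (p ^ e) u n - dilate (p ^ (e + 1)) u n))" for n
  define K where "K = (\<Sum>e<E. h e * (M / real (p ^ e) - M / real (p ^ (e + 1))))"
  have "has_mean v K" unfolding v_def K_def
    using p1 by (intro has_mean_sum has_mean_cmult has_mean_diff has_mean_dilate u(3)) auto
  moreover have "K = (\<Sum>e<E. h e * ((1 - 1 / real p) * (1 / real p) ^ e)) * M"
    unfolding K_def sum_distrib_right using p1 by (intro sum.cong refl) (simp add: power_one_over field_simps)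
  hence "\<bar>K - c * M\<bar> = \<bar>(\<Sum>e<E. h e * ((1 - 1 / real p) * (1 / real p) ^ e)) - c\<bar> * \<bar>M\<bar>"
    by (simp add: left_diff_distrib flip: abs_mult)
  hence "\<bar>K - c * M\<bar> \<le> \<epsilon> / (\<bar>M\<bar> + 1) * (\<bar>M\<bar> + 1)"
    using E1[of E] \<epsilon> by (simp only: E_def) (intro mult_mono, auto)
  hence "\<bar>K - c * M\<bar> \<le> \<epsilon>" using M0 by simp
  moreover have "\<bar>(\<Sum>n=1..N. h (multiplicity p n) * u n) - (\<Sum>n=1..N. v n)\<bar> \<le> \<epsilon> * real N" for N
  proof -
    have up: "u (n div p ^ e) = u n" if "p ^ e dvd n" "n > 0" for n e
      using that
    proof (induction e arbitrary: n)
      case (Suc e)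
      then obtain m where m: "n = p * (p ^ e * m)" "m > 0" by (auto simp: mult.assoc)
      have "u (p ^ e * m) = u (p ^ e * m div p ^ e)" using Suc.IH[of "p ^ e * m"] m p1 by simp
      moreover have "u n = u (p ^ e * m)" unfolding m(1) using m p1 by (intro u(2)) auto
      moreover have "n div p ^ Suc e = m" using m p1 by (simp flip: mult.assoc)
      ultimately show ?case using p1 by simp
    qed simp
    have veq: "v n = (if multiplicity p n < E then h (multiplicity p n) * u n else 0)" if n: "n > 0" for n
    proof -
      have dv: "p ^ e dvd n \<longleftrightarrow> e \<le> multiplicity p n" for e
        using n p1 by (intro power_dvd_iff_le_multiplicity) auto
      have dil: "dilate (p ^ e) u n = (if e \<le> multiplicity p n then u n else 0)" for e
        unfolding dilate_def dv[of e, symmetric] using up[of e n] n by simp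
      have "v n = (\<Sum>e<E. if e = multiplicity p n then h e * u n else 0)"
        unfolding v_def dil by (intro sum.cong refl) auto
      thus ?thesis by simp
    qed
    have "\<bar>(\<Sum>n=1..N. h (multiplicity p n) * u n) - (\<Sum>n=1..N. v n)\<bar> = \<bar>\<Sum>n=1..N. h (multiplicity p n) * u n - v n\<bar>"
      by (simp add: sum_subtractf)
    also have "\<dots> \<le> (\<Sum>n=1..N. \<bar>h (multiplicity p n) * u n - v n\<bar>)" by (rule sum_abs)
    also have "\<dots> \<le> (\<Sum>n=1..N. if p ^ E dvd n then 1 else 0)"
    proof (rule sum_mono)
      fix n assume "n \<in> {1..N}"
      hence n: "n > 0" by simp
      have "p ^ E dvd n \<longleftrightarrow> E \<le> multiplicity p n" using n p1 by (intro power_dvd_iff_le_multiplicity) auto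
      moreover have "\<bar>h (multiplicity p n) * u n\<bar> \<le> 1" unfolding abs_mult using h(1) u(1) by (intro mult_le_one) auto
      ultimately show "\<bar>h (multiplicity p n) * u n - v n\<bar> \<le> (if p ^ E dvd n then 1 else 0)"
        unfolding veq[OF n] by auto
    qed
    also have "\<dots> = real (card {n \<in> {1..N}. p ^ E dvd n})" by (simp add: sum.If_cases Int_def)
    also have "\<dots> \<le> real N / real (p ^ E)" using p1 by (intro card_multiples_le) auto
    also have "\<dots> = (1 / real p) ^ E * real N" by (simp add: power_one_over)
    also have "\<dots> \<le> \<epsilon> * real N" using pE by (intro mult_right_mono) auto
    finally show ?thesis .
  qed
  ultimately show "\<exists>v K. has_mean v K \<and> \<bar>K - c * M\<bar> \<le> \<epsilon> \<and>
      (\<forall>N. \<bar>(\<Sum>n=1..N. h (multiplicity p n) * u n) - (\<Sum>n=1..N. v n)\<bar> \<le> \<epsilon> * real N)" by blast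
qed

lemma has_mean_finite_product:
  fixes h :: "nat \<Rightarrow> nat \<Rightarrow> real"
  assumes "finite P" "\<And>p. p \<in> P \<Longrightarrow> prime p"
    and "\<And>p e. p \<in> P \<Longrightarrow> \<bar>h p e\<bar> \<le> 1"
    and "\<And>p. p \<in> P \<Longrightarrow> (\<lambda>e. h p e * ((1 - 1 / real p) * (1 / real p) ^ e)) sums c p"
  shows "has_mean (\<lambda>n. \<Prod>p\<in>P. h p (multiplicity p n)) (\<Prod>p\<in>P. c p)"
  using assms
proof (induction P)
  case empty
  have "(\<lambda>N. real N / real N) \<longlonglongrightarrow> 1"
    by (rule tendsto_eventually, rule eventually_sequentiallyI[of 1]) simp
  thus ?case by (simp add: has_mean_def)
next
  case (insert q P)
  have "has_mean (\<lambda>n. h q (multiplicity q n) * (\<Prod>p\<in>P. h p (multiplicity p n))) (c q * (\<Prod>p\<in>P. c p))"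
  proof (rule has_mean_prime_factor)
    show "prime q" using insert by auto
    show "\<bar>\<Prod>p\<in>P. h p (multiplicity p n)\<bar> \<le> 1" for n
      unfolding abs_prod using insert.prems by (intro prod_le_1) auto
    fix m :: nat assume "m > 0"
    show "(\<Prod>p\<in>P. h p (multiplicity p (q * m))) = (\<Prod>p\<in>P. h p (multiplicity p m))"
    proof (intro prod.cong refl)
      fix p assume p: "p \<in> P"
      hence "\<not> p dvd q" using insert primes_dvd_imp_eq[of p q] by auto
      thus "h p (multiplicity p (q * m)) = h p (multiplicity p m)"
        using p insert.prems \<open>m > 0\<close> prime_gt_0_nat[of q]
        by (subst prime_elem_multiplicity_mult_distrib) (auto simp: not_dvd_imp_multiplicity_0)
    qed
  qed (use insert in auto)
  thus ?case using insert by simp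
qed

section \<open>The upper bound\<close>

text \<open>The density of the integers whose valuation at \<open>p\<close> does not force 3 to
  divide \<tau>. Blocks of three give \<open>(1 + x) / (1 + x + x ^ 2)\<close> with
  \<open>x = 1 / p\<close>.\<close>

lemma sums_pattern:
  fixes p :: nat
  assumes "p > 1"
  shows "(\<lambda>e. (if e mod 3 = 2 then 0 else 1) * ((1 - 1 / real p) * (1 / real p) ^ e)) sums (1 - 1 / (real p ^ 2 + real p + 1))"
proof -
  define x where "x = 1 / real p"
  have x: "0 < x" "x < 1" using assms by (auto simp: x_def)
  have x3: "norm (x ^ 3) < 1" using x by (simp add: power_less_one_iff)
  let ?f = "\<lambda>e. (if e mod 3 = 2 then 0 else 1) * ((1 - x) * x ^ e) :: real"
  have sm: "summable ?f"
  proof (rule summable_comparison_test')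
    show "summable (\<lambda>e. x ^ e)" using x by (intro summable_geometric) auto
    show "norm (?f e) \<le> x ^ e" if "e \<ge> 0" for e
      using x by (auto simp: abs_mult intro!: mult_left_le_one_le)
  qed
  have blk: "(\<Sum>e = k * 3..<k * 3 + 3. ?f e) = (x ^ 3) ^ k * ((1 - x) * (1 + x))" for k
  proof -
    have "{k * 3..<k * 3 + 3} = {3 * k, 3 * k + 1, 3 * k + 2}" by auto
    moreover have "(3 * k) mod 3 = 0" "(3 * k + 1) mod 3 = 1" "(3 * k + 2) mod 3 = 2" by presburger+
    ultimately have "(\<Sum>e = k * 3..<k * 3 + 3. ?f e) = (1 - x) * x ^ (3 * k) + (1 - x) * x ^ (3 * k + 1)"
      by (simp del: mod_mult_self1_is_0 mod_mult_self2_is_0)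
    also have "\<dots> = (x ^ 3) ^ k * ((1 - x) * (1 + x))"
      by (simp add: algebra_simps power_add flip: power_mult)
    finally show ?thesis .
  qed
  have "(\<lambda>k. (x ^ 3) ^ k * ((1 - x) * (1 + x))) sums (\<Sum>e. ?f e)"
    using sums_group[OF summable_sums[OF sm], of 3] unfolding blk by simp
  moreover have "(\<lambda>k. (x ^ 3) ^ k * ((1 - x) * (1 + x))) sums (1 / (1 - x ^ 3) * ((1 - x) * (1 + x)))"
    by (intro sums_mult2 geometric_sums x3)
  ultimately have eq: "(\<Sum>e. ?f e) = 1 / (1 - x ^ 3) * ((1 - x) * (1 + x))" by (rule sums_unique2)
  have p0: "real p > 1" using assms by simp
  have q0: "real p ^ 2 + real p + 1 > 0" using p0 by (simp add: add_pos_pos)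
  have "1 - x ^ 3 = (1 - x) * (1 + x + x ^ 2)" by (simp add: algebra_simps power2_eq_square power3_eq_cube)
  moreover have "1 / ((1 - x) * B) * ((1 - x) * (1 + x)) = (1 + x) / B" for B using x by simp
  ultimately have "(\<Sum>e. ?f e) = (1 + x) / (1 + x + x ^ 2)" unfolding eq by (simp only:)
  also have "\<dots> = (real p ^ 2 + real p) / (real p ^ 2 + real p + 1)"
  proof -
    have "1 + x = (real p ^ 2 + real p) / real p ^ 2" "1 + x + x ^ 2 = (real p ^ 2 + real p + 1) / real p ^ 2"
      using p0 by (simp_all add: x_def field_simps power2_eq_square)
    thus ?thesis using p0 by simp
  qed
  also have "\<dots> = 1 - 1 / (real p ^ 2 + real p + 1)" using q0 by (simp add: field_simps)
  finally show ?thesis using summable_sums[OF sm] by (simp add: x_def)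
qed

lemma prod_one_minus_ge:
  fixes a :: "'a \<Rightarrow> real"
  assumes "finite P" "\<And>p. p \<in> P \<Longrightarrow> 0 \<le> a p \<and> a p \<le> 1"
  shows "1 - (\<Sum>p\<in>P. a p) \<le> (\<Prod>p\<in>P. 1 - a p)"
  using assms
proof (induction P)
  case (insert q P)
  have "1 - (\<Sum>p\<in>insert q P. a p) \<le> (1 - (\<Sum>p\<in>P. a p)) - a q * 1" using insert by simp
  also have "a q * (\<Prod>p\<in>P. 1 - a p) \<le> a q * 1"
    using insert.prems by (intro mult_left_mono prod_le_1) auto
  hence "(1 - (\<Sum>p\<in>P. a p)) - a q * 1 \<le> (\<Prod>p\<in>P. 1 - a p) - a q * (\<Prod>p\<in>P. 1 - a p)"
    using insert by auto
  also have "\<dots> = (\<Prod>p\<in>insert q P. 1 - a p)" using insert by (simp add: algebra_simps)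
  finally show ?case .
qed simp

text \<open>Each term is at most the increment of \<open>- 1 / (4 * m + 1)\<close>, so the sum over
  the odd numbers from 37 on is at most \<open>1 / (4 * 18 + 1)\<close>.\<close>

lemma sum_odd_tail_le:
  "(\<Sum>m\<in>{18..<N}. 1 / (real (2 * m + 1) ^ 2 + real (2 * m + 1) + 1)) \<le> 1 / 73"
proof (cases "N \<ge> 18")
  case True
  let ?g = "\<lambda>m. - (1 / (4 * real m + 1))"
  have "(\<Sum>m\<in>{18..<N}. 1 / (real (2 * m + 1) ^ 2 + real (2 * m + 1) + 1)) \<le> (\<Sum>m\<in>{18..<N}. ?g (Suc m) - ?g m)"
  proof (rule sum_mono)
    fix m assume "m \<in> {18..<N}"
    have "?g (Suc m) - ?g m = 4 / ((4 * real m + 1) * (4 * real m + 5))" by (simp add: field_simps)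
    moreover have "4 / ((4 * real m + 1) * (4 * real m + 5)) \<ge> 1 / (real (2 * m + 1) ^ 2 + real (2 * m + 1) + 1)"
    proof -
      have "(4 * real m + 1) * (4 * real m + 5) \<le> 4 * (real (2 * m + 1) ^ 2 + real (2 * m + 1) + 1)"
        by (simp add: power2_eq_square algebra_simps)
      thus ?thesis by (simp add: divide_le_eq field_simps add_pos_pos) (simp add: add_pos_nonneg)?
    qed
    ultimately show "1 / (real (2 * m + 1) ^ 2 + real (2 * m + 1) + 1) \<le> ?g (Suc m) - ?g m" by simp
  qed
  also have "\<dots> = ?g N - ?g 18" using sum_Suc_diff'[OF True, of ?g] .
  also have "\<dots> \<le> 1 / 73" by simp
  finally show ?thesis .
qed simp

lemma prime_5_cases:
  assumes "prime (p::nat)" "p \<ge> 5"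
  shows "p \<in> {5, 7, 11, 13, 17, 19, 23, 29, 31} \<or> (odd p \<and> p \<ge> 37)"
proof -
  have nd: "\<not> q dvd p \<or> p = q" if "prime q" for q using primes_dvd_imp_eq[OF that assms(1)] by auto
  have "\<not> 2 dvd p" "\<not> 3 dvd p" "\<not> 5 dvd p \<or> p = 5"
    using nd[of 2] nd[of 3] nd[of 5] assms by auto
  thus ?thesis using assms(2) by simp presburger
qed

text \<open>The primes up to 31 contribute at most 0.0728; from 37 on the sum is enlarged to all odd
  numbers.\<close>

lemma sum_prime_deficits_le:
  assumes "finite P" "\<And>p. p \<in> P \<Longrightarrow> prime p \<and> p \<ge> (5::nat)"
  shows "(\<Sum>p\<in>P. 1 / (real p ^ 2 + real p + 1)) \<le> 0.0866"
proof -
  let ?f = "\<lambda>p. 1 / (real p ^ 2 + real p + 1)"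
  let ?A = "{5, 7, 11, 13, 17, 19, 23, 29, 31 :: nat}"
  define N where "N = Max (insert 0 P) + 1"
  let ?B = "(\<lambda>m. 2 * m + 1) ` {18..<N}"
  have "P \<subseteq> ?A \<union> ?B"
  proof
    fix p assume p: "p \<in> P"
    have "p \<le> Max (insert 0 P)" using p assms(1) by (intro Max_ge) auto
    hence "p < N" unfolding N_def by linarith
    moreover have "p \<in> ?A \<or> (odd p \<and> p \<ge> 37)" using prime_5_cases assms(2)[OF p] by blast
    ultimately show "p \<in> ?A \<union> ?B"
      by (auto elim!: oddE intro!: image_eqI[of _ _ "p div 2"])
  qed
  hence "(\<Sum>p\<in>P. ?f p) \<le> (\<Sum>p\<in>?A \<union> ?B. ?f p)" by (intro sum_mono2) auto
  also have "\<dots> \<le> (\<Sum>p\<in>?A. ?f p) + (\<Sum>p\<in>?B. ?f p)"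
    by (subst sum.union_inter[symmetric]) (auto intro!: sum_nonneg)
  also have "(\<Sum>p\<in>?B. ?f p) = (\<Sum>m\<in>{18..<N}. ?f (2 * m + 1))"
    by (subst sum.reindex) (auto simp: inj_on_def)
  also have "\<dots> \<le> 1 / 73" by (rule sum_odd_tail_le)
  also have "(\<Sum>p\<in>?A. ?f p) \<le> 0.0728" by simp
  finally show ?thesis by simp
qed


lemma card_prime_square_multiples_le:
  assumes "y \<ge> 1"
  shows "real (card {n \<in> {1..N}. \<exists>p. prime p \<and> p > y \<and> p ^ 2 dvd n}) \<le> real N / real y"
proof -
  let ?P = "{p. prime p \<and> y < p \<and> p \<le> N}"
  have "{n \<in> {1..N}. \<exists>p. prime p \<and> p > y \<and> p ^ 2 dvd n} \<subseteq> (\<Union>p\<in>?P. {n \<in> {1..N}. p ^ 2 dvd n})"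
  proof
    fix n assume "n \<in> {n \<in> {1..N}. \<exists>p. prime p \<and> p > y \<and> p ^ 2 dvd n}"
    then obtain p where p: "prime p" "p > y" "p ^ 2 dvd n" "1 \<le> n" "n \<le> N" by auto
    have "p \<le> p ^ 2" by (simp add: power2_eq_square)
    also have "p ^ 2 \<le> n" using p by (intro dvd_imp_le) auto
    finally show "n \<in> (\<Union>p\<in>?P. {n \<in> {1..N}. p ^ 2 dvd n})" using p by auto
  qed
  hence "card {n \<in> {1..N}. \<exists>p. prime p \<and> p > y \<and> p ^ 2 dvd n} \<le> card (\<Union>p\<in>?P. {n \<in> {1..N}. p ^ 2 dvd n})"
    by (intro card_mono) auto
  also have "\<dots> \<le> (\<Sum>p\<in>?P. card {n \<in> {1..N}. p ^ 2 dvd n})" by (rule card_UN_le) simp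
  finally have "real (card {n \<in> {1..N}. \<exists>p. prime p \<and> p > y \<and> p ^ 2 dvd n}) \<le> (\<Sum>p\<in>?P. real (card {n \<in> {1..N}. p ^ 2 dvd n}))"
    by (simp only: of_nat_le_iff flip: of_nat_sum)
  also have "\<dots> \<le> (\<Sum>p\<in>?P. real N * (1 / real p ^ 2))"
  proof (rule sum_mono)
    fix p assume "p \<in> ?P"
    hence "p ^ 2 > 0" by (auto simp: prime_gt_0_nat)
    from card_multiples_le[OF this, of N]
    show "real (card {n \<in> {1..N}. p ^ 2 dvd n}) \<le> real N * (1 / real p ^ 2)" by simp
  qed
  also have "\<dots> = real N * (\<Sum>p\<in>?P. 1 / real p ^ 2)" by (simp only: sum_distrib_left)
  also have "\<dots> \<le> real N * (1 / real y)"
    using assms by (intro mult_left_mono sum_inverse_squares_le) auto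
  finally show ?thesis by simp
qed

section \<open>Weights for the flow between residue classes modulo 3\<close>

definition chi3 :: "nat \<Rightarrow> real" where
  "chi3 n = (if n mod 3 = 1 then 1 else if n mod 3 = 2 then - 1 else 0)"

lemma chi3_mult: "chi3 (a * b) = chi3 a * chi3 b"
  unfolding chi3_def by (rule symbol3_mult)

lemma chi3_odd: "odd n \<Longrightarrow> chi3 n = psi n"
proof -
  assume "odd n"
  have "n mod 6 = 1 \<longleftrightarrow> n mod 3 = 1" "n mod 6 = 5 \<longleftrightarrow> n mod 3 = 2" using \<open>odd n\<close> by presburger+
  thus ?thesis by (simp add: chi3_def psi_def)
qed

lemma psi_even: "even n \<Longrightarrow> psi n = 0"
proof -
  assume "even n"
  hence "n mod 6 \<noteq> 1" "n mod 6 \<noteq> 5" by presburger+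
  thus ?thesis by (simp add: psi_def)
qed

text \<open>\<tau>(n) is the product of the exponents increased by one, and 3 divides
  \<open>e + 1\<close> exactly when \<open>e\<close> is 2 modulo 3.\<close>

lemma tau3_nonzero_iff:
  assumes "n > 0"
  shows "tau3 n \<noteq> 0 \<longleftrightarrow> (\<forall>p. prime p \<longrightarrow> multiplicity p n mod 3 \<noteq> 2)"
proof -
  have "tau3 n \<noteq> 0 \<longleftrightarrow> \<not> 3 dvd divisor_tau n"
  proof -
    have "d mod 3 = 1 \<or> d mod 3 = 2 \<longleftrightarrow> \<not> 3 dvd d" for d :: nat by presburger
    thus ?thesis by (auto simp: tau3_def)
  qed
  also have "\<dots> \<longleftrightarrow> (\<forall>p\<in>prime_factors n. \<not> 3 dvd multiplicity p n + 1)"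
    unfolding divisor_tau_eq_prod[OF assms] by (subst prime_dvd_prod_iff) auto
  also have "\<dots> \<longleftrightarrow> (\<forall>p. prime p \<longrightarrow> multiplicity p n mod 3 \<noteq> 2)"
  proof -
    have e: "3 dvd e + 1 \<longleftrightarrow> e mod 3 = 2" for e :: nat by presburger
    have "multiplicity p n mod 3 = 2 \<Longrightarrow> prime p \<Longrightarrow> p \<in> prime_factors n" for p
      using assms by (auto simp: prime_factors_multiplicity intro!: Nat.gr0I)
    moreover have "p \<in> prime_factors n \<Longrightarrow> prime p" for p by auto
    ultimately show ?thesis unfolding e by blast
  qed
  finally show ?thesis .
qed

definition valset :: "nat set" where "valset = {0, 1, 3, 4, 6, 7}"

text \<open>A 2-adic valuation in \<open>valset\<close> is not 2 modulo 3, so it does not force 3 to divide the number of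
  divisors, and it is small enough to be determined by the residue modulo 256.\<close>

definition wt2 :: "nat \<Rightarrow> real" where "wt2 e = (if e \<in> valset then 1 else 0)"

text \<open>At the prime 3 the weight is \<open>1/2\<close> for valuation 0, and \<open>-1\<close> for positive valuations that are
  not 2 modulo 3.\<close>

definition local_wt :: "nat \<Rightarrow> nat \<Rightarrow> real" where
  "local_wt p e = (if p = 2 then wt2 e
     else (if p = 3 \<and> e = 0 then 3 / 2 else 0) - (if p = 3 then 1 else - 1) * (if e mod 3 = 2 then 0 else 1))"

text \<open>At 2, \<open>219 / 256\<close> is the sum of \<open>(1 / 2) ^ (e + 1)\<close> over
  \<open>valset\<close>. At 3, the value is \<open>3 / 2 * (2 / 3) - (1 - 1 / 13)\<close>.\<close>

definition local_mean :: "nat \<Rightarrow> real" where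
  "local_mean p = (if p = 2 then 219 / 256 else if p = 3 then 1 / 13 else 1 - 1 / (real p ^ 2 + real p + 1))"

lemma abs_local_wt_le: "\<bar>local_wt p e\<bar> \<le> 1"
  by (auto simp: local_wt_def wt2_def)

lemma local_wt_sums:
  assumes "prime p"
  shows "(\<lambda>e. local_wt p e * ((1 - 1 / real p) * (1 / real p) ^ e)) sums local_mean p"
proof -
  have p1: "p > 1" using assms prime_gt_1_nat by blast
  consider "p = 2" | "p = 3" | "p \<noteq> 2" "p \<noteq> 3" by blast
  thus ?thesis
  proof cases
    case 1
    let ?f = "\<lambda>e. local_wt p e * ((1 - 1 / real p) * (1 / real p) ^ e)"
    have "?f sums (\<Sum>e\<in>valset. ?f e)"
      by (rule sums_finite) (auto simp: 1 local_wt_def wt2_def valset_def)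
    moreover have "(\<Sum>e\<in>valset. ?f e) = local_mean p"
      by (simp add: 1 local_wt_def wt2_def valset_def local_mean_def power_divide)
    ultimately show ?thesis by simp
  next
    case 2
    have "(\<lambda>e. (if e = 0 then 3 / 2 * ((1 - 1 / real p) * (1 / real p) ^ e) else 0)
        - (if e mod 3 = 2 then 0 else 1) * ((1 - 1 / real p) * (1 / real p) ^ e)) sums
        (3 / 2 * ((1 - 1 / real p) * (1 / real p) ^ 0) - (1 - 1 / (real p ^ 2 + real p + 1)))"
      by (intro sums_diff sums_single sums_pattern p1)
    moreover have "3 / 2 * ((1 - 1 / real p) * (1 / real p) ^ 0) - (1 - 1 / (real p ^ 2 + real p + 1)) = local_mean p"
      by (simp add: 2 local_mean_def)
    moreover have "(if e = 0 then 3 / 2 * ((1 - 1 / real p) * (1 / real p) ^ e) else 0)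
        - (if e mod 3 = 2 then 0 else 1) * ((1 - 1 / real p) * (1 / real p) ^ e) =
        local_wt p e * ((1 - 1 / real p) * (1 / real p) ^ e)" for e
      by (simp add: 2 local_wt_def left_diff_distrib)
    ultimately show ?thesis by simp
  next
    case 3
    thus ?thesis using sums_pattern[OF p1] by (simp add: local_wt_def local_mean_def)
  qed
qed

abbreviation primes_le :: "nat \<Rightarrow> nat set" where "primes_le y \<equiv> {p. prime p \<and> p \<le> y}"

definition main_wt :: "nat \<Rightarrow> nat \<Rightarrow> real" where
  "main_wt y n = (\<Prod>p\<in>primes_le y. local_wt p (multiplicity p n))"

text \<open>The mean loss of the classes 1 and 2 due to an \<open>n\<close> with 3 not dividing
  \<tau>(n): a multiple of 3 always moves into them, any other \<open>n\<close> leaves them in half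
  of the cases.\<close>

definition sgn3 :: "nat \<Rightarrow> real" where "sgn3 n = (if 3 dvd n then - 1 else 1 / 2)"

lemma primes_le_split:
  assumes "y \<ge> 3"
  shows "primes_le y = insert 2 (insert 3 {p. prime p \<and> 5 \<le> p \<and> p \<le> y})"
proof -
  have "p = 2 \<or> p = 3 \<or> 5 \<le> p" if "prime p" for p :: nat
  proof -
    have "p \<noteq> 4" using that prime_nat_iff[of 4] by (auto intro!: exI[of _ 2])
    thus ?thesis using prime_ge_2_nat[OF that] by linarith
  qed
  thus ?thesis using assms by auto
qed

text \<open>\<open>219 / 256 * (1 / 13) * (1 - 0.0866)\<close> exceeds 0.0601. The bound is
  independent of \<open>y\<close>, which leaves \<open>y\<close> free for the comparison with
  \<open>true_wt\<close>.\<close>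

lemma main_wt_has_mean:
  assumes "y \<ge> 3"
  obtains M where "has_mean (main_wt y) M" "M \<ge> 0.0601"
proof
  show "has_mean (main_wt y) (\<Prod>p\<in>primes_le y. local_mean p)"
    unfolding main_wt_def
    by (intro has_mean_finite_product) (auto simp: abs_local_wt_le local_wt_sums)
  let ?P = "{p. prime p \<and> 5 \<le> p \<and> p \<le> y}"
  have fin: "finite ?P" by (rule finite_subset[of _ "{..y}"]) auto
  have "(\<Prod>p\<in>primes_le y. local_mean p) = local_mean 2 * (local_mean 3 * (\<Prod>p\<in>?P. local_mean p))"
    unfolding primes_le_split[OF assms] using fin by simp
  also have "(\<Prod>p\<in>?P. local_mean p) = (\<Prod>p\<in>?P. 1 - 1 / (real p ^ 2 + real p + 1))"
    by (intro prod.cong refl) (auto simp: local_mean_def)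
  also have "local_mean 2 * (local_mean 3 * (\<Prod>p\<in>?P. 1 - 1 / (real p ^ 2 + real p + 1))) \<ge>
      local_mean 2 * (local_mean 3 * (1 - 0.0866))"
  proof -
    have "1 - (\<Sum>p\<in>?P. 1 / (real p ^ 2 + real p + 1)) \<le> (\<Prod>p\<in>?P. 1 - 1 / (real p ^ 2 + real p + 1))"
    proof (rule prod_one_minus_ge[OF fin])
      fix p :: nat
      have "0 \<le> 1 / q \<and> 1 / q \<le> 1" if "q \<ge> 1" for q :: real using that by simp
      moreover have "real p ^ 2 + real p + 1 \<ge> 1" by simp
      ultimately show "0 \<le> 1 / (real p ^ 2 + real p + 1) \<and> 1 / (real p ^ 2 + real p + 1) \<le> 1" by blast
    qed
    moreover have "(\<Sum>p\<in>?P. 1 / (real p ^ 2 + real p + 1)) \<le> 0.0866"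
      using fin by (intro sum_prime_deficits_le) auto
    ultimately have "1 - 0.0866 \<le> (\<Prod>p\<in>?P. 1 - 1 / (real p ^ 2 + real p + 1))" by linarith
    thus ?thesis by (intro mult_left_mono) (auto simp: local_mean_def)
  qed
  finally show "(\<Prod>p\<in>primes_le y. local_mean p) \<ge> 0.0601" by (simp add: local_mean_def)
qed

lemma main_wt_eq:
  assumes "y \<ge> 3" "n > 0"
  shows "main_wt y n = wt2 (multiplicity 2 n) * sgn3 n * (if \<forall>p\<in>primes_le y. multiplicity p n mod 3 \<noteq> 2 then 1 else 0)"
proof -
  let ?P = "{p. prime p \<and> 5 \<le> p \<and> p \<le> y}"
  have fin: "finite ?P" by (rule finite_subset[of _ "{..y}"]) auto
  have "main_wt y n = wt2 (multiplicity 2 n) * (local_wt 3 (multiplicity 3 n) * (\<Prod>p\<in>?P. local_wt p (multiplicity p n)))"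
    unfolding main_wt_def primes_le_split[OF assms(1)] using fin by (simp add: local_wt_def)
  also have "(\<Prod>p\<in>?P. local_wt p (multiplicity p n)) = (\<Prod>p\<in>?P. if multiplicity p n mod 3 \<noteq> 2 then 1 else 0)"
    by (intro prod.cong refl) (auto simp: local_wt_def)
  also have "\<dots> = (if \<forall>p\<in>?P. multiplicity p n mod 3 \<noteq> 2 then 1 else 0)"
    using fin by (auto intro!: prod.neutral prod_zero)
  also have "local_wt 3 (multiplicity 3 n) = sgn3 n * (if multiplicity 3 n mod 3 \<noteq> 2 then 1 else 0)"
  proof -
    have "multiplicity 3 n = 0 \<longleftrightarrow> \<not> 3 dvd n"
      using assms(2) by (subst prime_elem_multiplicity_eq_zero_iff) auto
    thus ?thesis by (auto simp: local_wt_def sgn3_def)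
  qed
  \<comment> \<open>No element of \<open>valset\<close> is 2 modulo 3, so the condition at the prime
    2 comes for free.\<close>
  also have "wt2 (multiplicity 2 n) = wt2 (multiplicity 2 n) * (if multiplicity 2 n mod 3 \<noteq> 2 then 1 else 0)"
    by (auto simp: wt2_def valset_def)
  finally show ?thesis unfolding primes_le_split[OF assms(1)] by auto
qed

definition true_wt :: "nat \<Rightarrow> real" where
  "true_wt n = wt2 (multiplicity 2 n) * sgn3 n * (tau3 n) ^ 2"

text \<open>The weights differ at \<open>n\<close> only if a prime above \<open>y\<close> has
  multiplicity 2 modulo 3, and then its square divides \<open>n\<close>.\<close>

lemma true_wt_close:
  assumes "y \<ge> 3"
  shows "\<bar>(\<Sum>n=1..N. true_wt n) - (\<Sum>n=1..N. main_wt y n)\<bar> \<le> real N / real y"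
proof -
  have "\<bar>(\<Sum>n=1..N. true_wt n) - (\<Sum>n=1..N. main_wt y n)\<bar> \<le> (\<Sum>n=1..N. \<bar>true_wt n - main_wt y n\<bar>)"
    using sum_abs[of "\<lambda>n. true_wt n - main_wt y n" "{1..N}"] by (simp add: sum_subtractf)
  also have "\<dots> \<le> (\<Sum>n=1..N. if \<exists>p. prime p \<and> p > y \<and> p ^ 2 dvd n then 1 else 0)"
  proof (rule sum_mono)
    fix n assume "n \<in> {1..N}"
    hence n: "n > 0" by simp
    define A where "A \<longleftrightarrow> (\<forall>p\<in>primes_le y. multiplicity p n mod 3 \<noteq> 2)"
    define s where "s = wt2 (multiplicity 2 n) * sgn3 n"
    have s: "\<bar>s\<bar> \<le> 1" by (simp add: s_def wt2_def sgn3_def)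
    have t2: "(tau3 n) ^ 2 = (if tau3 n \<noteq> 0 then 1 else 0)" by (simp add: tau3_def)
    have m: "main_wt y n = s * (if A then 1 else 0)" unfolding main_wt_eq[OF assms n] s_def A_def ..
    have t: "true_wt n = s * (if tau3 n \<noteq> 0 then 1 else 0)" unfolding true_wt_def t2 s_def ..
    show "\<bar>true_wt n - main_wt y n\<bar> \<le> (if \<exists>p. prime p \<and> p > y \<and> p ^ 2 dvd n then 1 else 0)"
    proof (cases "\<exists>p. prime p \<and> p > y \<and> p ^ 2 dvd n")
      case True
      thus ?thesis using s unfolding m t by auto
    next
      case False
      have big: "multiplicity p n mod 3 \<noteq> 2" if "prime p" "p > y" for p
      proof
        assume "multiplicity p n mod 3 = 2"
        hence "2 \<le> multiplicity p n" by presburger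
        hence "p ^ 2 dvd n" by (rule multiplicity_dvd')
        thus False using False that by blast
      qed
      have "A \<longleftrightarrow> tau3 n \<noteq> 0" unfolding A_def tau3_nonzero_iff[OF n]
        using big by (metis (no_types, lifting) mem_Collect_eq not_le)
      thus ?thesis unfolding m t by simp
    qed
  qed
  also have "\<dots> = real (card {n \<in> {1..N}. \<exists>p. prime p \<and> p > y \<and> p ^ 2 dvd n})"
    by (simp add: sum.If_cases Int_def)
  also have "\<dots> \<le> real N / real y" using assms by (intro card_prime_square_multiples_le) auto
  finally show ?thesis .
qed

text \<open>Writing \<open>n = 2 ^ v * m\<close> with \<open>m\<close> odd reduces this to
  \<open>psi_tau3_mean_zero\<close>: \<open>psi\<close> vanishes at even numbers, so the dilate by
  \<open>2 ^ a\<close> is supported on \<open>v = a\<close>, and \<open>valset\<close> is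
  finite.\<close>

lemma twisted_mean_zero: "has_mean (\<lambda>n. wt2 (multiplicity 2 n) * (chi3 n * tau3 n)) 0"
proof -
  let ?g = "\<lambda>j. psi j * tau3 j"
  let ?F = "\<lambda>n. \<Sum>a\<in>valset. (chi3 (2 ^ a) * tau3 (2 ^ a)) * dilate (2 ^ a) ?g n"
  have "has_mean ?F (\<Sum>a\<in>valset. (chi3 (2 ^ a) * tau3 (2 ^ a)) * (0 / real (2 ^ a)))"
    by (intro has_mean_sum has_mean_cmult has_mean_dilate psi_tau3_mean_zero) (auto simp: valset_def)
  hence F: "has_mean ?F 0" by simp
  have eq: "wt2 (multiplicity 2 n) * (chi3 n * tau3 n) = ?F n" if n: "n > 0" for n
  proof -
    define v where "v = multiplicity 2 n"
    define m where "m = n div 2 ^ v"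
    have nm: "n = 2 ^ v * m" unfolding m_def v_def by (simp add: multiplicity_dvd)
    have odd: "odd m" unfolding m_def v_def using n multiplicity_decompose[of n 2] by simp
    have dil: "dilate (2 ^ a) ?g n = (if a = v then ?g m else 0)" for a
    proof (cases "a \<le> v")
      case True
      then obtain c where c: "v = a + c" by (metis le_add_diff_inverse)
      have "n div 2 ^ a = 2 ^ c * m" by (simp add: nm c power_add mult.assoc)
      moreover have "2 ^ a dvd n" by (simp add: nm c power_add mult.assoc)
      moreover have "psi (2 ^ c * m) = 0" if "c \<noteq> 0" using that by (intro psi_even) simp
      ultimately show ?thesis by (cases "c = 0") (auto simp: dilate_def c)
    next
      case False
      hence "\<not> 2 ^ a dvd n"
        using n power_dvd_iff_le_multiplicity[of n 2 a] by (simp add: v_def)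
      thus ?thesis using False by (simp add: dilate_def)
    qed
    have "?F n = (\<Sum>a\<in>valset. if a = v then chi3 (2 ^ a) * tau3 (2 ^ a) * ?g m else 0)"
      unfolding dil by (intro sum.cong refl) simp
    also have "\<dots> = wt2 v * (chi3 (2 ^ v) * tau3 (2 ^ v) * ?g m)"
      by (simp add: wt2_def valset_def sum.delta)
    also have "chi3 (2 ^ v) * tau3 (2 ^ v) * ?g m = chi3 n * tau3 n"
      using tau3_prime_power_mult[of 2 m v] odd chi3_odd[OF odd] by (simp add: nm chi3_mult)
    finally show ?thesis by (simp add: v_def)
  qed
  have "(\<Sum>n=1..N. wt2 (multiplicity 2 n) * (chi3 n * tau3 n)) = (\<Sum>n=1..N. ?F n)" for N
    by (intro sum.cong refl eq) auto
  thus ?thesis using F unfolding has_mean_def by simp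
qed

text \<open>A check of nine residue pairs. The left side is the loss of the classes 1 and 2 at
  \<open>n\<close>. On the right, the first term is its average over the two nonzero residues of
  \<tau>(n), and the second its fluctuation, which has mean 0 by
  \<open>twisted_mean_zero\<close>.\<close>

lemma residue_identity:
  "(if 3 dvd n then 0 else 1) - (if 3 dvd n + divisor_tau n then 0 else 1) = sgn3 n * (tau3 n) ^ 2 - 1 / 2 * (chi3 n * tau3 n)"
proof -
  let ?t = "divisor_tau n"
  have d: "3 dvd n \<longleftrightarrow> n mod 3 = 0" "3 dvd n + ?t \<longleftrightarrow> (n mod 3 + ?t mod 3) mod 3 = 0"
    by (simp_all add: dvd_eq_mod_eq_0 mod_add_eq)
  have "n mod 3 < 3" "?t mod 3 < 3" by simp_all
  hence "n mod 3 \<in> {0, 1, 2}" "?t mod 3 \<in> {0, 1, 2}" by auto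
  thus ?thesis unfolding sgn3_def tau3_def chi3_def d
    by (elim insertE emptyE) (simp_all add: power2_eq_square)
qed

section \<open>Counting the integers that are not attained\<close>

definition deficit :: "nat \<Rightarrow> real" where
  "deficit N = (\<Sum>n=1..N. wt2 (multiplicity 2 n) * ((if 3 dvd n then 0 else 1) - (if 3 dvd n + divisor_tau n then 0 else 1)))"

lemma deficit_ge: "\<forall>\<^sub>F N in sequentially. deficit N \<ge> 0.06005 * real N"
proof -
  \<comment> \<open>The truncation at this \<open>y\<close> costs 0.00001, which fits between
    0.06008 and 0.06005.\<close>
  define y :: nat where "y = 100000"
  have y: "y \<ge> 3" by (simp add: y_def)
  obtain M where M: "has_mean (main_wt y) M" "M \<ge> 0.0601" using main_wt_has_mean[OF y] .
  let ?g = "\<lambda>n. wt2 (multiplicity 2 n) * (chi3 n * tau3 n)"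
  have "has_mean (\<lambda>n. main_wt y n - 1 / 2 * ?g n) (M - 1 / 2 * 0)"
    by (intro has_mean_diff has_mean_cmult M(1) twisted_mean_zero)
  hence "(\<lambda>N. (\<Sum>n=1..N. main_wt y n - 1 / 2 * ?g n) / real N) \<longlonglongrightarrow> M" by (simp add: has_mean_def)
  hence "\<forall>\<^sub>F N in sequentially. (\<Sum>n=1..N. main_wt y n - 1 / 2 * ?g n) / real N > 0.06008"
    using M(2) by (intro order_tendstoD(1)) auto
  thus ?thesis
    using eventually_ge_at_top[of 1]
  proof eventually_elim
    case (elim N)
    have "deficit N = (\<Sum>n=1..N. true_wt n - 1 / 2 * ?g n)"
      unfolding deficit_def residue_identity true_wt_def by (intro sum.cong refl) (simp add: algebra_simps)
    also have "\<dots> = (\<Sum>n=1..N. true_wt n) - (\<Sum>n=1..N. main_wt y n) + (\<Sum>n=1..N. main_wt y n - 1 / 2 * ?g n)"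
      by (simp add: sum_subtractf)
    also have "\<dots> \<ge> - (real N / real y) + 0.06008 * real N"
    proof (rule add_mono)
      show "- (real N / real y) \<le> (\<Sum>n=1..N. true_wt n) - (\<Sum>n=1..N. main_wt y n)"
        using true_wt_close[OF y, of N] by (simp only: abs_le_iff) linarith
      show "0.06008 * real N \<le> (\<Sum>n=1..N. main_wt y n - 1 / 2 * ?g n)"
        using elim by (simp add: less_divide_eq)
    qed
    finally show ?case by (simp add: y_def)
  qed
qed


text \<open>Most \<open>n\<close> are divisible by at least 8 primes of a long enough interval above
  \<open>y\<close>, and, \<open>y\<close> being large, by the square of none of them. Each such
  prime contributes a factor 2 to \<tau>(n).\<close>

lemma few_not_256_dvd_tau:
  assumes "\<epsilon> > 0"
  shows "\<forall>\<^sub>F N in sequentially. real (card {n \<in> {1..N}. \<not> 256 dvd divisor_tau n}) \<le> \<epsilon> * real N"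
proof -
  define y where "y = nat \<lceil>2 / \<epsilon>\<rceil> + 1"
  have y: "real y \<ge> 2 / \<epsilon>" "y \<ge> 1" unfolding y_def by linarith+
  obtain Y0 where Y0: "\<And>Y. Y \<ge> Y0 \<Longrightarrow> (\<Sum>p | prime p \<and> p \<le> Y. 1 / real p) \<ge> max 16 (16 / \<epsilon>) + (\<Sum>p | prime p \<and> p \<le> y. 1 / real p)"
    using sum_inverse_primes_unbounded by blast
  define Y where "Y = max Y0 y"
  define P where "P = {p. prime p \<and> y < p \<and> p \<le> Y}"
  define S where "S = (\<Sum>p\<in>P. 1 / real p)"
  have finP: "finite P" by (simp add: P_def)
  have "S \<ge> max 16 (16 / \<epsilon>)"
  proof -
    have "{p. prime p \<and> p \<le> Y} = {p. prime p \<and> p \<le> y} \<union> P" by (auto simp: P_def Y_def)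
    moreover have "(\<Sum>p\<in>{p. prime p \<and> p \<le> y} \<union> P. 1 / real p) = (\<Sum>p | prime p \<and> p \<le> y. 1 / real p) + S"
      unfolding S_def using finP by (intro sum.union_disjoint) (auto simp: P_def)
    ultimately show ?thesis using Y0[of Y] by (simp add: Y_def)
  qed
  \<comment> \<open>The first bound gives at least \<open>S / 2 \<ge> 8\<close> primes, the second
    makes the exceptional proportion at most \<open>\<epsilon> / 2\<close>.\<close>
  hence S: "S \<ge> 16" "S \<ge> 16 / \<epsilon>" by auto
  have main: "real (card {n \<in> {1..N}. \<not> 256 dvd divisor_tau n}) \<le> \<epsilon> * real N" if N: "N \<ge> 2 * card P" for N
  proof -
    let ?B = "{k \<in> {1..N}. \<bar>real (card {p \<in> P. p dvd k}) - S\<bar> \<ge> S / 2}"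
    let ?C = "{n \<in> {1..N}. \<exists>p. prime p \<and> p > y \<and> p ^ 2 dvd n}"
    have sub: "{n \<in> {1..N}. \<not> 256 dvd divisor_tau n} \<subseteq> ?B \<union> ?C"
    proof (rule ccontr)
      assume "\<not> ?thesis"
      then obtain n where n: "n \<in> {1..N}" "\<not> 256 dvd divisor_tau n" "n \<notin> ?B" "n \<notin> ?C" by blast
      let ?W = "{p \<in> P. p dvd n}"
      have "\<bar>real (card ?W) - S\<bar> < S / 2" using n(1,3) by simp
      hence "real (card ?W) \<ge> 8" using S(1) by linarith
      hence "8 \<le> card ?W" by linarith
      then obtain D where D: "D \<subseteq> ?W" "card D = 8" "finite D" using obtain_subset_with_card_n by blast
      have Dpf: "D \<subseteq> prime_factors n" using D(1) n(1) by (auto simp: P_def in_prime_factors_iff)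
      have mult1: "multiplicity p n = 1" if "p \<in> D" for p
      proof -
        have p: "prime p" "p > y" "p dvd n" using that D(1) by (auto simp: P_def)
        have "\<not> p ^ 2 dvd n" using n(1,4) p by blast
        moreover have "p ^ 2 dvd n" if "2 \<le> multiplicity p n" using that by (rule multiplicity_dvd')
        moreover have "multiplicity p n \<noteq> 0" using p n(1) by (subst prime_elem_multiplicity_eq_zero_iff) auto
        ultimately show ?thesis by linarith
      qed
      have "divisor_tau n = (\<Prod>p\<in>prime_factors n - D. multiplicity p n + 1) * (\<Prod>p\<in>D. multiplicity p n + 1)"
        using n(1) Dpf by (subst divisor_tau_eq_prod) (auto intro!: prod.subset_diff)
      also have "(\<Prod>p\<in>D. multiplicity p n + 1) = (\<Prod>p\<in>D. 2)" using mult1 by (intro prod.cong) auto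
      also have "\<dots> = 256" using D by simp
      finally show False using n(2) by simp
    qed
    have "real (card ?B) * (S / 2)\<^sup>2 \<le> real N * S + 2 * S * real (card P)"
      unfolding S_def using finP S(1) by (intro turan_deviation) (auto simp: P_def S_def)
    hence "real (card ?B) * (S / 4) * S \<le> (real N + 2 * real (card P)) * S"
      by (simp add: power2_eq_square algebra_simps)
    hence "real (card ?B) * (S / 4) \<le> real N + 2 * real (card P)" using S(1) by simp
    also have "\<dots> \<le> 2 * real N" using N by (simp flip: of_nat_le_iff)
    finally have 1: "real (card ?B) * (S / 4) \<le> 2 * real N" .
    have "real (card ?B) * (4 / \<epsilon>) \<le> real (card ?B) * (S / 4)" using S(2) by (intro mult_left_mono) auto
    with 1 have "real (card ?B) * (4 / \<epsilon>) \<le> 2 * real N" by linarith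
    hence B: "real (card ?B) \<le> \<epsilon> / 2 * real N" using assms by (simp add: field_simps)
    have "real (card ?C) \<le> real N / real y" by (rule card_prime_square_multiples_le[OF y(2)])
    also have "\<dots> \<le> real N / (2 / \<epsilon>)" using y assms by (intro divide_left_mono mult_pos_pos) auto
    finally have C: "real (card ?C) \<le> \<epsilon> / 2 * real N" by (simp add: mult.commute)
    have "card {n \<in> {1..N}. \<not> 256 dvd divisor_tau n} \<le> card ?B + card ?C"
      using card_mono[OF _ sub] card_Un_le[of ?B ?C] by auto
    thus ?thesis using B C by linarith
  qed
  show ?thesis by (rule eventually_sequentiallyI[of "2 * card P"]) (rule main)
qed

text \<open>The largest element of \<open>valset\<close> is 7, so membership is decided by
  divisibility by powers of 2 up to \<open>2 ^ 8\<close>.\<close>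

lemma valset_shift_256:
  assumes "k > 0"
  shows "multiplicity 2 (k + 256 * j) \<in> valset \<longleftrightarrow> multiplicity 2 (k::nat) \<in> valset"
proof -
  have dv: "2 ^ e dvd k + 256 * j \<longleftrightarrow> 2 ^ e dvd k" if "e \<le> 8" for e
  proof -
    have "(2::nat) ^ e dvd 2 ^ 8" using that by (rule le_imp_power_dvd)
    hence "2 ^ e dvd 256 * j" by simp
    thus ?thesis by (simp add: dvd_add_left_iff)
  qed
  have val: "multiplicity 2 n = a \<longleftrightarrow> 2 ^ a dvd n \<and> \<not> 2 ^ Suc a dvd n" if "n > 0" for n a :: nat
    using that power_dvd_iff_le_multiplicity[of n 2 a] power_dvd_iff_le_multiplicity[of n 2 "Suc a"]
    by (auto simp del: power_Suc)
  have "multiplicity 2 (k + 256 * j) = a \<longleftrightarrow> multiplicity 2 k = a" if "a < 8" for a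
    using assms dv[of a] dv[of "Suc a"] that val[of "k + 256 * j" a] val[of k a] by simp
  thus ?thesis by (auto simp: valset_def)
qed

text \<open>If 256 divides \<tau>(k), the 2-adic condition passes from \<open>k + \<tau>(k)\<close>
  back to \<open>k\<close>. So an attained number in \<open>?S\<close> comes from a \<open>k\<close>
  in \<open>?T\<close> or from an exceptional \<open>k\<close> in \<open>?Z\<close>, and
  \<open>k\<close> does not exceed its image. At least \<open>card ?S - card ?T - card ?Z\<close>
  numbers are therefore missed.\<close>

lemma card_image_le_deficit:
  "real (card {n. 0 < n \<and> n \<le> N \<and> (\<exists>k>0. n = k + divisor_tau k)}) \<le>
     real N - deficit N + real (card {n \<in> {1..N}. \<not> 256 dvd divisor_tau n})"
proof -
  let ?U = "{n. 0 < n \<and> n \<le> N \<and> (\<exists>k>0. n = k + divisor_tau k)}"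
  let ?S = "{n \<in> {1..N}. multiplicity 2 n \<in> valset \<and> \<not> 3 dvd n}"
  let ?T = "{n \<in> {1..N}. multiplicity 2 n \<in> valset \<and> \<not> 3 dvd n + divisor_tau n}"
  let ?Z = "{n \<in> {1..N}. \<not> 256 dvd divisor_tau n}"
  have "deficit N = (\<Sum>n=1..N. if multiplicity 2 n \<in> valset \<and> \<not> 3 dvd n then 1 else 0)
      - (\<Sum>n=1..N. if multiplicity 2 n \<in> valset \<and> \<not> 3 dvd n + divisor_tau n then 1 else 0)"
    unfolding deficit_def sum_subtractf[symmetric] by (intro sum.cong) (auto simp: wt2_def)
  hence d: "deficit N = real (card ?S) - real (card ?T)" by (simp add: sum.If_cases Int_def)
  have "?U \<subseteq> ({1..N} - ?S) \<union> (\<lambda>k. k + divisor_tau k) ` (?T \<union> ?Z)"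
  proof
    fix n assume "n \<in> ?U"
    then obtain k where k: "0 < n" "n \<le> N" "k > 0" "n = k + divisor_tau k" by auto
    show "n \<in> ({1..N} - ?S) \<union> (\<lambda>k. k + divisor_tau k) ` (?T \<union> ?Z)"
    proof (cases "n \<in> ?S")
      case True
      have kN: "k \<in> {1..N}" using k by simp
      have "k \<in> ?T \<union> ?Z"
      proof (cases "256 dvd divisor_tau k")
        case t: True
        then obtain j where "divisor_tau k = 256 * j" by auto
        hence "multiplicity 2 k \<in> valset" using valset_shift_256[OF k(3), of j] True k(4) by simp
        thus ?thesis using kN True k(4) by simp
      qed (use kN in simp)
      thus ?thesis using k(4) by blast
    qed (use k in simp)
  qed
  hence "card ?U \<le> card (({1..N} - ?S) \<union> (\<lambda>k. k + divisor_tau k) ` (?T \<union> ?Z))" by (intro card_mono) auto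
  also have "\<dots> \<le> card ({1..N} - ?S) + card ((\<lambda>k. k + divisor_tau k) ` (?T \<union> ?Z))" by (rule card_Un_le)
  also have "card ((\<lambda>k. k + divisor_tau k) ` (?T \<union> ?Z)) \<le> card (?T \<union> ?Z)" by (rule card_image_le) auto
  also have "card (?T \<union> ?Z) \<le> card ?T + card ?Z" by (rule card_Un_le)
  also have "card ({1..N} - ?S) = N - card ?S" by (subst card_Diff_subset) auto
  finally have "card ?U \<le> N - card ?S + (card ?T + card ?Z)" by simp
  moreover have "card ?S \<le> card {1..N}" by (intro card_mono) auto
  ultimately show ?thesis unfolding d by simp
qed

theorem N_plus_tau_upper: "\<exists>x0. \<forall>x \<ge> x0. real (N_plus_tau x) \<le> 0.94 * x"
proof -
  \<comment> \<open>The tolerance 0.00005 lowers the deficit 0.06005 to exactly the required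
    0.06.\<close>
  have "\<forall>\<^sub>F N in sequentially. real (card {n \<in> {1..N}. \<not> 256 dvd divisor_tau n}) \<le> 0.00005 * real N"
    by (rule few_not_256_dvd_tau) simp
  hence "\<forall>\<^sub>F N in sequentially. real (card {n. 0 < n \<and> n \<le> N \<and> (\<exists>k>0. n = k + divisor_tau k)}) \<le> 0.94 * real N"
    using deficit_ge
  proof eventually_elim
    case (elim N)
    thus ?case using card_image_le_deficit[of N] by simp
  qed
  then obtain N0 where N0: "\<And>N. N \<ge> N0 \<Longrightarrow>
      real (card {n. 0 < n \<and> n \<le> N \<and> (\<exists>k>0. n = k + divisor_tau k)}) \<le> 0.94 * real N"
    by (auto simp: eventually_at_top_linorder)
  have "real (N_plus_tau x) \<le> 0.94 * x" if x: "x \<ge> real N0" for x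
  proof -
    define N where "N = nat \<lfloor>x\<rfloor>"
    have x0: "x \<ge> 0" using x by (meson of_nat_0_le_iff order_trans)
    have "N \<ge> N0" unfolding N_def using x by (simp add: le_nat_floor)
    have "n \<le> N \<longleftrightarrow> real n \<le> x" for n unfolding N_def using x0 by (simp add: le_nat_iff le_floor_iff)
    hence "N_plus_tau x = card {n. 0 < n \<and> n \<le> N \<and> (\<exists>k>0. n = k + divisor_tau k)}"
      by (simp add: N_plus_tau_def)
    also have "real \<dots> \<le> 0.94 * real N" using N0[OF \<open>N \<ge> N0\<close>] .
    also have "\<dots> \<le> 0.94 * x" using x0 unfolding N_def by simp
    finally show ?thesis .
  qed
  thus ?thesis by blast
qed

theorem theorem2:
  shows "\<exists>c > 0. \<exists>x0 :: real. \<forall>x \<ge> x0.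
           c * x \<le> real (N_plus_tau x) \<and> real (N_plus_tau x) \<le> 0.94 * x"
proof -
  obtain c x1 where c: "c > 0" "\<And>x. x \<ge> x1 \<Longrightarrow> c * x \<le> real (N_plus_tau x)"
    using N_plus_tau_lower by blast
  obtain x2 where "\<And>x. x \<ge> x2 \<Longrightarrow> real (N_plus_tau x) \<le> 0.94 * x"
    using N_plus_tau_upper by blast
  with c show ?thesis by (intro exI[of _ c] conjI exI[of _ "max x1 x2"]) auto
qed

end
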